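(* Let $\mathbb{F}$ be a field of characteristic $0$ and let $\widetilde{\mathcal{SV}}$ be the extended Schrödinger-Virasoro Lie conformal algebra, i.e. the free $\mathbb{F}[\partial]$-module on $L,M,Y,N$ with non-zero $\lambda$-brackets on generators $[L_\lambda L]=(\partial+2\lambda)L$, $[L_\lambda M]=(\partial+\lambda)M$, $[L_\lambda Y]=(\partial+\tfrac32\lambda)Y$, $[M_\lambda L]=\lambda M$, $[Y_\lambda L]=(\tfrac12\partial+\tfrac32\lambda)Y$, $[Y_\lambda Y]=(\partial+2\lambda)M$, $[L_\lambda N]=(\partial+\lambda)N$, $[N_\lambda L]=\lambda N$, $[N_\lambda M]=2M$, $[M_\lambda N]=-2M$, $[N_\lambda Y]=Y$, $[Y_\lambda N]=-Y$. For $\Delta,\beta\in\mathbb{F}$ let $V_{\Delta,\beta,0}=\mathbb{F}[\partial]m$ be the $\widetilde{\mathcal{SV}}$-module, free of rank one over $\mathbb{F}[\partial]$, with $L_\lambda m=(\partial+\Delta\lambda)m$, $N_\lambda m=\beta m$, $M_\lambda m=Y_\lambda m=0$. If $\beta\notin\mathbb{Z}$ or $\beta$ is a negative integer, then $$\widetilde{\mathrm{H}}^\bullet(\widetilde{\mathcal{SV}},V_{\Delta,\beta,0})=\mathrm{H}^\bullet(\widetilde{\mathcal{SV}},V_{\Delta,\beta,0})=0,$$ i.e. the basic and reduced cohomology vanish in all degrees.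
   Context: Lie conformal algebra (LCA): an $\mathbb{F}[\partial]$-module $\mathcal{A}$ with an $\mathbb{F}$-bilinear $\lambda$-bracket $\mathcal{A}\otimes\mathcal{A}\to\mathcal{A}[\lambda]$, $a\otimes b\mapsto[a_\lambda b]$, such that $[\partial a_\lambda b]=-\lambda[a_\lambda b]$, $[a_\lambda\partial b]=(\partial+\lambda)[a_\lambda b]$, $[a_\lambda b]=-[b_{-\lambda-\partial}a]$, and $[a_\lambda[b_\mu c]]=[[a_\lambda b]_{\lambda+\mu}c]+[b_\mu[a_\lambda c]]$. The $\lambda$-bracket on $\mathbb{F}[\partial]$-generators determines it everywhere. An $\mathcal{A}$-module is an $\mathbb{F}[\partial]$-module $V$ with an $\mathbb{F}$-bilinear $\lambda$-action $a\otimes v\mapsto a_\lambda v\in V[\lambda]$ such that $(\partial a)_\lambda v=-\lambda a_\lambda v$, $a_\lambda(\partial v)=(\partial+\lambda)a_\lambda v$, $a_\lambda(b_\mu v)-b_\mu(a_\lambda v)=[a_\lambda b]_{\lambda+\mu}v$. Write $\partial^V$ for the action of $\partial$ on $V$. Basic complex: for $q\ge 1$, $\widetilde{C}^q(\mathcal{A},V)$ is the space of $\mathbb{F}$-linear maps $f:\mathcal{A}^{\otimes q}\to V[\lambda_1,\dots,\lambda_q]$, $a_1\otimes\cdots\otimes a_q\mapsto f_{\lambda_1,\dots,\lambda_q}(a_1,\dots,a_q)$, with $f_{\lambda_1,\dots,\lambda_q}(a_1,\dots,\partial a_i,\dots,a_q)=-\lambda_i f_{\lambda_1,\dots,\lambda_q}(a_1,\dots,a_q)$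 for all $i$, and skew-symmetric under simultaneous permutations of the $a_i$ and the $\lambda_i$. Also $\widetilde{C}^0(\mathcal{A},V)=V$. The differential is $$(\mathbf{d}f)_{\lambda_1,\dots,\lambda_{q+1}}(a_1,\dots,a_{q+1})=\sum_{k}(-1)^{k+1}a_{k\,\lambda_k}f_{\lambda_1,\dots,\hat\lambda_k,\dots,\lambda_{q+1}}(a_1,\dots,\hat a_k,\dots,a_{q+1})+\sum_{k<l}(-1)^{k+l}f_{\lambda_k+\lambda_l,\lambda_1,\dots,\hat\lambda_k,\dots,\hat\lambda_l,\dots,\lambda_{q+1}}([a_{k\,\lambda_k}a_l],a_1,\dots,\hat a_k,\dots,\hat a_l,\dots,a_{q+1}),$$ with $(\mathbf{d}v)_\lambda(a)=a_\lambda v$ for $v\in V$; hats denote omission, and polynomial coefficients in the $\lambda$'s are extended linearly. One has $\mathbf{d}^2=0$. Define $(\partial f)_{\lambda_1,\dots,\lambda_q}(a_1,\dots,a_q)=(\partial^V+\sum_{k=1}^q\lambda_k)f_{\lambda_1,\dots,\lambda_q}(a_1,\dots,a_q)$; then $\mathbf{d}\partial=\partial\mathbf{d}$. The reduced complex is $C^\bullet(\mathcal{A},V)=\widetilde{C}^\bullet(\mathcal{A},V)/\partial\widetilde{C}^\bullet(\mathcal{A},V)$. The basic cohomology $\widetilde{\mathrm{H}}^\bullet(\mathcal{A},V)$ is the cohomology of $\widetilde{C}^\bullet(\mathcal{A},V)$; the reduced cohomology $\mathrm{H}^\bullet(\mathcal{A},V)$ is the cohomology of $C^\bullet(\mathcal{A},V)$.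 Since $\mathbb{F}$ has characteristic $0$, $\mathbb{Z}$ is regarded as a subset of $\mathbb{F}$. *)

theory Defs
  imports
    "HOL-Library.Poly_Mapping"
    "HOL-Computational_Algebra.Polynomial"
    "HOL-Combinatorics.Permutations"
    "HOL-Algebra.Elementary_Groups"
begin

section \<open>Polynomials in \<open>\<lambda>\<^sub>0, \<lambda>\<^sub>1, \<dots>\<close> with coefficients in a module\<close>

text \<open>
  \<open>'v lpoly\<close> is \<open>V[\<lambda>\<^sub>0, \<lambda>\<^sub>1, \<dots>]\<close>: a finitely supported family of coefficients in \<open>V\<close>, indexed
  by monomials, a monomial being its exponent vector.  For a module \<open>V\<close> over a commutative ring
  \<open>R\<close>, \<open>V[\<lambda>\<^sub>0, \<lambda>\<^sub>1, \<dots>]\<close> is a module over \<open>R[\<lambda>\<^sub>0, \<lambda>\<^sub>1, \<dots>]\<close>.  Below, \<open>R\<close> is \<open>F[\<partial>]\<close>, rendered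
  as \<open>'a poly\<close>, so that an \<open>F[\<partial>]\<close>-module is a module over \<open>'a poly\<close>.
\<close>

type_synonym 'v lpoly = "(nat \<Rightarrow>\<^sub>0 nat) \<Rightarrow>\<^sub>0 'v"

definition lconst :: "'v::zero \<Rightarrow> 'v lpoly"
  where "lconst v = Poly_Mapping.single 0 v"

definition lvar :: "nat \<Rightarrow> 'r::comm_ring_1 lpoly"
  where "lvar i = Poly_Mapping.single (Poly_Mapping.single i 1) 1"

definition ldel :: "'a::comm_ring_1 poly lpoly"
  where "ldel = lconst [:0, 1:]"

definition lscale :: "('r::comm_ring_1 \<Rightarrow> 'v::ab_group_add \<Rightarrow> 'v) \<Rightarrow> 'r lpoly \<Rightarrow> 'v lpoly \<Rightarrow> 'v lpoly"
  where "lscale s P p = (\<Sum>m\<in>Poly_Mapping.keys P. \<Sum>n\<in>Poly_Mapping.keys p.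
    Poly_Mapping.single (m + n) (s (Poly_Mapping.lookup P m) (Poly_Mapping.lookup p n)))"

text \<open>
  \<open>leval s P p\<close> is \<open>p(P) = \<Sum>\<^sub>i P\<^sup>i p\<^sub>i\<close> for \<open>p = \<Sum>\<^sub>i \<lambda>\<^sup>i p\<^sub>i \<in> V[\<lambda>]\<close>.  As \<open>P\<close> ranges over
  \<open>F[\<partial>][\<lambda>\<^sub>0, \<lambda>\<^sub>1, \<dots>]\<close>, this covers the substitution of \<open>-\<lambda> - \<partial>\<close>, with \<open>\<partial>\<close> acting on the
  coefficients from the left.
\<close>

definition leval :: "('r::comm_ring_1 \<Rightarrow> 'v::ab_group_add \<Rightarrow> 'v) \<Rightarrow> 'r lpoly \<Rightarrow> 'v poly \<Rightarrow> 'v lpoly"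
  where "leval s P p = (\<Sum>i\<le>degree p. lscale s (P ^ i) (lconst (coeff p i)))"

text \<open>\<open>lsubst s Ps p\<close> substitutes the \<open>i\<close>-th entry of the list \<open>Ps\<close> for \<open>\<lambda>\<^sub>i\<close> in \<open>p\<close>.\<close>

definition lsubst :: "('r::comm_ring_1 \<Rightarrow> 'v::ab_group_add \<Rightarrow> 'v) \<Rightarrow> 'r lpoly list \<Rightarrow> 'v lpoly \<Rightarrow> 'v lpoly"
  where "lsubst s Ps p = (\<Sum>n\<in>Poly_Mapping.keys p.
    lscale s (\<Prod>i\<in>Poly_Mapping.keys n. (Ps ! i) ^ Poly_Mapping.lookup n i)
      (lconst (Poly_Mapping.lookup p n)))"

text \<open>
  The extension of \<open>g : U \<rightarrow> V[\<lambda>\<^sub>0, \<dots>]\<close> to \<open>U[\<lambda>\<^sub>0, \<dots>] \<rightarrow> V[\<lambda>\<^sub>0, \<dots>]\<close> that is linear with respect to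
  polynomial coefficients in the \<open>\<lambda>\<^sub>i\<close>.
\<close>

definition lext ::
  "('r::comm_ring_1 \<Rightarrow> 'v::ab_group_add \<Rightarrow> 'v) \<Rightarrow> ('u::zero \<Rightarrow> 'v lpoly) \<Rightarrow> 'u lpoly \<Rightarrow> 'v lpoly"
  where "lext s g p = (\<Sum>n\<in>Poly_Mapping.keys p.
    lscale s (Poly_Mapping.single n 1) (g (Poly_Mapping.lookup p n)))"


section \<open>Lie conformal algebras and their modules\<close>

text \<open>
  \<open>bracket a b\<close> is \<open>[a\<^sub>\<lambda> b] \<in> A[\<lambda>]\<close>, so \<open>pCons 0\<close> is multiplication by \<open>\<lambda>\<close> and \<open>map_poly\<close>
  applies an operator to the coefficients.  In the Jacobi identity, \<open>\<lambda>\<close> and \<open>\<mu>\<close> are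
  \<open>\<lambda>\<^sub>0\<close> and \<open>\<lambda>\<^sub>1\<close>.
\<close>

locale lie_conformal_algebra = module scale
  for scale :: "'a::field_char_0 poly \<Rightarrow> 'b::ab_group_add \<Rightarrow> 'b" +
  fixes bracket :: "'b \<Rightarrow> 'b \<Rightarrow> 'b poly"
  assumes bracket_add_left: "bracket (a + b) c = bracket a c + bracket b c"
    and bracket_add_right: "bracket a (b + c) = bracket a b + bracket a c"
    and bracket_scale_left: "bracket (scale [:t:] a) b = map_poly (scale [:t:]) (bracket a b)"
    and bracket_scale_right: "bracket a (scale [:t:] b) = map_poly (scale [:t:]) (bracket a b)"
    and bracket_del_left: "bracket (scale [:0, 1:] a) b = - pCons 0 (bracket a b)"
    and bracket_del_right:
      "bracket a (scale [:0, 1:] b) = map_poly (scale [:0, 1:]) (bracket a b) + pCons 0 (bracket a b)"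
    and bracket_skew:
      "leval scale (lvar 0) (bracket a b) = - leval scale (- lvar 0 - ldel) (bracket b a)"
    and bracket_jacobi:
      "lext scale (\<lambda>x. leval scale (lvar 0) (bracket a x)) (leval scale (lvar 1) (bracket b c)) =
       lext scale (\<lambda>x. leval scale (lvar 0 + lvar 1) (bracket x c)) (leval scale (lvar 0) (bracket a b)) +
       lext scale (\<lambda>x. leval scale (lvar 1) (bracket b x)) (leval scale (lvar 0) (bracket a c))"

locale lca_module = lie_conformal_algebra scale bracket + V: module scaleV
  for scale :: "'a::field_char_0 poly \<Rightarrow> 'b::ab_group_add \<Rightarrow> 'b"
    and bracket :: "'b \<Rightarrow> 'b \<Rightarrow> 'b poly"
    and scaleV :: "'a poly \<Rightarrow> 'v::ab_group_add \<Rightarrow> 'v" +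
  fixes act :: "'b \<Rightarrow> 'v \<Rightarrow> 'v poly"
  assumes act_add_left: "act (a + b) v = act a v + act b v"
    and act_add_right: "act a (v + w) = act a v + act a w"
    and act_scale_left: "act (scale [:t:] a) v = map_poly (scaleV [:t:]) (act a v)"
    and act_scale_right: "act a (scaleV [:t:] v) = map_poly (scaleV [:t:]) (act a v)"
    and act_del_left: "act (scale [:0, 1:] a) v = - pCons 0 (act a v)"
    and act_del_right:
      "act a (scaleV [:0, 1:] v) = map_poly (scaleV [:0, 1:]) (act a v) + pCons 0 (act a v)"
    and act_bracket:
      "lext scaleV (\<lambda>w. leval scaleV (lvar 0) (act a w)) (leval scaleV (lvar 1) (act b v)) -
       lext scaleV (\<lambda>w. leval scaleV (lvar 1) (act b w)) (leval scaleV (lvar 0) (act a v)) =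
       lext scaleV (\<lambda>x. leval scaleV (lvar 0 + lvar 1) (act x v)) (leval scale (lvar 0) (bracket a b))"


section \<open>The basic and the reduced complex\<close>

text \<open>The cohomology of a complex of abelian groups in degrees \<open>0, 1, 2, \<dots>\<close>, as a quotient group.\<close>

definition cohomology :: "(nat \<Rightarrow> 'c monoid) \<Rightarrow> (nat \<Rightarrow> 'c \<Rightarrow> 'c) \<Rightarrow> nat \<Rightarrow> 'c set monoid"
  where "cohomology C d q =
    ((C q)\<lparr>carrier := kernel (C q) (C (Suc q)) (d q)\<rparr>) Mod
    (case q of 0 \<Rightarrow> {\<one>\<^bsub>C 0\<^esub>} | Suc p \<Rightarrow> d p ` carrier (C p))"

definition omit :: "nat \<Rightarrow> 'c list \<Rightarrow> 'c list"
  where "omit k xs = take k xs @ drop (Suc k) xs"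

text \<open>
  A \<open>q\<close>-cochain is a function on lists \<open>[a\<^sub>0, \<dots>, a\<^bsub>q-1\<^esub>]\<close> of length \<open>q\<close> with values in
  \<open>V[\<lambda>\<^sub>0, \<dots>, \<lambda>\<^bsub>q-1\<^esub>]\<close>; by convention it is \<open>0\<close> on lists of any other length.  Indices start at \<open>0\<close>,
  which does not affect the signs in \<open>d\<close>: the exponents \<open>k + 1\<close> and \<open>k + l\<close> become \<open>k\<close> and \<open>k + l\<close>.
  A \<open>0\<close>-cochain is a polynomial in no variables, i.e.\ an element of \<open>V\<close>, placed on the empty list.
\<close>

context lca_module
begin

definition basic_cochains :: "nat \<Rightarrow> ('b list \<Rightarrow> 'v lpoly) set"
  where "basic_cochains q = {f.
    (\<forall>as. length as \<noteq> q \<longrightarrow> f as = 0) \<and>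
    (\<forall>as. \<forall>n\<in>Poly_Mapping.keys (f as). Poly_Mapping.keys n \<subseteq> {..<q}) \<and>
    (\<forall>as i x y. length as = q \<and> i < q \<longrightarrow> f (as[i := x + y]) = f (as[i := x]) + f (as[i := y])) \<and>
    (\<forall>as i t x. length as = q \<and> i < q \<longrightarrow>
      f (as[i := scale [:t:] x]) = lscale scaleV (lconst [:t:]) (f (as[i := x]))) \<and>
    (\<forall>as i x. length as = q \<and> i < q \<longrightarrow>
      f (as[i := scale [:0, 1:] x]) = lscale scaleV (- lvar i) (f (as[i := x]))) \<and>
    (\<forall>as \<pi>. length as = q \<and> \<pi> permutes {..<q} \<longrightarrow>
      lsubst scaleV (permute_list \<pi> (map lvar [0..<q])) (f (permute_list \<pi> as)) =
      lscale scaleV (of_int (sign \<pi>)) (f as))}"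

definition basic_group :: "nat \<Rightarrow> ('b list \<Rightarrow> 'v lpoly) monoid"
  where "basic_group q =
    \<lparr>carrier = basic_cochains q, monoid.mult = (\<lambda>f g as. f as + g as), one = (\<lambda>as. 0)\<rparr>"

text \<open>\<open>cochain_at f Ps as\<close> is \<open>f\<^bsub>P\<^sub>0, P\<^sub>1, \<dots>\<^esub>(a\<^sub>0, a\<^sub>1, \<dots>)\<close>.\<close>

definition cochain_at :: "('b list \<Rightarrow> 'v lpoly) \<Rightarrow> 'a poly lpoly list \<Rightarrow> 'b list \<Rightarrow> 'v lpoly"
  where "cochain_at f Ps as = lsubst scaleV Ps (f as)"

definition basic_diff :: "('b list \<Rightarrow> 'v lpoly) \<Rightarrow> 'b list \<Rightarrow> 'v lpoly"
  where "basic_diff f as = (let ls = map lvar [0..<length as] in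
    (\<Sum>k<length as. lscale scaleV ((- 1) ^ k)
      (lext scaleV (\<lambda>v. leval scaleV (lvar k) (act (as ! k) v))
        (cochain_at f (omit k ls) (omit k as)))) +
    (\<Sum>l<length as. \<Sum>k<l. lscale scaleV ((- 1) ^ (k + l))
      (lext scaleV
        (\<lambda>x. cochain_at f ((lvar k + lvar l) # omit k (omit l ls)) (x # omit k (omit l as)))
        (leval scale (lvar k) (bracket (as ! k) (as ! l))))))"

definition cochain_del :: "('b list \<Rightarrow> 'v lpoly) \<Rightarrow> 'b list \<Rightarrow> 'v lpoly"
  where "cochain_del f as = lscale scaleV (ldel + (\<Sum>k<length as. lvar k)) (f as)"

definition basic_cohomology :: "nat \<Rightarrow> ('b list \<Rightarrow> 'v lpoly) set monoid"
  where "basic_cohomology = cohomology basic_group (\<lambda>q. basic_diff)"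

definition reduced_group :: "nat \<Rightarrow> ('b list \<Rightarrow> 'v lpoly) set monoid"
  where "reduced_group q = basic_group q Mod (cochain_del ` basic_cochains q)"

text \<open>The map induced by \<open>d\<close> on cosets: all representatives of a coset have the same image coset.\<close>

definition reduced_diff :: "nat \<Rightarrow> ('b list \<Rightarrow> 'v lpoly) set \<Rightarrow> ('b list \<Rightarrow> 'v lpoly) set"
  where "reduced_diff q X =
    (\<Union>f\<in>X. cochain_del ` basic_cochains (Suc q) #>\<^bsub>basic_group (Suc q)\<^esub> basic_diff f)"

definition reduced_cohomology :: "nat \<Rightarrow> ('b list \<Rightarrow> 'v lpoly) set set monoid"
  where "reduced_cohomology = cohomology reduced_group reduced_diff"

end


section \<open>The extended Schroedinger-Virasoro Lie conformal algebra\<close>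

datatype sv_gen = gL | gM | gY | gN

text \<open>The free \<open>F[\<partial>]\<close>-module on a set of generators, as finitely supported functions.\<close>

definition free_scale :: "'r::comm_ring_1 \<Rightarrow> ('g \<Rightarrow>\<^sub>0 'r) \<Rightarrow> ('g \<Rightarrow>\<^sub>0 'r)"
  where "free_scale p x = Poly_Mapping.map ((*) p) x"

text \<open>
  \<open>sesq s p r w\<close> is \<open>p(-\<lambda>) r(\<partial> + \<lambda>) w\<close> for \<open>p, r \<in> F[\<partial>]\<close> and \<open>w \<in> V[\<lambda>]\<close>.  By sesquilinearity,
  this is \<open>[p(\<partial>)g\<^sub>\<lambda> r(\<partial>)h]\<close> when \<open>w = [g\<^sub>\<lambda> h]\<close>.
\<close>

definition op_poly :: "('a::comm_ring_1 poly \<Rightarrow> 'v::ab_group_add \<Rightarrow> 'v) \<Rightarrow>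
    ('v poly \<Rightarrow> 'v poly) \<Rightarrow> 'a poly \<Rightarrow> 'v poly \<Rightarrow> 'v poly"
  where "op_poly s T p w = (\<Sum>i\<le>degree p. map_poly (s [:coeff p i:]) ((T ^^ i) w))"

definition sesq :: "('a::comm_ring_1 poly \<Rightarrow> 'v::ab_group_add \<Rightarrow> 'v) \<Rightarrow>
    'a poly \<Rightarrow> 'a poly \<Rightarrow> 'v poly \<Rightarrow> 'v poly"
  where "sesq s p r w =
    op_poly s (\<lambda>u. - pCons 0 u) p
      (op_poly s (\<lambda>u. map_poly (s [:0, 1:]) u + pCons 0 u) r w)"

text \<open>
  The bracket of two generators, as a polynomial in \<open>\<lambda>\<close> with coefficients in the free module;
  e.g.\ the value at \<open>(L, L)\<close> is \<open>\<partial>L + \<lambda>(2L)\<close>.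
\<close>

fun sv_table :: "sv_gen \<Rightarrow> sv_gen \<Rightarrow> (sv_gen \<Rightarrow>\<^sub>0 'a::field_char_0 poly) poly" where
  "sv_table gL gL = [:Poly_Mapping.single gL [:0, 1:], Poly_Mapping.single gL [:2:]:]"
| "sv_table gL gM = [:Poly_Mapping.single gM [:0, 1:], Poly_Mapping.single gM [:1:]:]"
| "sv_table gL gY = [:Poly_Mapping.single gY [:0, 1:], Poly_Mapping.single gY [:3/2:]:]"
| "sv_table gM gL = [:0, Poly_Mapping.single gM [:1:]:]"
| "sv_table gY gL = [:Poly_Mapping.single gY [:0, 1/2:], Poly_Mapping.single gY [:3/2:]:]"
| "sv_table gY gY = [:Poly_Mapping.single gM [:0, 1:], Poly_Mapping.single gM [:2:]:]"
| "sv_table gL gN = [:Poly_Mapping.single gN [:0, 1:], Poly_Mapping.single gN [:1:]:]"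
| "sv_table gN gL = [:0, Poly_Mapping.single gN [:1:]:]"
| "sv_table gN gM = [:Poly_Mapping.single gM [:2:]:]"
| "sv_table gM gN = [:Poly_Mapping.single gM [:-2:]:]"
| "sv_table gN gY = [:Poly_Mapping.single gY [:1:]:]"
| "sv_table gY gN = [:Poly_Mapping.single gY [:-1:]:]"
| "sv_table _ _ = 0"

definition sv_bracket ::
  "(sv_gen \<Rightarrow>\<^sub>0 'a::field_char_0 poly) \<Rightarrow> (sv_gen \<Rightarrow>\<^sub>0 'a poly) \<Rightarrow> (sv_gen \<Rightarrow>\<^sub>0 'a poly) poly"
  where "sv_bracket x y = (\<Sum>g\<in>Poly_Mapping.keys x. \<Sum>h\<in>Poly_Mapping.keys y.
    sesq free_scale (Poly_Mapping.lookup x g) (Poly_Mapping.lookup y h) (sv_table g h))"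

text \<open>
  The module \<open>V\<^bsub>\<Delta>,\<beta>,0\<^esub> = F[\<partial>]m\<close> is \<open>'a poly\<close> with \<open>m = 1\<close> and multiplication as scalar action;
  \<open>sv_mod_table \<Delta> \<beta> g\<close> is \<open>g\<^sub>\<lambda> m\<close>.
\<close>

fun sv_mod_table :: "'a::field_char_0 \<Rightarrow> 'a \<Rightarrow> sv_gen \<Rightarrow> 'a poly poly" where
  "sv_mod_table \<Delta> \<beta> gL = [:[:0, 1:], [:\<Delta>:]:]"
| "sv_mod_table \<Delta> \<beta> gN = [:[:\<beta>:]:]"
| "sv_mod_table \<Delta> \<beta> gM = 0"
| "sv_mod_table \<Delta> \<beta> gY = 0"

definition sv_act ::
  "'a::field_char_0 \<Rightarrow> 'a \<Rightarrow> (sv_gen \<Rightarrow>\<^sub>0 'a poly) \<Rightarrow> 'a poly \<Rightarrow> 'a poly poly"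
  where "sv_act \<Delta> \<beta> x v =
    (\<Sum>g\<in>Poly_Mapping.keys x. sesq (*) (Poly_Mapping.lookup x g) v (sv_mod_table \<Delta> \<beta> g))"


section \<open>The brackets and actions above satisfy the axioms\<close>

text \<open>
  It remains to check that \<open>sv_bracket\<close> is a Lie conformal algebra and \<open>sv_act\<close> a module over it.
  By sesquilinearity, each identity only has to be verified on generators.
\<close>

lemma poly_mapping_additive_induct:
  assumes "\<And>k v. P (Poly_Mapping.single k v)" "\<And>a b. P a \<Longrightarrow> P b \<Longrightarrow> P (a + b)"
  shows "P (p :: 'm \<Rightarrow>\<^sub>0 'v::comm_monoid_add)"
proof (induction p rule: Poly_Mapping.update_induct)
  case const then show ?case using assms(1)[of undefined 0] by simp
next
  case (update f a b)
  have "Poly_Mapping.update a b f = f + Poly_Mapping.single a b"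
    using update by (intro poly_mapping_eqI)
      (auto simp: lookup_update lookup_add lookup_single when_def not_in_keys_iff_lookup_eq_zero)
  then show ?case using assms update by metis
qed

lemma lconst_add: "lconst (v + w) = lconst v + lconst w"
  by (simp add: lconst_def single_add)
lemma lconst_0 [simp]: "lconst 0 = 0"
  by (simp add: lconst_def)
lemma lconst_uminus: "lconst (- v) = - lconst v"
  by (simp add: lconst_def single_uminus)
lemma lconst_mult: "lconst (v * w) = lconst v * (lconst w :: 'r::comm_ring_1 lpoly)"
  by (simp add: lconst_def mult_single)
lemma lconst_1: "lconst 1 = (1 :: 'r::comm_ring_1 lpoly)"
  by (simp add: lconst_def)

context module begin

lemma lscale_superset:
  assumes "finite A" "finite B" "Poly_Mapping.keys P \<subseteq> A" "Poly_Mapping.keys p \<subseteq> B"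
  shows "lscale scale P p = (\<Sum>m\<in>A. \<Sum>n\<in>B.
    Poly_Mapping.single (m + n) (scale (Poly_Mapping.lookup P m) (Poly_Mapping.lookup p n)))"
proof -
  have 1: "(\<Sum>n\<in>Poly_Mapping.keys p.
      Poly_Mapping.single (m + n) (scale (Poly_Mapping.lookup P m) (Poly_Mapping.lookup p n)))
    = (\<Sum>n\<in>B. Poly_Mapping.single (m + n) (scale (Poly_Mapping.lookup P m) (Poly_Mapping.lookup p n)))" for m
    using assms by (intro sum.mono_neutral_left) (auto simp: not_in_keys_iff_lookup_eq_zero)
  show ?thesis unfolding lscale_def 1
    using assms by (intro sum.mono_neutral_left) (auto simp: not_in_keys_iff_lookup_eq_zero)
qed

lemma lscale_single [simp]:
  "lscale scale (Poly_Mapping.single m c) (Poly_Mapping.single n v) = Poly_Mapping.single (m + n) (scale c v)"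
  by (simp add: lscale_superset[of "{m}" "{n}"])

lemma lscale_add_left: "lscale scale (P + Q) p = lscale scale P p + lscale scale Q p"
proof -
  let ?A = "Poly_Mapping.keys P \<union> Poly_Mapping.keys Q \<union> Poly_Mapping.keys (P + Q)"
  have *: "lscale scale R p = (\<Sum>m\<in>?A. \<Sum>n\<in>Poly_Mapping.keys p.
    Poly_Mapping.single (m + n) (scale (Poly_Mapping.lookup R m) (Poly_Mapping.lookup p n)))"
    if "R \<in> {P, Q, P + Q}" for R
    using that by (intro lscale_superset) auto
  show ?thesis
    by (simp add: * lookup_add scale_left_distrib single_add sum.distrib)
qed

lemma lscale_add_right: "lscale scale P (p + q) = lscale scale P p + lscale scale P q"
proof -
  let ?B = "Poly_Mapping.keys p \<union> Poly_Mapping.keys q \<union> Poly_Mapping.keys (p + q)"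
  have *: "lscale scale P r = (\<Sum>m\<in>Poly_Mapping.keys P. \<Sum>n\<in>?B.
    Poly_Mapping.single (m + n) (scale (Poly_Mapping.lookup P m) (Poly_Mapping.lookup r n)))"
    if "r \<in> {p, q, p + q}" for r
    using that by (intro lscale_superset) auto
  show ?thesis
    by (simp add: * lookup_add scale_right_distrib single_add sum.distrib)
qed

lemma lscale_mult: "lscale scale (P * Q) p = lscale scale P (lscale scale Q p)"
proof (induction P rule: poly_mapping_additive_induct)
  case (1 k v) show ?case
  proof (induction Q rule: poly_mapping_additive_induct)
    case (1 k' v') show ?case
      by (induction p rule: poly_mapping_additive_induct)
         (simp_all add: lscale_add_right mult_single add.assoc)
  qed (simp_all add: lscale_add_left lscale_add_right distrib_left)
qed (simp_all add: lscale_add_left distrib_right)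

lemma lscale_1: "lscale scale 1 p = p"
proof -
  have "lscale scale (Poly_Mapping.single 0 1) p = p"
    by (induction p rule: poly_mapping_additive_induct) (simp_all add: lscale_add_right del: single_one)
  then show ?thesis by simp
qed

lemma module_lscale: "module (lscale scale)"
  by unfold_locales (simp_all add: lscale_add_left lscale_add_right lscale_mult lscale_1)

interpretation l: module "lscale scale" by (rule module_lscale)

lemma lscale_lconst: "lscale scale (lconst c) (lconst v) = lconst (scale c v)"
  by (simp add: lconst_def)

lemma leval_0 [simp]: "leval scale P 0 = 0"
  by (simp add: leval_def)

lemma leval_bound: assumes "degree p \<le> N"
  shows "leval scale P p = (\<Sum>i\<le>N. lscale scale (P ^ i) (lconst (coeff p i)))"
  unfolding leval_def using assms
  by (intro sum.mono_neutral_left) (auto simp: coeff_eq_0)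

lemma leval_add: "leval scale P (p + q) = leval scale P p + leval scale P q"
  using degree_add_le_max[of p q]
  by (simp add: leval_bound[of _ "max (degree p) (degree q)"] lconst_add lscale_add_right sum.distrib)

lemma leval_uminus: "leval scale P (- p) = - leval scale P p"
  using leval_add[of P p "-p"] by (simp add: eq_neg_iff_add_eq_0 add.commute)

lemma leval_pCons: "leval scale P (pCons v p) = lconst v + lscale scale P (leval scale P p)"
proof -
  have "leval scale P (pCons v p) = (\<Sum>i\<le>Suc (degree p). lscale scale (P ^ i) (lconst (coeff (pCons v p) i)))"
    by (rule leval_bound) (simp add: degree_pCons_le)
  also have "\<dots> = lconst v + (\<Sum>i\<le>degree p. lscale scale (P ^ Suc i) (lconst (coeff p i)))"
    by (subst sum.atMost_Suc_shift) (simp add: lscale_1)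
  finally show ?thesis by (simp add: leval_def l.scale_sum_right)
qed

lemma leval_map_poly: "leval scale P (map_poly (scale c) p) = lscale scale (lconst c) (leval scale P p)"
proof (induction p)
  case (pCons a p)
  have "map_poly (scale c) (pCons a p) = pCons (scale c a) (map_poly (scale c) p)"
    by (rule map_poly_pCons) simp
  then show ?case using pCons
    by (simp add: leval_pCons lscale_add_right lscale_lconst mult.commute)
qed simp

lemma lext_superset:
  assumes "finite B" "Poly_Mapping.keys p \<subseteq> B" "g 0 = 0"
  shows "lext scale g p = (\<Sum>n\<in>B. lscale scale (Poly_Mapping.single n 1) (g (Poly_Mapping.lookup p n)))"
  unfolding lext_def using assms
  by (intro sum.mono_neutral_left) (auto simp: not_in_keys_iff_lookup_eq_zero)

lemma lext_single: "g 0 = 0 \<Longrightarrow> lext scale g (Poly_Mapping.single n v) = lscale scale (Poly_Mapping.single n 1) (g v)"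
  by (simp add: lext_superset[of "{n}"])

lemma lext_lconst: "g 0 = 0 \<Longrightarrow> lext scale g (lconst v) = g v"
  by (simp add: lconst_def lext_single lscale_1)

lemma lext_add:
  assumes "\<And>x y. g (x + y) = g x + g (y :: 'u::ab_group_add)"
  shows "lext scale g (p + q) = lext scale g p + lext scale g q"
proof -
  have "g 0 = 0" using assms[of 0 0] by simp
  let ?B = "Poly_Mapping.keys p \<union> Poly_Mapping.keys q \<union> Poly_Mapping.keys (p + q)"
  have *: "lext scale g r = (\<Sum>n\<in>?B. lscale scale (Poly_Mapping.single n 1) (g (Poly_Mapping.lookup r n)))"
    if "r \<in> {p, q, p + q}" for r
    using that \<open>g 0 = 0\<close> by (intro lext_superset) auto
  show ?thesis
    by (simp add: * lookup_add assms lscale_add_right sum.distrib)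
qed

lemma lext_uminus:
  assumes "\<And>x y. g (x + y) = g x + g (y :: 'u::ab_group_add)"
  shows "lext scale g (- p) = - lext scale g p"
proof -
  have "g 0 = 0" using assms[of 0 0] by simp
  then have "lext scale g 0 = 0" by (simp add: lext_def)
  then show ?thesis
  using lext_add[OF assms, of p "-p"] by (simp add: eq_neg_iff_add_eq_0 add.commute)
qed

lemma lext_fun_add: "lext scale (\<lambda>x. g x + h x) p = lext scale g p + lext scale h p"
  by (simp add: lext_def lscale_add_right sum.distrib)
lemma lext_fun_uminus: "lext scale (\<lambda>x. - g x) p = - lext scale g p"
  by (simp add: lext_def sum_negf)
lemma lext_fun_lscale: "lext scale (\<lambda>x. lscale scale P (g x)) p = lscale scale P (lext scale g p)"
  by (simp add: lext_def l.scale_sum_right mult.commute)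

end

lemma lext_lscale_lconst:
  assumes "module s" "module t"
    and g: "\<And>x y. g (x + y) = g x + g (y :: 'u::ab_group_add)"
    and c: "\<And>x. g (t c x) = lscale s Q (g x)"
  shows "lext s g (lscale t (lconst c) p) = lscale s Q (lext s g p)"
proof -
  interpret s: module s by fact
  interpret t: module t by fact
  interpret ls: module "lscale s" by (rule s.module_lscale)
  have [simp]: "g 0 = 0" using g[of 0 0] by simp
  show ?thesis
  proof (induction p rule: poly_mapping_additive_induct)
    case (1 k v)
    then show ?case by (simp add: lconst_def s.lext_single c mult.commute)
  next
    case (2 a b)
    then show ?case by (simp add: t.lscale_add_right s.lext_add[of g, OF g] s.lscale_add_right)
  qed
qed

lemma lext_lscale_lvar:
  assumes "module s" "module t"
    and g: "\<And>x y. g (x + y) = g x + g (y :: 'u::ab_group_add)"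
  shows "lext s g (lscale t (lvar i) p) = lscale s (lvar i) (lext s g p)"
proof -
  interpret s: module s by fact
  interpret t: module t by fact
  interpret ls: module "lscale s" by (rule s.module_lscale)
  have [simp]: "g 0 = 0" using g[of 0 0] by simp
  show ?thesis
  proof (induction p rule: poly_mapping_additive_induct)
    case (1 k v)
    then show ?case by (simp add: lvar_def s.lext_single  mult_single)
  next
    case (2 a b)
    then show ?case by (simp add: t.lscale_add_right s.lext_add[of g, OF g] s.lscale_add_right)
  qed
qed

lemma map_poly_scale_pCons: "s 0 = 0 \<Longrightarrow> map_poly s (pCons a p) = pCons (s a) (map_poly s p)"
  by (rule map_poly_pCons)

lemma (in module) map_poly_scale_add:
  "map_poly (scale c) (p + q) = map_poly (scale c) p + map_poly (scale c) q"
  by (intro poly_eqI) (simp add: coeff_map_poly scale_right_distrib)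
lemma (in module) map_poly_scale_add_left:
  "map_poly (scale (c + d)) p = map_poly (scale c) p + map_poly (scale d) p"
  by (intro poly_eqI) (simp add: coeff_map_poly scale_left_distrib)
lemma (in module) map_poly_scale_uminus:
  "map_poly (scale c) (- p) = - map_poly (scale c) p"
  by (intro poly_eqI) (simp add: coeff_map_poly)
lemma (in module) map_poly_scale_mult:
  "map_poly (scale c) (map_poly (scale d) p) = map_poly (scale (c * d)) p"
  by (intro poly_eqI) (simp add: coeff_map_poly)
lemma (in module) map_poly_scale_1: "map_poly (scale 1) p = p"
  by (intro poly_eqI) (simp add: coeff_map_poly)
lemma (in module) map_poly_scale_0: "map_poly (scale 0) p = 0"
  by (intro poly_eqI) (simp add: coeff_map_poly)

locale pmod = module scale for scale :: "'a::comm_ring_1 poly \<Rightarrow> 'v::ab_group_add \<Rightarrow> 'v"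
begin

lemmas mps = map_poly_scale_add map_poly_scale_add_left map_poly_scale_uminus map_poly_scale_mult
  map_poly_scale_1 map_poly_scale_0

definition "shift = (\<lambda>u. map_poly (scale [:0, 1:]) u + pCons 0 u)"
definition "neg_lam = (\<lambda>u :: 'v poly. - pCons 0 u)"

definition "adm T \<longleftrightarrow> (\<forall>u w. T (u + w) = T u + T w) \<and> (\<forall>c u. T (map_poly (scale c) u) = map_poly (scale c) (T u))"

lemma pCons_sc: "pCons 0 (map_poly (scale c) u) = map_poly (scale c) (pCons 0 u)"
  by (simp add: map_poly_scale_pCons)

lemma pCons_0_add: "pCons 0 (u + w) = pCons 0 u + pCons 0 (w :: 'v poly)"
  by simp
lemma pCons_0_uminus: "pCons 0 (- u) = - pCons 0 (u :: 'v poly)"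
  by simp

lemma adm_map: "adm (map_poly (scale c))"
  by (simp add: adm_def mps mult.commute)

lemma adm_shift: "adm shift"
  by (simp add: adm_def shift_def mps pCons_sc pCons_0_add mult.commute add_ac del: add_pCons)

lemma adm_neg: "adm neg_lam"
  by (simp add: adm_def neg_lam_def mps pCons_sc pCons_0_add pCons_0_uminus del: add_pCons minus_pCons)

lemma shift_neg: "shift (neg_lam u) = neg_lam (shift u)"
  by (simp add: shift_def neg_lam_def mps pCons_sc pCons_0_add pCons_0_uminus del: add_pCons minus_pCons)

lemma adm_pow: "adm T \<Longrightarrow> adm (T ^^ n)"
  by (induction n) (auto simp: adm_def)

lemma adm_0: "adm T \<Longrightarrow> T 0 = 0"
  unfolding adm_def by (metis add_cancel_left_left)
lemma adm_sum: "adm T \<Longrightarrow> T (sum f A) = (\<Sum>i\<in>A. T (f i))"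
  by (induction A rule: infinite_finite_induct) (auto simp: adm_0 adm_def)

lemma op_poly_bound:
  assumes "degree p \<le> N"
  shows "op_poly scale T p w = (\<Sum>i\<le>N. map_poly (scale [:coeff p i:]) ((T ^^ i) w))"
  unfolding op_poly_def using assms
  by (intro sum.mono_neutral_left) (auto simp: coeff_eq_0 mps)

lemma op_poly_0 [simp]: "op_poly scale T 0 w = 0"
  by (simp add: op_poly_def mps)

lemma op_poly_pCons: assumes "adm T"
  shows "op_poly scale T (pCons c p) w = map_poly (scale [:c:]) w + T (op_poly scale T p w)"
proof -
  have "op_poly scale T (pCons c p) w = (\<Sum>i\<le>Suc (degree p). map_poly (scale [:coeff (pCons c p) i:]) ((T ^^ i) w))"
    by (rule op_poly_bound) (simp add: degree_pCons_le)
  also have "\<dots> = map_poly (scale [:c:]) w + (\<Sum>i\<le>degree p. map_poly (scale [:coeff p i:]) ((T ^^ Suc i) w))"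
    by (subst sum.atMost_Suc_shift) simp
  also have "(\<Sum>i\<le>degree p. map_poly (scale [:coeff p i:]) ((T ^^ Suc i) w)) = T (op_poly scale T p w)"
    using assms by (simp add: op_poly_def adm_sum[OF assms]) (simp add: adm_def)
  finally show ?thesis .
qed

lemma op_poly_add: "op_poly scale T (p + q) w = op_poly scale T p w + op_poly scale T q w"
proof -
  have *: "[:a + b:] = [:a:] + [:b:]" for a b :: 'a by simp
  show ?thesis
  using degree_add_le_max[of p q]
  by (simp add: op_poly_bound[of _ "max (degree p) (degree q)"] * mps sum.distrib del: add_pCons)
qed

lemma op_poly_smult: assumes "adm T"
  shows "op_poly scale T ([:c:] * p) w = map_poly (scale [:c:]) (op_poly scale T p w)"
proof (induction p)
  case (pCons a p)
  have [simp]: "T (map_poly (scale c) w) = map_poly (scale c) (T w)" for c w using assms by (auto simp: adm_def)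
  from pCons show ?case
    using op_poly_pCons[OF assms, of "c*a" "smult c p"] op_poly_pCons[OF assms, of "a" "p"]
    by (simp add: mps mult.commute[of c a])
qed (simp add: mps)

lemma op_poly_X: assumes "adm T"
  shows "op_poly scale T ([:0,1:] * p) w = T (op_poly scale T p w)"
  using op_poly_pCons[OF assms, of 0 p w] by (simp add: mps)

lemma op_poly_adm:
  assumes "adm T" shows "adm (op_poly scale T p)"
proof (induction p)
  case 0 then show ?case by (simp add: adm_def)
next
  case (pCons a p)
  then show ?case using assms
    by (auto simp: adm_def op_poly_pCons[OF assms] mps mult.commute algebra_simps)
qed

lemma op_poly_commute:
  assumes "adm T" "adm U" "\<And>u. U (T u) = T (U u)"
  shows "U (op_poly scale T p w) = op_poly scale T p (U w)"
proof (induction p)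
  case 0 then show ?case using assms by (simp add: adm_0)
next
  case (pCons a p)
  then show ?case using assms(2,3)
    by (auto simp: adm_def op_poly_pCons[OF assms(1)] )
qed

lemma sesq_alt: "sesq scale p r w = op_poly scale neg_lam p (op_poly scale shift r w)"
  unfolding sesq_def neg_lam_def shift_def ..

lemma sesq_simps:
  "sesq scale (p + p') r w = sesq scale p r w + sesq scale p' r w"
  "sesq scale p (r + r') w = sesq scale p r w + sesq scale p r' w"
  "sesq scale ([:c:] * p) r w = map_poly (scale [:c:]) (sesq scale p r w)"
  "sesq scale p ([:c:] * r) w = map_poly (scale [:c:]) (sesq scale p r w)"
  "sesq scale ([:0,1:] * p) r w = neg_lam (sesq scale p r w)"
  "sesq scale p ([:0,1:] * r) w = shift (sesq scale p r w)"
  unfolding sesq_alt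
  using op_poly_adm[OF adm_neg, of p]
  by (auto simp only: op_poly_add op_poly_smult[OF adm_neg] op_poly_smult[OF adm_shift]
    op_poly_X[OF adm_neg] op_poly_X[OF adm_shift] adm_def op_poly_commute[OF adm_neg adm_shift shift_neg])

lemma sesq_0: "sesq scale 0 r w = 0"  "sesq scale p 0 w = 0"
  unfolding sesq_alt using adm_0[OF op_poly_adm[OF adm_neg, of p]] by auto

lemma sesq_1: "sesq scale 1 1 w = w"
  unfolding sesq_alt by (simp add: one_pCons op_poly_def mps) (simp flip: one_pCons add: mps)

end

lemma keys_sum_single:
  assumes "\<And>k. F k 0 = (0::'c::ab_group_add)"
  shows "(\<Sum>k\<in>Poly_Mapping.keys (Poly_Mapping.single a p). F k (Poly_Mapping.lookup (Poly_Mapping.single a p) k)) = F a p"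
  using assms by (auto simp: keys_single)

lemma keys_sum_UNIV:
  assumes "\<And>k. F k 0 = (0::'c::ab_group_add)"
  shows "(\<Sum>k\<in>Poly_Mapping.keys x. F k (Poly_Mapping.lookup x k)) = (\<Sum>k\<in>{gL,gM,gY,gN}. F k (Poly_Mapping.lookup x k))"
proof -
  have "Poly_Mapping.keys x \<subseteq> {gL,gM,gY,gN}" using sv_gen.exhaust by blast
  then show ?thesis using assms by (intro sum.mono_neutral_left) (auto simp: not_in_keys_iff_lookup_eq_zero)
qed

lemma lookup_free_scale [simp]: "Poly_Mapping.lookup (free_scale p x) k = p * Poly_Mapping.lookup x k"
  by (simp add: free_scale_def Poly_Mapping.map.rep_eq when_def)

lemma module_free_scale: "module (free_scale :: 'r::comm_ring_1 \<Rightarrow> _)"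
  by unfold_locales (auto intro!: poly_mapping_eqI simp: lookup_add algebra_simps)

lemma module_times: "module ((*) :: 'r::comm_ring_1 \<Rightarrow> _)"
  by unfold_locales (auto simp: algebra_simps)

locale sesq_act = sU: module sU + sV: module sV + sW: module sW
  for sU :: "'a::comm_ring_1 poly \<Rightarrow> 'u::ab_group_add \<Rightarrow> 'u"
  and sV :: "'a poly \<Rightarrow> 'v::ab_group_add \<Rightarrow> 'v"
  and sW :: "'a poly \<Rightarrow> 'w::ab_group_add \<Rightarrow> 'w" +
  fixes act :: "'u \<Rightarrow> 'v \<Rightarrow> 'w poly"
  assumes add_l: "act (a + b) v = act a v + act b v"
    and add_r: "act a (v + w) = act a v + act a w"
    and sc_l: "act (sU [:t:] a) v = map_poly (sW [:t:]) (act a v)"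
    and sc_r: "act a (sV [:t:] v) = map_poly (sW [:t:]) (act a v)"
    and del_l: "act (sU [:0, 1:] a) v = - pCons 0 (act a v)"
    and del_r: "act a (sV [:0, 1:] v) = map_poly (sW [:0, 1:]) (act a v) + pCons 0 (act a v)"
begin

lemma le:
  "leval sW P (act (a + b) v) = leval sW P (act a v) + leval sW P (act b v)"
  "leval sW P (act a (v + w)) = leval sW P (act a v) + leval sW P (act a w)"
  "leval sW P (act (sU [:t:] a) v) = lscale sW (lconst [:t:]) (leval sW P (act a v))"
  "leval sW P (act a (sV [:t:] v)) = lscale sW (lconst [:t:]) (leval sW P (act a v))"
  "leval sW P (act (sU [:0,1:] a) v) = lscale sW (- P) (leval sW P (act a v))"
  "leval sW P (act a (sV [:0,1:] v)) = lscale sW (ldel + P) (leval sW P (act a v))"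
proof -
  interpret l: module "lscale sW" by (rule sW.module_lscale)
  show
  "leval sW P (act (a + b) v) = leval sW P (act a v) + leval sW P (act b v)"
  "leval sW P (act a (v + w)) = leval sW P (act a v) + leval sW P (act a w)"
  "leval sW P (act (sU [:t:] a) v) = lscale sW (lconst [:t:]) (leval sW P (act a v))"
  "leval sW P (act a (sV [:t:] v)) = lscale sW (lconst [:t:]) (leval sW P (act a v))"
  "leval sW P (act (sU [:0,1:] a) v) = lscale sW (- P) (leval sW P (act a v))"
  "leval sW P (act a (sV [:0,1:] v)) = lscale sW (ldel + P) (leval sW P (act a v))"
  by (simp_all add: add_l add_r sc_l sc_r del_l del_r sW.leval_add sW.leval_map_poly sW.leval_pCons sW.leval_uminus
     ldel_def l.scale_left_distrib)
qed

lemma zero: "act 0 v = 0" "act a 0 = 0"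
  using add_l[of 0 0 v] add_r[of a 0 0] by auto

lemma le0: "leval sW P (act 0 v) = 0" "leval sW P (act a 0) = 0"
  by (simp_all add: zero)

lemma extR_simps:
  "lext sW (\<lambda>w. leval sW P (act a w)) (p + q) = lext sW (\<lambda>w. leval sW P (act a w)) p + lext sW (\<lambda>w. leval sW P (act a w)) q"
  "lext sW (\<lambda>w. leval sW P (act a w)) (- p) = - lext sW (\<lambda>w. leval sW P (act a w)) p"
  "lext sW (\<lambda>w. leval sW P (act a w)) (lconst w) = leval sW P (act a w)"
  "lext sW (\<lambda>w. leval sW P (act a w)) (lscale sV (lvar i) p) = lscale sW (lvar i) (lext sW (\<lambda>w. leval sW P (act a w)) p)"
  "lext sW (\<lambda>w. leval sW P (act a w)) (lscale sV (lconst [:t:]) p) = lscale sW (lconst [:t:]) (lext sW (\<lambda>w. leval sW P (act a w)) p)"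
  "lext sW (\<lambda>w. leval sW P (act a w)) (lscale sV ldel p) = lscale sW (ldel + P) (lext sW (\<lambda>w. leval sW P (act a w)) p)"
  unfolding ldel_def[where 'a='a and ?'a='a]
  by (rule sW.lext_add sW.lext_uminus sW.lext_lconst lext_lscale_lvar[OF sW.module_axioms sV.module_axioms]
      lext_lscale_lconst[OF sW.module_axioms sV.module_axioms]; simp add: le le0 flip: ldel_def)+

lemma extL_simps:
  "lext sW (\<lambda>x. leval sW P (act x v)) (p + q) = lext sW (\<lambda>x. leval sW P (act x v)) p + lext sW (\<lambda>x. leval sW P (act x v)) q"
  "lext sW (\<lambda>x. leval sW P (act x v)) (- p) = - lext sW (\<lambda>x. leval sW P (act x v)) p"
  "lext sW (\<lambda>x. leval sW P (act x v)) (lconst x) = leval sW P (act x v)"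
  "lext sW (\<lambda>x. leval sW P (act x v)) (lscale sU (lvar i) p) = lscale sW (lvar i) (lext sW (\<lambda>x. leval sW P (act x v)) p)"
  "lext sW (\<lambda>x. leval sW P (act x v)) (lscale sU (lconst [:t:]) p) = lscale sW (lconst [:t:]) (lext sW (\<lambda>x. leval sW P (act x v)) p)"
  "lext sW (\<lambda>x. leval sW P (act x v)) (lscale sU ldel p) = lscale sW (- P) (lext sW (\<lambda>x. leval sW P (act x v)) p)"
  unfolding ldel_def[where 'a='a and ?'a='a]
  by (rule sW.lext_add sW.lext_uminus sW.lext_lconst lext_lscale_lvar[OF sW.module_axioms sU.module_axioms]
      lext_lscale_lconst[OF sW.module_axioms sU.module_axioms]; simp add: le le0 flip: ldel_def)+

lemmas ext_simps = extR_simps extL_simps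

end

locale pre_mod = A: module sA + V: module sV + B: sesq_act sA sA sA br + M: sesq_act sA sV sV act for sA :: "'a::comm_ring_1 poly \<Rightarrow> 'b::ab_group_add \<Rightarrow> 'b" and sV :: "'a poly \<Rightarrow> 'v::ab_group_add \<Rightarrow> 'v" and br act
begin

definition "J a b v =
  lext sV (\<lambda>w. leval sV (lvar 0) (act a w)) (leval sV (lvar 1) (act b v)) -
       lext sV (\<lambda>w. leval sV (lvar 1) (act b w)) (leval sV (lvar 0) (act a v)) -
       lext sV (\<lambda>x. leval sV (lvar 0 + lvar 1) (act x v)) (leval sA (lvar 0) (br a b))"

sublocale lV: module "lscale sV" by (rule V.module_lscale)
sublocale lA: module "lscale sA" by (rule A.module_lscale)

lemma J_add:
  "J (a + a') b v = J a b v + J a' b v"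
  "J a (b + b') v = J a b v + J a b' v"
  "J a b (v + v') = J a b v + J a b v'"
  by (simp_all add: J_def M.le B.le M.ext_simps V.lext_fun_add algebra_simps)

lemma J_sc:
  "J (sA [:t:] a) b v = lscale sV (lconst [:t:]) (J a b v)"
  "J a (sA [:t:] b) v = lscale sV (lconst [:t:]) (J a b v)"
  "J a b (sV [:t:] v) = lscale sV (lconst [:t:]) (J a b v)"
  by (simp_all add: J_def M.le B.le M.ext_simps V.lext_fun_lscale lV.scale_right_diff_distrib)

lemma J_del:
  "J (sA [:0,1:] a) b v = lscale sV (- lvar 0) (J a b v)"
  "J a (sA [:0,1:] b) v = lscale sV (- lvar 1) (J a b v)"
  "J a b (sV [:0,1:] v) = lscale sV (ldel + lvar 0 + lvar 1) (J a b v)"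
  by (simp_all add: J_def M.le B.le M.ext_simps V.lext_fun_lscale V.lext_fun_add V.lext_fun_uminus lV.scale_right_diff_distrib lV.scale_left_distrib lA.scale_left_distrib lV.scale_left_diff_distrib algebra_simps)

end

lemma free_induct:
  assumes add: "\<And>x y. P x \<Longrightarrow> P y \<Longrightarrow> P (x + y)"
    and sc: "\<And>x c. P x \<Longrightarrow> P (free_scale [:c:] x)"
    and del: "\<And>x. P x \<Longrightarrow> P (free_scale [:0,1:] x)"
    and gen: "\<And>g. P (Poly_Mapping.single g 1)"
  shows "P (x :: 'g \<Rightarrow>\<^sub>0 'a::comm_ring_1 poly)"
proof (induction x rule: poly_mapping_additive_induct)
  case (1 g p)
  show ?case
  proof (induction p)
    case 0
    have "free_scale [:0:] (Poly_Mapping.single g 1) = Poly_Mapping.single g (0 :: 'a poly)"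
      by (simp add: module.scale_zero_left[OF module_free_scale])
    then show ?case using sc[OF gen, of 0 g] by simp
  next
    case (pCons c p)
    have "Poly_Mapping.single g (pCons c p) = free_scale [:c:] (Poly_Mapping.single g 1) + free_scale [:0,1:] (Poly_Mapping.single g p)"
      by (intro poly_mapping_eqI) (auto simp: lookup_add lookup_single when_def)
    then show ?case using add[OF sc[OF gen] del[OF pCons(2)]] by simp
  qed
qed (rule add)

lemma poly_module_induct:
  assumes add: "\<And>x y. P x \<Longrightarrow> P y \<Longrightarrow> P (x + y)"
    and sc: "\<And>x c. P x \<Longrightarrow> P ([:c:] * x)"
    and del: "\<And>x. P x \<Longrightarrow> P ([:0,1:] * x)"
    and gen: "P 1"
  shows "P (x :: 'a::comm_ring_1 poly)"
proof (induction x)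
    case 0
    then show ?case using sc[OF gen, of 0] by simp
  next
    case (pCons c p)
    have "pCons c p = [:c:] * 1 + [:0,1:] * p" by (simp)
    then show ?case using add[OF sc[OF gen, of c] del[OF pCons(2)]] by simp
qed

context
begin

interpretation fr: pmod "free_scale :: 'a::comm_ring_1 poly \<Rightarrow> ('g \<Rightarrow>\<^sub>0 _) \<Rightarrow> _"
  unfolding pmod_def by (rule module_free_scale)

lemma sv_bracket_UNIV: "sv_bracket x y = (\<Sum>g\<in>{gL,gM,gY,gN}. \<Sum>h\<in>{gL,gM,gY,gN}.
    sesq free_scale (Poly_Mapping.lookup x g) (Poly_Mapping.lookup y h) (sv_table g h))"
  unfolding sv_bracket_def
  by (subst keys_sum_UNIV, simp add: fr.sesq_0, intro sum.cong refl keys_sum_UNIV, simp add: fr.sesq_0)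

interpretation ti: pmod "(*) :: 'a::comm_ring_1 poly \<Rightarrow> _"
  unfolding pmod_def by (rule module_times)

lemma sv_act_UNIV: "sv_act D B x v = (\<Sum>g\<in>{gL,gM,gY,gN}.
    sesq (*) (Poly_Mapping.lookup x g) v (sv_mod_table D B g))"
  unfolding sv_act_def
  by (subst keys_sum_UNIV) (auto simp: ti.sesq_0)

lemma sv_bracket_sesq:
  "sv_bracket (x + x') y = sv_bracket x y + sv_bracket x' y"
  "sv_bracket x (y + y') = sv_bracket x y + sv_bracket x y'"
  "sv_bracket (free_scale [:c:] x) y = map_poly (free_scale [:c:]) (sv_bracket x y)"
  "sv_bracket x (free_scale [:c:] y) = map_poly (free_scale [:c:]) (sv_bracket x y)"
  "sv_bracket (free_scale [:0,1:] x) y = fr.neg_lam (sv_bracket x y)"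
  "sv_bracket x (free_scale [:0,1:] y) = fr.shift (sv_bracket x y)"
  unfolding sv_bracket_UNIV lookup_free_scale lookup_add fr.sesq_simps
  by (simp_all only: sum.distrib fr.adm_sum[OF fr.adm_neg] fr.adm_sum[OF fr.adm_shift] fr.adm_sum[OF fr.adm_map])

lemma sv_act_sesq:
  "sv_act D B (x + x') y = sv_act D B x y + sv_act D B x' y"
  "sv_act D B x (y + y') = sv_act D B x y + sv_act D B x y'"
  "sv_act D B (free_scale [:c:] x) y = map_poly ((*) [:c:]) (sv_act D B x y)"
  "sv_act D B x ([:c:] * y) = map_poly ((*) [:c:]) (sv_act D B x y)"
  "sv_act D B (free_scale [:0,1:] x) y = ti.neg_lam (sv_act D B x y)"
  "sv_act D B x ([:0,1:] * y) = ti.shift (sv_act D B x y)"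
  unfolding sv_act_UNIV lookup_free_scale lookup_add ti.sesq_simps
  by (simp_all only: sum.distrib ti.adm_sum[OF ti.adm_neg] ti.adm_sum[OF ti.adm_shift] ti.adm_sum[OF ti.adm_map])

lemma sv_bracket_gen: "sv_bracket (Poly_Mapping.single g 1) (Poly_Mapping.single h 1) = sv_table g h"
  by (simp add: sv_bracket_def fr.sesq_1)
lemma sv_act_gen: "sv_act D B (Poly_Mapping.single g 1) 1 = sv_mod_table D B g"
  by (simp add: sv_act_def ti.sesq_1)

interpretation sv_br: sesq_act free_scale free_scale free_scale "sv_bracket :: _ \<Rightarrow> _ \<Rightarrow> (sv_gen \<Rightarrow>\<^sub>0 'a::field_char_0 poly) poly"
  unfolding sesq_act_def sesq_act_axioms_def
  by (simp add: module_free_scale sv_bracket_sesq fr.neg_lam_def fr.shift_def)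

interpretation sv_ac: sesq_act free_scale "(*)" "(*)" "sv_act D B" for D B :: "'a::field_char_0"
  unfolding sesq_act_def sesq_act_axioms_def
  using sv_act_sesq[of D B]
  by (simp add: module_free_scale module_times ti.neg_lam_def ti.shift_def del: mult_pCons_left)

interpretation svA: pre_mod free_scale free_scale sv_bracket "sv_bracket :: _ \<Rightarrow> _ \<Rightarrow> (sv_gen \<Rightarrow>\<^sub>0 'a::field_char_0 poly) poly"
  by unfold_locales
interpretation svV: pre_mod free_scale "(*)" sv_bracket  "sv_act D B" for D B :: "'a::field_char_0"
  by unfold_locales

definition "lgen g = lconst (Poly_Mapping.single g 1)"
lemma lconst_single_1: "lconst (Poly_Mapping.single g [:c:]) = lscale free_scale (lconst [:c:]) (lgen g)"
  and lconst_single_2: "lconst (Poly_Mapping.single g [:c,d:]) = lscale free_scale (lconst [:c:] + lconst [:d:] * ldel) (lgen g)"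
proof -
  have a: "free_scale p (Poly_Mapping.single g 1) = Poly_Mapping.single g p" for p
    by (intro poly_mapping_eqI) (auto simp: lookup_single when_def)
  have b: "lconst [:c:] + lconst [:d:] * ldel = lconst [:c,d:]"
    by (simp add: ldel_def flip: lconst_mult lconst_add)
  show "lconst (Poly_Mapping.single g [:c:]) = lscale free_scale (lconst [:c:]) (lgen g)"
   "lconst (Poly_Mapping.single g [:c,d:]) = lscale free_scale (lconst [:c:] + lconst [:d:] * ldel) (lgen g)"
    unfolding lgen_def b by (simp_all only: fr.lscale_lconst a)
qed

lemma half_twice: "lconst [:1/2::'a::field_char_0:] * 2 = 1"
proof -
  have "lconst [:1/2::'a:] + lconst [:1/2:] = 1"
    by (simp flip: lconst_add) (simp add: lconst_1 flip: one_pCons)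
  then show ?thesis by (simp add: mult_2_right)
qed

lemma lconst_three_halves: "lconst [:3/2::'a::field_char_0:] = 1 + lconst [:1/2:]"
proof -
  have "[:3/2::'a:] = 1 + [:1/2:]" by (simp add: one_pCons)
  then show ?thesis by (simp only: lconst_add lconst_1)
qed
lemma lconst_numerals: "lconst [:2::'a::field_char_0:] = 2" "lconst [:-2::'a::field_char_0:] = - 2"
  "lconst [:1::'a::field_char_0:] = 1"  "lconst [:-1::'a::field_char_0:] = -1" "lconst [:0::'a::field_char_0:] = 0"
proof -
  show 1: "lconst [:1::'a::field_char_0:] = 1" by (simp add: lconst_1 flip: one_pCons)
  show "lconst [:-1::'a::field_char_0:] = -1"
    using lconst_uminus[of "[:1::'a:]"] 1 by simp
  show 2: "lconst [:2::'a::field_char_0:] = 2"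
    using lconst_add[of "[:1::'a:]" "[:1:]"] 1 by simp
  show "lconst [:-2::'a::field_char_0:] = -2"
    using lconst_uminus[of "[:2::'a:]"] 2 by simp
qed simp

lemma leval_gen: "leval free_scale P (sv_bracket (Poly_Mapping.single g 1) (Poly_Mapping.single h 1)) = leval free_scale P (sv_table g h)"
  by (simp add: sv_bracket_gen)

interpretation lf: module "lscale (free_scale :: 'a::comm_ring_1 poly \<Rightarrow> ('g \<Rightarrow>\<^sub>0 _) \<Rightarrow> _)" by (rule fr.module_lscale)

definition lhalf :: "'a::field_char_0 poly lpoly" where "lhalf = lconst [:1/2:]"

fun gen_bracket :: "sv_gen \<Rightarrow> sv_gen \<Rightarrow> 'a::field_char_0 poly lpoly \<Rightarrow> (sv_gen \<Rightarrow>\<^sub>0 'a::field_char_0 poly) lpoly" where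
  "gen_bracket gL gL l = lscale free_scale ldel (lgen gL) + (lscale free_scale l (lgen gL) + lscale free_scale l (lgen gL))"
| "gen_bracket gL gM l = lscale free_scale ldel (lgen gM) + lscale free_scale l (lgen gM)"
| "gen_bracket gL gY l = lscale free_scale ldel (lgen gY) + (lscale free_scale l (lgen gY) + lscale free_scale lhalf (lscale free_scale l (lgen gY)))"
| "gen_bracket gM gL l = lscale free_scale l (lgen gM)"
| "gen_bracket gY gL l = lscale free_scale lhalf (lscale free_scale ldel (lgen gY)) + (lscale free_scale l (lgen gY) + lscale free_scale lhalf (lscale free_scale l (lgen gY)))"
| "gen_bracket gY gY l = lscale free_scale ldel (lgen gM) + (lscale free_scale l (lgen gM) + lscale free_scale l (lgen gM))"
| "gen_bracket gL gN l = lscale free_scale ldel (lgen gN) + lscale free_scale l (lgen gN)"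
| "gen_bracket gN gL l = lscale free_scale l (lgen gN)"
| "gen_bracket gN gM l = (lgen gM) + lgen gM"
| "gen_bracket gM gN l = - (lgen gM) + - lgen gM"
| "gen_bracket gN gY l = (lgen gY)"
| "gen_bracket gY gN l = - (lgen gY)"
| "gen_bracket _ _ l = 0"

lemma lf_2: "lscale free_scale 2 w = w + (w::('g \<Rightarrow>\<^sub>0 'a::comm_ring_1 poly) lpoly)"
    by (metis lf.scale_one lf.scale_left_distrib one_add_one)

lemma gen_bracket_eq: "leval free_scale P (sv_table g h) = gen_bracket g h P"
  by (cases g; cases h)
     (simp_all add: fr.leval_pCons lconst_single_1 lconst_single_2 lconst_numerals lconst_three_halves lf.scale_left_distrib lf.scale_right_distrib mult.commute fr.lscale_1 lf_2 lhalf_def)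

lemma lhalf_twice: "lhalf * 2 = 1" unfolding lhalf_def by (rule half_twice)

lemma lext_gen: "lext free_scale (\<lambda>w. leval free_scale P (sv_bracket (Poly_Mapping.single g 1) w)) (lgen k) = gen_bracket g k P"
      "lext free_scale (\<lambda>x. leval free_scale P (sv_bracket x (Poly_Mapping.single g 1))) (lgen k) = gen_bracket k g P"
    by (simp_all add: lgen_def sv_br.ext_simps leval_gen gen_bracket_eq)

lemma lext_lhalf: "lext free_scale (\<lambda>w. leval free_scale P (sv_bracket a w)) (lscale free_scale lhalf p) = lscale free_scale lhalf (lext free_scale (\<lambda>w. leval free_scale P (sv_bracket a w)) p)"
    "lext free_scale (\<lambda>x. leval free_scale P (sv_bracket x a)) (lscale free_scale lhalf p) = lscale free_scale lhalf (lext free_scale (\<lambda>x. leval free_scale P (sv_bracket x a)) p)"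
    unfolding lhalf_def by (rule sv_br.ext_simps)+

lemma lext_zero: "lext s f 0 = 0" by (simp add: lext_def)

definition "gscale = lscale (free_scale :: 'a::comm_ring_1 poly \<Rightarrow> (sv_gen \<Rightarrow>\<^sub>0 _) \<Rightarrow> _)"
lemma gscale_simps: "gscale P w + gscale Q w = gscale (P + Q) w" "gscale P w - gscale Q w = gscale (P - Q) w" "- gscale P w = gscale (-P) w" "gscale P (gscale Q w) = gscale (P * Q) w"
   "gscale P 0 = 0" "0 - gscale P w = gscale (-P) w" "0 + x = x" "x + 0 = x" "x - 0 = x" "- 0 = (0 :: (sv_gen \<Rightarrow>\<^sub>0 'a::comm_ring_1 poly) lpoly)" "0 - 0 = (0 :: (sv_gen \<Rightarrow>\<^sub>0 'a::comm_ring_1 poly) lpoly)"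
   "gscale P (x + y) = gscale P x + gscale P y" "gscale P (- x) = - gscale P x"
  for x w :: "(sv_gen \<Rightarrow>\<^sub>0 'a::comm_ring_1 poly) lpoly"
  by (simp_all add: gscale_def lf.scale_left_distrib lf.scale_left_diff_distrib lf.scale_right_distrib)

lemma gscale_eq_0: "P = 0 \<Longrightarrow> gscale P w = 0" by (simp add: gscale_def)

lemma lhalf_double: "lhalf * (x * 2) = x" "lhalf * (x * (y * 2)) = x * y"
proof -
  have "lhalf * (x * 2) = (lhalf * 2) * x" by (simp only: mult_ac)
  then show "lhalf * (x * 2) = x" by (simp only: lhalf_twice mult_1_left)
  have "lhalf * (x * (y * 2)) = (lhalf * 2) * (x * y)" by (simp only: mult_ac)
  then show "lhalf * (x * (y * 2)) = x * y" by (simp only: lhalf_twice mult_1_left)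
qed

lemma svA_J_gen:
  "svA.J (Poly_Mapping.single g 1) (Poly_Mapping.single h 1) (Poly_Mapping.single k (1::'a::field_char_0 poly)) = 0"
proof -
  define EL EM EY EN :: "(sv_gen \<Rightarrow>\<^sub>0 'a::field_char_0 poly) lpoly" where defs: "EL = lgen gL" "EM = lgen gM" "EY = lgen gY" "EN = lgen gN"
  have ee: "lgen gL = gscale 1 EL" "lgen gM = gscale 1 EM"  "lgen gY = gscale 1 EY"  "lgen gN = gscale 1 EN" by (simp_all add: defs gscale_def)
  have "(lhalf :: 'a poly lpoly) * 2 = 1" by (rule lhalf_twice)
  then have lhalf': "(lhalf :: 'a poly lpoly) + lhalf = 1" by (simp only: mult_2_right)
  have lhalf'': "(lhalf :: 'a poly lpoly) * x + lhalf * x = x" for x by (simp add: lhalf' flip: distrib_right)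
  have hf3: "(lhalf :: 'a poly lpoly) * x + (lhalf * x + y) = x + y" for x y by (simp add: lhalf' flip: distrib_right add.assoc)
  have lhalf_double: "lhalf * (x * 2) = (x :: 'a poly lpoly)" "lhalf * (x * (y * 2)) = (x * y :: 'a poly lpoly)" for x y
    by (rule lhalf_double)+
  show ?thesis
    unfolding svA.J_def leval_gen gen_bracket_eq
    apply (cases g; cases h; cases k)
    apply (simp_all only: gen_bracket.simps
       sv_br.ext_simps lext_gen lext_lhalf lext_zero)
    apply (simp_all only: ee gscale_def[symmetric] gscale_simps)
    apply (rule gscale_eq_0 refl; simp add: algebra_simps lhalf' lhalf'' hf3 lhalf_double lhalf_twice)+
    done
qed

lemma svA_J: "svA.J a b c = 0"
proof -
  have g1: "svA.J (Poly_Mapping.single g 1) (Poly_Mapping.single h 1) c = 0" for g h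
    by (induction c rule: free_induct) (auto simp: svA.J_add svA.J_sc svA.J_del svA_J_gen)
  have g2: "svA.J (Poly_Mapping.single g 1) b c = 0" for g
    by (induction b rule: free_induct) (auto simp: svA.J_add svA.J_sc svA.J_del g1)
  show ?thesis
    by (induction a rule: free_induct) (auto simp: svA.J_add svA.J_sc svA.J_del g2)
qed

definition "skew_defect a b = leval free_scale (lvar 0) (sv_bracket a b) + leval free_scale (- lvar 0 - ldel) (sv_bracket b (a :: sv_gen \<Rightarrow>\<^sub>0 'a::field_char_0 poly))"

lemma skew_defect_simps:
  "skew_defect (a + a') b = skew_defect a b + skew_defect a' b"
  "skew_defect a (b + b') = skew_defect a b + skew_defect a b'"
  "skew_defect (free_scale [:c:] a) b = lscale free_scale (lconst [:c:]) (skew_defect a b)"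
  "skew_defect a (free_scale [:c:] b) = lscale free_scale (lconst [:c:]) (skew_defect a b)"
  "skew_defect (free_scale [:0,1:] a) b = lscale free_scale (- lvar 0) (skew_defect a b)"
  "skew_defect a (free_scale [:0,1:] b) = lscale free_scale (lvar 0 + ldel) (skew_defect a b)"
  unfolding skew_defect_def
  by (simp_all only: sv_br.le lf.scale_right_distrib) (simp_all add: algebra_simps)

lemma skew_defect_gen: "skew_defect (Poly_Mapping.single g 1) (Poly_Mapping.single h (1::'a::field_char_0 poly)) = 0"
proof -
  have hf: "(lhalf :: 'a poly lpoly) + lhalf = 1" using lhalf_twice by (simp only: mult_2_right)
  have lhalf': "(lhalf :: 'a poly lpoly) * x + lhalf * x = x" for x by (simp add: hf flip: distrib_right)
  have lhalf_double: "lhalf * (x * 2) = (x :: 'a poly lpoly)" "lhalf * (x * (y * 2)) = (x * y :: 'a poly lpoly)" for x y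
    by (rule lhalf_double)+
  have ee: "lgen g = gscale 1 (lgen g)" by (simp add: gscale_def)
  show ?thesis unfolding skew_defect_def leval_gen gen_bracket_eq
    apply (cases g; cases h)
    apply (simp_all only: gen_bracket.simps)
    apply (simp_all only: gscale_def[symmetric] gscale_simps)
    apply (simp_all add: gscale_def algebra_simps lhalf' lhalf_double lhalf_twice)
    done
qed

lemma skew_defect_0: "skew_defect a b = 0"
proof -
  have g1: "skew_defect (Poly_Mapping.single g 1) b = 0" for g
    by (induction b rule: free_induct) (auto simp: skew_defect_simps skew_defect_gen)
  show ?thesis
    by (induction a rule: free_induct) (auto simp: skew_defect_simps g1)
qed

lemma sv_lie_conformal_algebra: "lie_conformal_algebra free_scale (sv_bracket :: _ \<Rightarrow> _ \<Rightarrow> (sv_gen \<Rightarrow>\<^sub>0 'a::field_char_0 poly) poly)"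
proof (intro lie_conformal_algebra.intro lie_conformal_algebra_axioms.intro module_free_scale)
  fix a b c :: "sv_gen \<Rightarrow>\<^sub>0 'a poly"
  show "leval free_scale (lvar 0) (sv_bracket a b) = - leval free_scale (- lvar 0 - ldel) (sv_bracket b a)"
    using skew_defect_0[of a b] by (simp add: skew_defect_def eq_neg_iff_add_eq_0)
  show "lext free_scale (\<lambda>x. leval free_scale (lvar 0) (sv_bracket a x)) (leval free_scale (lvar 1) (sv_bracket b c)) =
       lext free_scale (\<lambda>x. leval free_scale (lvar 0 + lvar 1) (sv_bracket x c)) (leval free_scale (lvar 0) (sv_bracket a b)) +
       lext free_scale (\<lambda>x. leval free_scale (lvar 1) (sv_bracket b x)) (leval free_scale (lvar 0) (sv_bracket a c))"
    using svA_J[of a b c] by (simp add: svA.J_def algebra_simps)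
qed (rule sv_br.add_l sv_br.add_r sv_br.sc_l sv_br.sc_r sv_br.del_l sv_br.del_r)+

lemma leval_gen_act: "leval (*) P (sv_act D B (Poly_Mapping.single g 1) 1) = leval (*) P (sv_mod_table D B g)"
  by (simp add: sv_act_gen)

interpretation lt: module "lscale ((*) :: 'a::comm_ring_1 poly \<Rightarrow> _)" by (rule ti.module_lscale)

fun gen_act :: "'a::field_char_0 \<Rightarrow> 'a \<Rightarrow> sv_gen \<Rightarrow> 'a poly lpoly \<Rightarrow> 'a poly lpoly" where
  "gen_act D B gL l = lscale (*) ldel (lconst 1) + lscale (*) (lconst [:D:]) (lscale (*) l (lconst 1))"
| "gen_act D B gN l = lscale (*) (lconst [:B:]) (lconst 1)"
| "gen_act D B _ l = 0"

lemma lconst_act: "lscale (*) (lconst p) (lconst 1) = lconst (p :: 'a::field_char_0 poly)"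
  by (simp add: ti.lscale_lconst)

lemma gen_act_eq: "leval (*) P (sv_mod_table D B g) = gen_act D B g P"
  by (cases g) (simp_all add: ti.leval_pCons lconst_act ldel_def, metis (no_types) lconst_act lt.scale_scale mult.commute)

lemma lext_gen_act: "lext (*) (\<lambda>w. leval (*) P (sv_act D B (Poly_Mapping.single g 1) w)) (lconst 1) = gen_act D B g P"
      "lext (*) (\<lambda>x. leval (*) P (sv_act D B x 1)) (lgen k) = gen_act D B k P"
    by (simp_all add: lgen_def sv_ac.ext_simps leval_gen_act gen_act_eq)

lemma svV_J_gen:
  "svV.J D B (Poly_Mapping.single g 1) (Poly_Mapping.single h 1) (1::'a::field_char_0 poly) = 0"
proof -
  have hf: "(lhalf :: 'a poly lpoly) + lhalf = 1" using lhalf_twice by (simp only: mult_2_right)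
  have lhalf': "(lhalf :: 'a poly lpoly) * x + lhalf * x = x" for x by (simp add: hf flip: distrib_right)
  have lext_lhalf: "lext (*) (\<lambda>x. leval (*) P (sv_act D B x a)) (lscale free_scale lhalf p) = lscale (*) lhalf (lext (*) (\<lambda>x. leval (*) P (sv_act D B x a)) p)" for P a p
    unfolding lhalf_def by (rule sv_ac.ext_simps)+
  show ?thesis unfolding svV.J_def leval_gen gen_bracket_eq leval_gen_act gen_act_eq
    apply (cases g; cases h)
    apply (simp_all only: gen_bracket.simps gen_act.simps sv_ac.ext_simps lext_lhalf lext_gen_act lext_zero leval_gen_act gen_act_eq)
    apply (simp_all add: algebra_simps lt.scale_right_distrib lt.scale_left_distrib)
    done
qed

lemma svV_J: "svV.J D B a b c = 0"
proof -
  have g1: "svV.J D B (Poly_Mapping.single g 1) (Poly_Mapping.single h 1) c = 0" for g h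
    by (induction c rule: poly_module_induct) (simp_all only: svV.J_add svV.J_sc svV.J_del svV_J_gen lt.scale_zero_right add_0)
  have g2: "svV.J D B (Poly_Mapping.single g 1) b c = 0" for g
    by (induction b rule: free_induct) (auto simp: svV.J_add svV.J_sc svV.J_del g1)
  show ?thesis
    by (induction a rule: free_induct) (auto simp: svV.J_add svV.J_sc svV.J_del g2)
qed

lemma sv_lca_module: "lca_module free_scale sv_bracket (*) (sv_act D B)"
proof (intro lca_module.intro sv_lie_conformal_algebra lca_module_axioms.intro module_times)
  fix a b :: "sv_gen \<Rightarrow>\<^sub>0 'a poly" and v :: "'a poly"
  show "lext (*) (\<lambda>w. leval (*) (lvar 0) (sv_act D B a w)) (leval (*) (lvar 1) (sv_act D B b v)) -
       lext (*) (\<lambda>w. leval (*) (lvar 1) (sv_act D B b w)) (leval (*) (lvar 0) (sv_act D B a v)) =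
       lext (*) (\<lambda>x. leval (*) (lvar 0 + lvar 1) (sv_act D B x v)) (leval free_scale (lvar 0) (sv_bracket a b))"
    using svV_J[of D B a b v] by (simp add: svV.J_def)
qed (rule sv_ac.add_l sv_ac.add_r sv_ac.sc_l sv_ac.sc_r sv_ac.del_l sv_ac.del_r)+

end

end

theory Submission
  imports Defs "HOL-Library.Function_Algebras" "HOL-Library.Set_Algebras"
begin

text \<open>
  The argument is Cartan's homotopy for the element \<open>N\<close>, with its spectral parameter set to \<open>0\<close>.  Let
  \<open>\<iota>f = f\<^bsub>0,\<lambda>\<^sub>1,\<dots>\<^esub>(N, a\<^sub>1, \<dots>)\<close> (\<open>contract\<close>).  Sorting the terms of \<open>df\<close> by whether they involve the first
  argument gives Cartan's formula \<open>\<iota>d + d\<iota> = \<theta>\<close> (\<open>cartan_formula\<close>), where \<open>\<theta>\<close> is the Lie derivative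
  along the operator \<open>N\<^bsub>0\<^esub>\<close> (\<open>lie\<close>).  On the module \<open>N\<^bsub>0\<^esub>\<close> is multiplication by \<open>\<beta>\<close>; on the algebra it is the
  \<open>F[\<partial>]\<close>-linear map with eigenvalue \<open>0\<close> on \<open>L\<close> and \<open>N\<close>, \<open>1\<close> on \<open>Y\<close> and \<open>2\<close> on \<open>M\<close>, read off from
  \<open>[N\<^sub>\<lambda> L] = \<lambda>N\<close>, \<open>[N\<^sub>\<lambda> Y] = Y\<close> and \<open>[N\<^sub>\<lambda> M] = 2M\<close>.  Hence on a tuple of generators of total weight \<open>w\<close>
  the operator \<open>\<theta>\<close> is multiplication by \<open>\<beta> - w\<close>, with \<open>w\<close> a natural number, and it is invertible as soon
  as \<open>\<beta>\<close> is not a natural number.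

  To see that the inverse \<open>T\<close> of \<open>\<theta>\<close> commutes with \<open>d\<close> and with \<open>\<partial>\<close>, it is written as a linear
  combination of pullbacks of cochains.  The weights grade the Lie conformal algebra, so
  multiplying each generator by \<open>c\<close> to the power of its weight is an endomorphism that does not change
  the action on the module, and pulling back along it commutes with \<open>d\<close>.  The pullback for \<open>c = 2\<^sup>i\<close>
  multiplies the value on generators of weight \<open>w\<close> by \<open>(2\<^sup>w)\<^sup>i\<close>.  If \<open>Q\<close> is a polynomial with
  \<open>Q(2\<^sup>w) = 1/(\<beta> - w)\<close> for all weights that occur in a given degree, its coefficients are
  the coefficients of the linear combination sought (\<open>lie_N_inverse\<close>).

  If \<open>df = 0\<close>, then \<open>d(Tf) = 0\<close> and \<open>f = \<theta>(Tf) = d(\<iota>Tf)\<close>, so the basic cohomology vanishes.  Contraction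
  commutes with \<open>\<partial>\<close> because the parameter of \<open>N\<close> is \<open>0\<close>; if \<open>df = \<partial>g\<close>, then \<open>d(Tf) = \<partial>(Tg)\<close> and
  \<open>f = \<theta>(Tf) = d(\<iota>Tf) + \<partial>(\<iota>Tg)\<close>, which settles the reduced cohomology (\<open>homotopy_decomposition\<close>,
  \<open>cohomology_vanishes\<close>).

  That \<open>d\<close> maps cochains to cochains and commutes with \<open>\<partial>\<close>, so that it acts on the reduced
  complex, is part of the proof.  For this, a cochain is regarded as a
  function of a list of pairs \<open>(P\<^sub>i, a\<^sub>i)\<close>, with polynomials \<open>P\<^sub>i\<close> substituted for the variables.  Fixing the first
  pair gives a function of the same kind, and the formula of Cartan for an arbitrary first
  pair (\<open>diff_at_Cons\<close>) becomes a recursion for \<open>d\<close> along the list.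
\<close>

section \<open>Substitution for the variables\<close>

definition monomial_at :: "'r::comm_ring_1 lpoly list \<Rightarrow> (nat \<Rightarrow>\<^sub>0 nat) \<Rightarrow> 'r lpoly"
  where "monomial_at Ps n =
    (\<Prod>i\<in>Poly_Mapping.keys n. (Ps ! i) ^ Poly_Mapping.lookup n i)"

lemma monomial_at_superset:
  assumes "finite A" "Poly_Mapping.keys n \<subseteq> A"
  shows "monomial_at Ps n = (\<Prod>i\<in>A. (Ps ! i) ^ Poly_Mapping.lookup n i)"
  unfolding monomial_at_def using assms
  by (intro prod.mono_neutral_left) (auto simp: not_in_keys_iff_lookup_eq_zero)

lemma monomial_at_0 [simp]: "monomial_at Ps 0 = 1"
  by (simp add: monomial_at_def)

lemma monomial_at_add: "monomial_at Ps (m + n) = monomial_at Ps m * monomial_at Ps n"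
proof -
  let ?A = "Poly_Mapping.keys m \<union> Poly_Mapping.keys n"
  have "monomial_at Ps k = (\<Prod>i\<in>?A. (Ps ! i) ^ Poly_Mapping.lookup k i)" if "k \<in> {m, n, m + n}" for k
    using that keys_add[of m n] by (intro monomial_at_superset) auto
  then show ?thesis
    by (simp add: lookup_add power_add prod.distrib)
qed

lemma prod_single: "(\<Prod>i\<in>A. Poly_Mapping.single (g i) (1::'r::comm_ring_1)) = Poly_Mapping.single (sum g A) 1"
  by (induction A rule: infinite_finite_induct) (simp_all add: mult_single flip: single_one)

lemma lvar_power: "lvar i ^ k = Poly_Mapping.single (Poly_Mapping.single i k) 1"
  by (induction k) (simp_all add: lvar_def mult_single single_add[symmetric])

lemma sum_singles: "(\<Sum>n\<in>Poly_Mapping.keys w. Poly_Mapping.single n (Poly_Mapping.lookup w n)) = w"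
  for w :: "'m \<Rightarrow>\<^sub>0 'v::ab_group_add"
  by (intro poly_mapping_eqI)
     (simp add: lookup_sum lookup_single when_def sum.delta' in_keys_iff)

lemma monomial_at_lvars:
  assumes "Poly_Mapping.keys n \<subseteq> {..<q}"
  shows "monomial_at (map lvar [0..<q]) n = Poly_Mapping.single n (1::'r::comm_ring_1)"
proof -
  have "monomial_at (map lvar [0..<q]) n =
      (\<Prod>i\<in>Poly_Mapping.keys n. Poly_Mapping.single (Poly_Mapping.single i (Poly_Mapping.lookup n i)) (1::'r))"
    unfolding monomial_at_def using assms by (intro prod.cong) (auto simp: lvar_power)
  also have "\<dots> = Poly_Mapping.single (\<Sum>i\<in>Poly_Mapping.keys n. Poly_Mapping.single i (Poly_Mapping.lookup n i)) 1"
    by (rule prod_single)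
  also have "(\<Sum>i\<in>Poly_Mapping.keys n. Poly_Mapping.single i (Poly_Mapping.lookup n i)) = n"
    by (intro poly_mapping_eqI)
       (simp add: lookup_sum lookup_single when_def sum.delta' in_keys_iff)
  finally show ?thesis .
qed

lemma lscale_times: "lscale (*) P Q = P * (Q :: 'r::comm_ring_1 lpoly)"
proof -
  interpret t: module "(*) :: 'r \<Rightarrow> _" by (rule module_times)
  show ?thesis
  proof (induction P rule: poly_mapping_additive_induct)
    case (1 k v) show ?case
      by (induction Q rule: poly_mapping_additive_induct)
         (simp_all add: t.lscale_add_right mult_single distrib_left)
  qed (simp add: t.lscale_add_left distrib_right)
qed

context module begin

interpretation l: module "lscale scale" by (rule module_lscale)

lemma lsubst_superset:
  assumes "finite B" "Poly_Mapping.keys w \<subseteq> B"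
  shows "lsubst scale Ps w =
    (\<Sum>n\<in>B. lscale scale (monomial_at Ps n) (lconst (Poly_Mapping.lookup w n)))"
  unfolding lsubst_def monomial_at_def using assms
  by (intro sum.mono_neutral_left) (auto simp: not_in_keys_iff_lookup_eq_zero)

lemma lsubst_single: "lsubst scale Ps (Poly_Mapping.single n v) = lscale scale (monomial_at Ps n) (lconst v)"
  by (simp add: lsubst_superset[of "{n}"])

lemma lsubst_0 [simp]: "lsubst scale Ps 0 = 0"
  by (simp add: lsubst_def)

lemma lsubst_lconst [simp]: "lsubst scale Ps (lconst v) = lconst v"
  by (simp add: lconst_def lsubst_single lscale_1)

lemma lsubst_add: "lsubst scale Ps (v + w) = lsubst scale Ps v + lsubst scale Ps w"
proof -
  let ?B = "Poly_Mapping.keys v \<union> Poly_Mapping.keys w"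
  have "lsubst scale Ps u =
      (\<Sum>n\<in>?B. lscale scale (monomial_at Ps n) (lconst (Poly_Mapping.lookup u n)))" if "u \<in> {v, w, v + w}" for u
    using that keys_add[of v w] by (intro lsubst_superset) auto
  then show ?thesis
    by (simp add: lookup_add lconst_add lscale_add_right sum.distrib)
qed

lemma lsubst_uminus: "lsubst scale Ps (- w) = - lsubst scale Ps w"
  using lsubst_add[of Ps w "- w"] by (simp add: eq_neg_iff_add_eq_0 add.commute)

lemma lsubst_sum: "lsubst scale Ps (sum g A) = (\<Sum>i\<in>A. lsubst scale Ps (g i))"
  by (induction A rule: infinite_finite_induct) (simp_all add: lsubst_add)

lemma lsubst_lscale:
  "lsubst scale Ps (lscale scale P w) = lscale scale (lsubst (*) Ps P) (lsubst scale Ps w)"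
proof -
  interpret t: module "(*) :: 'a \<Rightarrow> _" by (rule module_times)
  show ?thesis
  proof (induction P rule: poly_mapping_additive_induct)
    case (1 k c) show ?case
    proof (induction w rule: poly_mapping_additive_induct)
      case (1 n v)
      have "lscale scale (monomial_at Ps (k + n)) (lconst (c *s v)) =
        lscale scale ((monomial_at Ps k * lconst c) * monomial_at Ps n) (lconst v)"
        unfolding monomial_at_add lscale_lconst[symmetric] lscale_mult[symmetric]
        by (simp only: mult_ac)
      then show ?case
        by (simp only: lscale_single lsubst_single t.lsubst_single lscale_times lscale_mult)
    qed (simp add: lsubst_add lscale_add_right)
  qed (simp add: lsubst_add t.lsubst_add lscale_add_left)
qed

end

text \<open>On coefficients in the base ring, substitution is a ring homomorphism.\<close>

context
  fixes Ps :: "'r::comm_ring_1 lpoly list"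
begin

interpretation t: module "(*) :: 'r \<Rightarrow> _" by (rule module_times)

lemma lsubst_times: "lsubst (*) Ps (P * Q) = lsubst (*) Ps P * lsubst (*) Ps Q"
  using t.lsubst_lscale[of Ps P Q] by (simp only: lscale_times)

lemma lsubst_one [simp]: "lsubst (*) Ps 1 = 1"
  using t.lsubst_lconst[of Ps 1] by (simp add: lconst_1)

lemma lsubst_ring_simps:
  "lsubst (*) Ps 0 = 0" "lsubst (*) Ps (- P) = - lsubst (*) Ps P"
  "lsubst (*) Ps (P + Q) = lsubst (*) Ps P + lsubst (*) Ps Q"
  "lsubst (*) Ps (P - Q) = lsubst (*) Ps P - lsubst (*) Ps Q"
  "lsubst (*) Ps (sum g A) = (\<Sum>i\<in>A. lsubst (*) Ps (g i))"
  "lsubst (*) Ps (lconst c) = lconst c"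
  using t.lsubst_add[of Ps P "- Q"] by (simp_all add: t.lsubst_add t.lsubst_uminus t.lsubst_sum)

lemma lsubst_power: "lsubst (*) Ps (P ^ k) = lsubst (*) Ps P ^ k"
  by (induction k) (simp_all add: lsubst_times)

lemma lsubst_prod: "lsubst (*) Ps (prod g A) = (\<Prod>i\<in>A. lsubst (*) Ps (g i))"
  by (induction A rule: infinite_finite_induct) (simp_all add: lsubst_times)

lemma lsubst_of_int: "lsubst (*) Ps (of_int k) = of_int k"
proof -
  have "lsubst (*) Ps (of_nat m) = of_nat m" for m
    by (induction m) (simp_all add: lsubst_ring_simps)
  then show ?thesis
    by (cases k rule: int_cases2) (simp_all add: lsubst_ring_simps)
qed

lemma lsubst_lvar [simp]: "lsubst (*) Ps (lvar i) = Ps ! i"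
  by (simp add: lvar_def t.lsubst_single lscale_times lconst_1 monomial_at_def)

lemma lsubst_monomial_at:
  assumes "Poly_Mapping.keys n \<subseteq> {..<length Qs}"
  shows "lsubst (*) Ps (monomial_at Qs n) = monomial_at (map (lsubst (*) Ps) Qs) n"
  unfolding monomial_at_def lsubst_prod lsubst_power
  using assms by (intro prod.cong) auto

end

text \<open>
  Substituting a list of length \<open>q\<close> is only meaningful for elements without further variables, as the
  \<open>i\<close>-th entry of a list is unspecified beyond its length.
\<close>

definition vars_below :: "nat \<Rightarrow> 'v::zero lpoly \<Rightarrow> bool"
  where "vars_below q w \<longleftrightarrow> (\<forall>n\<in>Poly_Mapping.keys w. Poly_Mapping.keys n \<subseteq> {..<q})"

lemma vars_below_add: "vars_below q v \<Longrightarrow> vars_below q w \<Longrightarrow> vars_below q (v + w :: 'v::ab_group_add lpoly)"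
  unfolding vars_below_def using keys_add[of v w] by blast

lemma vars_below_0 [simp]: "vars_below q 0"
  by (simp add: vars_below_def)

lemma vars_below_sum:
  "(\<And>i. i \<in> A \<Longrightarrow> vars_below q (g i)) \<Longrightarrow> vars_below q (sum g A :: 'v::ab_group_add lpoly)"
  by (induction A rule: infinite_finite_induct) (simp_all add: vars_below_add)

lemma vars_below_uminus: "vars_below q w \<Longrightarrow> vars_below q (- w :: 'v::ab_group_add lpoly)"
  by (simp add: vars_below_def)

lemma vars_below_lconst: "vars_below q (lconst v)"
  by (simp add: vars_below_def lconst_def keys_single)

lemma vars_below_lvar: "i < q \<Longrightarrow> vars_below q (lvar i)"
  by (simp add: vars_below_def lvar_def keys_single)

lemma (in module) vars_below_lscale:
  assumes "vars_below q P" "vars_below q w"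
  shows "vars_below q (lscale scale P w)"
  unfolding lscale_def
proof (intro vars_below_sum)
  fix m n assume "m \<in> Poly_Mapping.keys P" "n \<in> Poly_Mapping.keys w"
  then have "Poly_Mapping.keys (m + n) \<subseteq> {..<q}"
    using assms keys_add[of m n] unfolding vars_below_def by blast
  then show "vars_below q (Poly_Mapping.single (m + n) (Poly_Mapping.lookup P m *s Poly_Mapping.lookup w n))"
    by (auto simp: vars_below_def keys_single)
qed

lemma vars_below_times: "vars_below q P \<Longrightarrow> vars_below q Q \<Longrightarrow> vars_below q (P * Q :: 'r::comm_ring_1 lpoly)"
  using module.vars_below_lscale[OF module_times] by (simp only: lscale_times)

lemma vars_below_1: "vars_below q (1 :: 'r::comm_ring_1 lpoly)"
  using vars_below_lconst[of q "1::'r"] by (simp add: lconst_1)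

lemma vars_below_power: "vars_below q P \<Longrightarrow> vars_below q (P ^ k :: 'r::comm_ring_1 lpoly)"
  by (induction k) (simp_all add: vars_below_1 vars_below_times)

lemma vars_below_prod:
  "(\<And>i. i \<in> A \<Longrightarrow> vars_below q (g i)) \<Longrightarrow> vars_below q (prod g A :: 'r::comm_ring_1 lpoly)"
  by (induction A rule: infinite_finite_induct) (simp_all add: vars_below_1 vars_below_times)

context module begin

interpretation l: module "lscale scale" by (rule module_lscale)

lemma lsubst_lsubst:
  assumes "vars_below (length Qs) w"
  shows "lsubst scale Ps (lsubst scale Qs w) = lsubst scale (map (lsubst (*) Ps) Qs) w"
proof -
  have "lsubst scale Ps (lsubst scale Qs w) = (\<Sum>n\<in>Poly_Mapping.keys w.
      lscale scale (lsubst (*) Ps (monomial_at Qs n)) (lconst (Poly_Mapping.lookup w n)))"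
    by (simp add: lsubst_superset[OF _ order_refl, of _ Qs] lsubst_sum lsubst_lscale)
  also have "\<dots> = (\<Sum>n\<in>Poly_Mapping.keys w.
      lscale scale (monomial_at (map (lsubst (*) Ps) Qs) n) (lconst (Poly_Mapping.lookup w n)))"
    using assms by (intro sum.cong) (simp_all add: lsubst_monomial_at vars_below_def)
  finally show ?thesis
    by (simp add: lsubst_superset[OF _ order_refl, of _ "map (lsubst (*) Ps) Qs"])
qed

lemma lsubst_lvars:
  assumes "vars_below q w"
  shows "lsubst scale (map lvar [0..<q]) w = w"
proof -
  have "lsubst scale (map lvar [0..<q]) w =
      (\<Sum>n\<in>Poly_Mapping.keys w. Poly_Mapping.single n (Poly_Mapping.lookup w n))"
    unfolding lsubst_superset[OF finite_keys order_refl] using assms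
    by (intro sum.cong) (auto simp: vars_below_def monomial_at_lvars lconst_def)
  then show ?thesis
    by (simp add: sum_singles)
qed

lemma vars_below_lsubst:
  assumes "vars_below (length Ps) w" "\<And>P. P \<in> set Ps \<Longrightarrow> vars_below q P"
  shows "vars_below q (lsubst scale Ps w)"
  unfolding lsubst_superset[OF finite_keys order_refl]
proof (intro vars_below_sum vars_below_lscale vars_below_lconst)
  fix n assume "n \<in> Poly_Mapping.keys w"
  then have "Poly_Mapping.keys n \<subseteq> {..<length Ps}"
    using assms(1) by (simp add: vars_below_def)
  then show "vars_below q (monomial_at Ps n)"
    unfolding monomial_at_def using assms(2) by (intro vars_below_prod vars_below_power) auto
qed

end

text \<open>
  The extension \<open>lext s g\<close> of an additive map \<open>g\<close> is linear over polynomials in the \<open>\<lambda>\<^sub>i\<close>, but in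
  general not over \<open>\<partial>\<close>.  The following subring singles out scalars that may always be moved
  across \<open>lext s g\<close>.
\<close>

inductive_set lambda_polys :: "'r::comm_ring_1 lpoly set" where
  zero: "0 \<in> lambda_polys"
| one: "1 \<in> lambda_polys"
| var: "lvar i \<in> lambda_polys"
| uminus: "P \<in> lambda_polys \<Longrightarrow> - P \<in> lambda_polys"
| add: "P \<in> lambda_polys \<Longrightarrow> Q \<in> lambda_polys \<Longrightarrow> P + Q \<in> lambda_polys"
| times: "P \<in> lambda_polys \<Longrightarrow> Q \<in> lambda_polys \<Longrightarrow> P * Q \<in> lambda_polys"

lemma lambda_polys_power: "P \<in> lambda_polys \<Longrightarrow> P ^ k \<in> lambda_polys"
  by (induction k) (auto intro: lambda_polys.intros)

lemma lambda_polys_prod: "(\<And>i. i \<in> A \<Longrightarrow> g i \<in> lambda_polys) \<Longrightarrow> prod g A \<in> lambda_polys"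
  by (induction A rule: infinite_finite_induct) (auto intro: lambda_polys.intros)

lemma lext_zero [simp]: "lext s g 0 = 0"
  by (simp add: lext_def)

lemma (in module) lext_sum:
  assumes "\<And>x y. g (x + y) = g x + g (y :: 'u::ab_group_add)"
  shows "lext scale g (sum h A) = (\<Sum>i\<in>A. lext scale g (h i))"
  by (induction A rule: infinite_finite_induct) (simp_all add: lext_add[of g, OF assms])

lemma (in module) lscale_0 [simp]: "lscale scale 0 w = 0" "lscale scale P 0 = 0"
  by (simp_all add: lscale_def)

lemma (in module) lscale_uminus_left: "lscale scale (- P) w = - lscale scale P w"
  using lscale_add_left[of P "- P" w] by (simp add: eq_neg_iff_add_eq_0 add.commute)

text \<open>
  Two kinds of maps arise: \<open>v \<mapsto> a\<^bsub>P\<^esub> v\<close>, for which \<open>\<partial>\<close> becomes \<open>\<partial> + P\<close>, and \<open>x \<mapsto> f\<^bsub>P,\<dots>\<^esub>(x, \<dots>)\<close>, for which it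
  becomes \<open>-P\<close>.  What they share is additivity.
\<close>

locale additive_coefficient_map = S: module s + T: module t
  for s :: "'r::comm_ring_1 \<Rightarrow> 'v::ab_group_add \<Rightarrow> 'v"
    and t :: "'r \<Rightarrow> 'u::ab_group_add \<Rightarrow> 'u" +
  fixes g :: "'u \<Rightarrow> 'v lpoly"
  assumes g_add: "g (x + y) = g x + g y"
begin

lemma g_0: "g 0 = 0"
  using g_add[of 0 0] by simp

lemma lext_lscale_lambda:
  "P \<in> lambda_polys \<Longrightarrow> lext s g (lscale t P w) = lscale s P (lext s g w)"
proof (induction arbitrary: w rule: lambda_polys.induct)
  case (var i)
  show ?case by (rule lext_lscale_lvar) (unfold_locales, rule g_add)
next
  case (uminus P)
  then show ?case
    using S.lext_uminus[of g, OF g_add] S.lscale_uminus_left T.lscale_uminus_left by metis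
qed (simp_all only: S.lscale_1 T.lscale_1 S.lscale_mult T.lscale_mult S.lscale_add_left
  T.lscale_add_left S.lext_add[of g, OF g_add] S.lscale_0 T.lscale_0 lext_zero)

text \<open>
  The next two formulas no longer contain extensions of \<open>g\<close>, so that a further
  substitution can be carried out term by term on the right-hand sides.
\<close>

lemma lext_lsubst:
  assumes "set Ps \<subseteq> lambda_polys" "vars_below (length Ps) w"
  shows "lext s g (lsubst t Ps w) =
    (\<Sum>n\<in>Poly_Mapping.keys w. lscale s (monomial_at Ps n) (g (Poly_Mapping.lookup w n)))"
proof -
  have mon: "monomial_at Ps n \<in> lambda_polys" if "n \<in> Poly_Mapping.keys w" for n
  proof -
    have "Poly_Mapping.keys n \<subseteq> {..<length Ps}"
      using assms(2) that by (simp add: vars_below_def)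
    then show ?thesis
      unfolding monomial_at_def using assms(1)
      by (intro lambda_polys_prod lambda_polys_power) (auto simp: subset_eq)
  qed
  have "lext s g (lsubst t Ps w) = (\<Sum>n\<in>Poly_Mapping.keys w.
      lext s g (lscale t (monomial_at Ps n) (lconst (Poly_Mapping.lookup w n))))"
    by (simp add: T.lsubst_superset[OF finite_keys order_refl] S.lext_sum[of g, OF g_add])
  also have "\<dots> = (\<Sum>n\<in>Poly_Mapping.keys w. lscale s (monomial_at Ps n) (g (Poly_Mapping.lookup w n)))"
    by (intro sum.cong refl) (simp add: lext_lscale_lambda mon S.lext_lconst g_0)
  finally show ?thesis .
qed

lemma lext_leval:
  assumes "P \<in> lambda_polys"
  shows "lext s g (leval t P p) = (\<Sum>i\<le>degree p. lscale s (P ^ i) (g (coeff p i)))"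
proof -
  have "lext s g (leval t P p) = (\<Sum>i\<le>degree p. lext s g (lscale t (P ^ i) (lconst (coeff p i))))"
    by (simp add: leval_def S.lext_sum[of g, OF g_add])
  also have "\<dots> = (\<Sum>i\<le>degree p. lscale s (P ^ i) (g (coeff p i)))"
    by (intro sum.cong refl) (simp add: lext_lscale_lambda lambda_polys_power assms S.lext_lconst g_0)
  finally show ?thesis .
qed

end

section \<open>Cochains evaluated at polynomials\<close>

lemma map_omit: "map h (omit k xs) = omit k (map h xs)"
  by (simp add: omit_def take_map drop_map)

lemma length_omit: "k < length xs \<Longrightarrow> length (omit k xs) = length xs - 1"
  by (simp add: omit_def)

lemma omit_Cons [simp]: "omit 0 (x # xs) = xs" "omit (Suc k) (x # xs) = x # omit k xs"
  by (simp_all add: omit_def)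

lemma set_omit: "set (omit k xs) \<subseteq> set xs"
  by (auto simp: omit_def dest: in_set_takeD in_set_dropD)

lemma map_lsubst_lvars: "map (lsubst (*) Ps) (map lvar [0..<length Ps]) = (Ps :: 'r::comm_ring_1 lpoly list)"
  by (simp add: comp_def map_nth)

lemma (in module) lsubst_leval: "lsubst scale Ps (leval scale P p) = leval scale (lsubst (*) Ps P) p"
  by (simp add: leval_def lsubst_sum lsubst_lscale lsubst_power)

lemma (in module) leval_at_0: "leval scale 0 p = lconst (coeff p 0)"
  by (cases p) (simp add: leval_pCons)

text \<open>
  A permutation of the arguments after the first one, as a permutation of all arguments.
\<close>

lemma permute_list_Cons:
  assumes "\<pi> permutes {..<length xs}"
  shows "permute_list (map_permutation {..<length xs} Suc \<pi>) (x # xs) = x # permute_list \<pi> xs"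
proof (rule nth_equalityI)
  fix i assume i: "i < length (permute_list (map_permutation {..<length xs} Suc \<pi>) (x # xs))"
  show "permute_list (map_permutation {..<length xs} Suc \<pi>) (x # xs) ! i = (x # permute_list \<pi> xs) ! i"
  proof (cases i)
    case 0
    have "map_permutation {..<length xs} Suc \<pi> 0 = 0"
      by (simp add: map_permutation_def restrict_id_def image_iff)
    then show ?thesis using i 0 by (simp add: permute_list_def del: upt_Suc)
  next
    case (Suc j)
    then have "map_permutation {..<length xs} Suc \<pi> i = Suc (\<pi> j)"
      using i by (simp add: map_permutation_apply)
    then show ?thesis using i Suc by (simp add: permute_list_def del: upt_Suc)
  qed
qed simp

lemma permute_list_transpose:
  assumes "a < length xs" "b < length xs"
  shows "permute_list (transpose a b) xs = xs[a := xs ! b, b := xs ! a]"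
  using assms
  by (intro nth_equalityI) (auto simp: permute_list_def transpose_def nth_list_update simp del: upt_Suc)

lemma permute_list_swap:
  "length us = m \<Longrightarrow> permute_list (transpose m (Suc m)) (us @ y # z # vs) = us @ z # y # vs"
  by (subst permute_list_transpose) (simp_all add: nth_append list_update_append)

context lca_module
begin

interpretation lV: module "lscale scaleV" by (rule V.module_lscale)

lemma cochain_length: "f \<in> basic_cochains q \<Longrightarrow> length as \<noteq> q \<Longrightarrow> f as = 0"
  by (simp add: basic_cochains_def)

lemma cochain_vars: "f \<in> basic_cochains q \<Longrightarrow> vars_below q (f as)"
  by (simp add: basic_cochains_def vars_below_def)

lemma cochain_add:
  "f \<in> basic_cochains q \<Longrightarrow> length as = q \<Longrightarrow> i < q \<Longrightarrow>
    f (as[i := x + y]) = f (as[i := x]) + f (as[i := y])"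
  by (simp add: basic_cochains_def)

lemma cochain_Cons_add:
  assumes "f \<in> basic_cochains q"
  shows "f ((x + y) # as) = f (x # as) + f (y # as)"
proof (cases "Suc (length as) = q")
  case True
  then show ?thesis using cochain_add[OF assms, of "x # as" 0] by simp
qed (simp add: cochain_length[OF assms])

lemma cochain_at_lvars:
  assumes "f \<in> basic_cochains q" "length as = q"
  shows "cochain_at f (map lvar [0..<q]) as = f as"
  using V.lsubst_lvars[OF cochain_vars[OF assms(1)]] by (simp add: cochain_at_def)

text \<open>
  Skew-symmetry is required of the variables \<open>\<lambda>\<^sub>i\<close> only; substituting \<open>P\<^sub>i\<close> for \<open>\<lambda>\<^sub>i\<close> yields the general case.
\<close>

lemma cochain_at_permute:
  assumes f: "f \<in> basic_cochains q" and "length Ps = q" "length as = q" "\<pi> permutes {..<q}"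
  shows "cochain_at f (permute_list \<pi> Ps) (permute_list \<pi> as) =
    lscale scaleV (of_int (sign \<pi>)) (cochain_at f Ps as)"
proof -
  have "lsubst scaleV (permute_list \<pi> (map lvar [0..<q])) (f (permute_list \<pi> as)) =
      lscale scaleV (of_int (sign \<pi>)) (f as)"
    using assms by (simp add: basic_cochains_def)
  then have "lsubst scaleV Ps (lsubst scaleV (permute_list \<pi> (map lvar [0..<q])) (f (permute_list \<pi> as))) =
      lscale scaleV (of_int (sign \<pi>)) (cochain_at f Ps as)"
    by (simp add: V.lsubst_lscale lsubst_of_int cochain_at_def)
  moreover have "map (lsubst (*) Ps) (permute_list \<pi> (map lvar [0..<q])) = permute_list \<pi> Ps"
    using assms map_lsubst_lvars[of Ps] by (simp flip: permute_list_map)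
  ultimately show ?thesis
    using cochain_vars[OF f] by (simp add: V.lsubst_lsubst cochain_at_def)
qed

section \<open>Contraction\<close>

text \<open>
  Setting the variable of \<open>a\<close> to \<open>0\<close> makes contraction commute with \<open>\<partial>\<close>: in \<open>\<partial> + \<lambda>\<^sub>1 + \<lambda>\<^sub>2 + \<dots>\<close> the
  variable belonging to \<open>a\<close> drops out.
\<close>

definition contract :: "'b \<Rightarrow> ('b list \<Rightarrow> 'v lpoly) \<Rightarrow> 'b list \<Rightarrow> 'v lpoly"
  where "contract a f as = cochain_at f (0 # map lvar [0..<length as]) (a # as)"

lemma cochain_at_contract:
  assumes f: "f \<in> basic_cochains q" and "length Ps = length as"
  shows "cochain_at (contract a f) Ps as = cochain_at f (0 # Ps) (a # as)"
proof (cases "Suc (length as) = q")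
  case True
  then have "vars_below (length (0 # map lvar [0..<length as] :: 'a poly lpoly list)) (f (a # as))"
    using cochain_vars[OF f] by simp
  from V.lsubst_lsubst[OF this, of Ps] show ?thesis
    using assms(2) map_lsubst_lvars[of Ps]
    by (simp add: cochain_at_def contract_def lsubst_ring_simps del: map_map)
qed (simp add: cochain_at_def contract_def cochain_length[OF f])

lemma contract_cochain:
  assumes f: "f \<in> basic_cochains (Suc q)"
  shows "contract a f \<in> basic_cochains q"
  unfolding basic_cochains_def
proof (intro CollectI conjI allI impI ballI)
  fix as :: "'b list" assume "length as \<noteq> q"
  then show "contract a f as = 0"
    by (simp add: contract_def cochain_at_def cochain_length[OF f])
next
  fix as :: "'b list" and n assume n: "n \<in> Poly_Mapping.keys (contract a f as)"
  have "vars_below q (contract a f as)"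
  proof (cases "length as = q")
    case True
    then show ?thesis
      unfolding contract_def cochain_at_def using cochain_vars[OF f]
      by (intro V.vars_below_lsubst) (auto simp: vars_below_lvar)
  qed (simp add: contract_def cochain_at_def cochain_length[OF f])
  then show "Poly_Mapping.keys n \<subseteq> {..<q}"
    using n by (simp add: vars_below_def)
next
  fix as :: "'b list" and i x y assume "length as = q \<and> i < q"
  then show "contract a f (as[i := x + y]) = contract a f (as[i := x]) + contract a f (as[i := y])"
    using cochain_add[OF f, of "a # as" "Suc i" x y]
    by (simp add: contract_def cochain_at_def V.lsubst_add del: upt_Suc)
next
  fix as :: "'b list" and i t x assume i: "length as = q \<and> i < q"
  then have "f ((a # as)[Suc i := scale [:t:] x]) =
      lscale scaleV (lconst [:t:]) (f ((a # as)[Suc i := x]))"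
    using f unfolding basic_cochains_def by (simp del: list_update.simps list_update_code)
  then show "contract a f (as[i := scale [:t:] x]) = lscale scaleV (lconst [:t:]) (contract a f (as[i := x]))"
    by (simp add: contract_def cochain_at_def V.lsubst_lscale lsubst_ring_simps del: upt_Suc)
next
  fix as :: "'b list" and i x assume i: "length as = q \<and> i < q"
  then have "f ((a # as)[Suc i := scale [:0, 1:] x]) =
      lscale scaleV (- lvar (Suc i)) (f ((a # as)[Suc i := x]))"
    using f unfolding basic_cochains_def by (simp del: list_update.simps list_update_code)
  then show "contract a f (as[i := scale [:0, 1:] x]) = lscale scaleV (- lvar i) (contract a f (as[i := x]))"
    using i by (simp add: contract_def cochain_at_def V.lsubst_lscale V.lsubst_uminus lsubst_ring_simps del: upt_Suc)
next
  fix as :: "'b list" and \<pi> assume *: "length as = q \<and> \<pi> permutes {..<q}"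
  let ?ls = "map lvar [0..<q] :: 'a poly lpoly list"
  let ?\<pi> = "map_permutation {..<q} Suc \<pi>"
  have "?\<pi> permutes Suc ` {..<q}"
    using * by (intro map_permutation_permutes) (auto simp: bij_betw_def)
  then have perm: "?\<pi> permutes {..<Suc q}"
    by (rule permutes_subset) auto
  have "lsubst scaleV (permute_list \<pi> ?ls) (contract a f (permute_list \<pi> as)) =
      cochain_at f (0 # permute_list \<pi> ?ls) (a # permute_list \<pi> as)"
    using * cochain_at_contract[OF f] by (simp add: cochain_at_def)
  also have "\<dots> = cochain_at f (permute_list ?\<pi> (0 # ?ls)) (permute_list ?\<pi> (a # as))"
    using * permute_list_Cons[of \<pi> as a] permute_list_Cons[of \<pi> ?ls 0] by simp
  also have "\<dots> = lscale scaleV (of_int (sign ?\<pi>)) (cochain_at f (0 # ?ls) (a # as))"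
    using * perm by (intro cochain_at_permute[OF f]) auto
  also have "sign ?\<pi> = sign \<pi>"
    using * by (intro sign_map_permutation) auto
  finally show "lsubst scaleV (permute_list \<pi> ?ls) (contract a f (permute_list \<pi> as)) =
      lscale scaleV (of_int (sign \<pi>)) (contract a f as)"
    using * by (simp add: contract_def)
qed

lemma cochain_del_contract:
  "contract a (cochain_del f) as = cochain_del (contract a f) as"
proof -
  have "(\<Sum>k<Suc (length as). (0 # map lvar [0..<length as]) ! k) = (\<Sum>k<length as. lvar k :: 'a poly lpoly)"
    by (simp only: sum.lessThan_Suc_shift) simp
  then show ?thesis
    by (simp add: contract_def cochain_at_def cochain_del_def V.lsubst_lscale lsubst_ring_simps ldel_def
      del: sum.lessThan_Suc upt_Suc)
qed

section \<open>Skew-symmetric sesquilinear functions of lists of pairs\<close>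

definition cochain_on :: "('b list \<Rightarrow> 'v lpoly) \<Rightarrow> ('a poly lpoly \<times> 'b) list \<Rightarrow> 'v lpoly"
  where "cochain_on f zs = cochain_at f (map fst zs) (map snd zs)"

text \<open>
  The entries \<open>P\<^sub>i\<close> are kept in the subring that commutes with extensions of additive maps.  It contains
  \<open>0\<close>, needed for contractions, the variables, and with \<open>P\<close> and \<open>Q\<close> also the parameter \<open>P + Q\<close> that
  belongs to the bracket of the two arguments.
\<close>

abbreviation lambda_list :: "('a poly lpoly \<times> 'b) list \<Rightarrow> bool"
  where "lambda_list zs \<equiv> fst ` set zs \<subseteq> lambda_polys"

definition skew_conformal :: "(('a poly lpoly \<times> 'b) list \<Rightarrow> 'v lpoly) \<Rightarrow> bool"
  where "skew_conformal F \<longleftrightarrow>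
    (\<forall>us vs P x y. lambda_list us \<and> lambda_list vs \<and> P \<in> lambda_polys \<longrightarrow>
      F (us @ (P, x + y) # vs) = F (us @ (P, x) # vs) + F (us @ (P, y) # vs)) \<and>
    (\<forall>us vs P t x. lambda_list us \<and> lambda_list vs \<and> P \<in> lambda_polys \<longrightarrow>
      F (us @ (P, scale [:t:] x) # vs) = lscale scaleV (lconst [:t:]) (F (us @ (P, x) # vs))) \<and>
    (\<forall>us vs P x. lambda_list us \<and> lambda_list vs \<and> P \<in> lambda_polys \<longrightarrow>
      F (us @ (P, scale [:0, 1:] x) # vs) = lscale scaleV (- P) (F (us @ (P, x) # vs))) \<and>
    (\<forall>us vs y z. lambda_list us \<and> lambda_list vs \<and> fst y \<in> lambda_polys \<and> fst z \<in> lambda_polys \<longrightarrow>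
      F (us @ z # y # vs) = - F (us @ y # z # vs))"

lemma skew_conformalD:
  assumes "skew_conformal F" "lambda_list us" "lambda_list vs"
  shows "P \<in> lambda_polys \<Longrightarrow> F (us @ (P, x + y) # vs) = F (us @ (P, x) # vs) + F (us @ (P, y) # vs)"
    and "P \<in> lambda_polys \<Longrightarrow> F (us @ (P, scale [:t:] x) # vs) = lscale scaleV (lconst [:t:]) (F (us @ (P, x) # vs))"
    and "P \<in> lambda_polys \<Longrightarrow> F (us @ (P, scale [:0, 1:] x) # vs) = lscale scaleV (- P) (F (us @ (P, x) # vs))"
    and "fst y' \<in> lambda_polys \<Longrightarrow> fst z \<in> lambda_polys \<Longrightarrow> F (us @ z # y' # vs) = - F (us @ y' # z # vs)"
  using assms unfolding skew_conformal_def by blast+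

text \<open>
  Fixing an initial segment of the arguments preserves the property; this drives all inductions below.
\<close>

lemma skew_conformal_append:
  assumes F: "skew_conformal F" and ws: "lambda_list ws"
  shows "skew_conformal (\<lambda>zs. F (ws @ zs))"
  unfolding skew_conformal_def
proof (intro conjI allI impI; elim conjE)
  fix us vs and P :: "'a poly lpoly" and x y
  assume *: "lambda_list us" "lambda_list vs" "P \<in> lambda_polys"
  show "F (ws @ us @ (P, x + y) # vs) = F (ws @ us @ (P, x) # vs) + F (ws @ us @ (P, y) # vs)"
    using skew_conformalD(1)[OF F, of "ws @ us" vs P x y] ws * by (simp add: image_Un)
next
  fix us vs and P :: "'a poly lpoly" and t x
  assume *: "lambda_list us" "lambda_list vs" "P \<in> lambda_polys"
  show "F (ws @ us @ (P, scale [:t:] x) # vs) = lscale scaleV (lconst [:t:]) (F (ws @ us @ (P, x) # vs))"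
    using skew_conformalD(2)[OF F, of "ws @ us" vs P t x] ws * by (simp add: image_Un)
next
  fix us vs and P :: "'a poly lpoly" and x
  assume *: "lambda_list us" "lambda_list vs" "P \<in> lambda_polys"
  show "F (ws @ us @ (P, scale [:0, 1:] x) # vs) = lscale scaleV (- P) (F (ws @ us @ (P, x) # vs))"
    using skew_conformalD(3)[OF F, of "ws @ us" vs P x] ws * by (simp add: image_Un)
next
  fix us vs and y z :: "'a poly lpoly \<times> 'b"
  assume *: "lambda_list us" "lambda_list vs" "fst y \<in> lambda_polys" "fst z \<in> lambda_polys"
  show "F (ws @ us @ z # y # vs) = - F (ws @ us @ y # z # vs)"
    using skew_conformalD(4)[OF F, of "ws @ us" vs y z] ws * by (simp add: image_Un)
qed

lemma skew_conformal_Cons: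
  "skew_conformal F \<Longrightarrow> fst z \<in> lambda_polys \<Longrightarrow> skew_conformal (\<lambda>zs. F (z # zs))"
  using skew_conformal_append[of F "[z]"] by simp

lemma skew_conformal_to_front:
  assumes F: "skew_conformal F" and "lambda_list us" "lambda_list vs" "fst z \<in> lambda_polys"
  shows "F (z # us @ vs) = lscale scaleV ((- 1) ^ length us) (F (us @ z # vs))"
  using assms(2,3)
proof (induction us arbitrary: vs rule: rev_induct)
  case (snoc y us)
  then show ?case
    using snoc.IH[of "y # vs"] skew_conformalD(4)[OF F, of us vs z y] assms(4) by simp
qed simp

lemma skew_conformal_transpose:
  assumes F: "skew_conformal F" and "lambda_list us" "lambda_list ms" "lambda_list vs"
    and yz: "fst y \<in> lambda_polys" "fst z \<in> lambda_polys"
  shows "F (us @ z # ms @ y # vs) = - F (us @ y # ms @ z # vs)"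
proof -
  have Fus: "skew_conformal (\<lambda>zs. F (us @ zs))"
    by (rule skew_conformal_append[OF F assms(2)])
  show ?thesis
    using skew_conformal_to_front[OF Fus, of ms "y # vs" z] skew_conformal_to_front[OF Fus, of ms "z # vs" y]
      skew_conformalD(4)[OF F, of "us @ ms" vs y z] assms by (simp add: image_Un)
qed

text \<open>
  Every permutation is a product of transpositions, and a transposition is reduced to an adjacent one by moving
  one of its two entries across the entries in between, at the cost of the same sign twice.
\<close>

lemma skew_conformal_permute:
  assumes F: "skew_conformal F" and "lambda_list zs" "\<pi> permutes {..<length zs}"
  shows "F (permute_list \<pi> zs) = lscale scaleV (of_int (sign \<pi>)) (F zs)"
  using finite_lessThan assms(3)
proof (induction rule: permutes_rev_induct)
  case (swap a b p)
  let ?xs = "permute_list p zs"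
  have *: "F (permute_list (transpose a b) ?xs) = - F ?xs" if ab: "a < b" "b < length zs" for a b
  proof -
    define us ms vs where "us = take a ?xs" "ms = take (b - Suc a) (drop (Suc a) ?xs)" "vs = drop (Suc b) ?xs"
    have "?xs = us @ ?xs ! a # drop (Suc a) ?xs"
      unfolding us_ms_vs_def using ab by (intro id_take_nth_drop) simp
    also have "drop (Suc a) ?xs = ms @ drop (Suc a) ?xs ! (b - Suc a) # drop (Suc (b - Suc a)) (drop (Suc a) ?xs)"
      unfolding us_ms_vs_def using ab by (intro id_take_nth_drop) simp
    also have "drop (Suc a) ?xs ! (b - Suc a) # drop (Suc (b - Suc a)) (drop (Suc a) ?xs) = ?xs ! b # vs"
      using ab by (simp add: us_ms_vs_def)
    finally have xs: "?xs = us @ ?xs ! a # ms @ ?xs ! b # vs" .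
    have len: "length us = a" "length ms = b - Suc a"
      using ab by (auto simp: us_ms_vs_def)
    have lam: "lambda_list ?xs" using assms(2) swap by simp
    have lams: "lambda_list us" "lambda_list ms" "lambda_list vs"
      "fst (?xs ! a) \<in> lambda_polys" "fst (?xs ! b) \<in> lambda_polys"
      using lam by (subst (asm) xs; simp add: image_Un)+
    have "permute_list (transpose a b) ?xs = ?xs[a := ?xs ! b, b := ?xs ! a]"
      using ab by (intro permute_list_transpose) auto
    also have "\<dots> = (us @ ?xs ! a # ms @ ?xs ! b # vs)[a := ?xs ! b, b := ?xs ! a]"
      by (subst xs) (rule refl)
    also have "\<dots> = us @ ?xs ! b # ms @ ?xs ! a # vs"
      using ab len by (auto simp: list_update_append split: nat.split)
    finally show ?thesis
      using skew_conformal_transpose[OF F lams(1-3), of "?xs ! a" "?xs ! b"] lams xs by metis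
  qed
  have "F (permute_list (transpose a b) ?xs) = - F ?xs"
    using *[of a b] *[of b a] swap by (cases a b rule: linorder_cases) (auto simp: transpose_commute)
  moreover have "permute_list (p \<circ> transpose a b) zs = permute_list (transpose a b) ?xs"
    using swap by (intro permute_list_compose permutes_swap_id) auto
  moreover have "sign (p \<circ> transpose a b) = - sign p"
    using swap permutes_imp_permutation[OF finite_lessThan \<open>p permutes {..<length zs}\<close>]
    by (simp add: sign_compose[OF _ permutation_swap_id] sign_swap_id del: o_apply)
  ultimately show ?case
    using swap by (simp only: of_int_minus lV.scale_minus_left)
qed (simp add: V.lscale_1)

lemma map_append_update: "(map g us @ x # vs)[length us := y] = map g us @ y # vs"
  using list_update_length[of "map g us"] by simp

lemma cochain_on_skew_conformal:
  assumes f: "f \<in> basic_cochains q"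
  shows "skew_conformal (cochain_on f)"
  unfolding skew_conformal_def
proof (intro conjI allI impI)
  fix us vs :: "('a poly lpoly \<times> 'b) list" and P x y
  show "cochain_on f (us @ (P, x + y) # vs) = cochain_on f (us @ (P, x) # vs) + cochain_on f (us @ (P, y) # vs)"
  proof (cases "length us + length vs + 1 = q")
    case True
    then show ?thesis
      using cochain_add[OF f, of "map snd us @ x # map snd vs" "length us" x y]
      by (simp add: cochain_on_def cochain_at_def V.lsubst_add map_append_update)
  qed (simp add: cochain_on_def cochain_at_def cochain_length[OF f])
next
  fix us vs :: "('a poly lpoly \<times> 'b) list" and P t x
  show "cochain_on f (us @ (P, scale [:t:] x) # vs) = lscale scaleV (lconst [:t:]) (cochain_on f (us @ (P, x) # vs))"
  proof (cases "length us + length vs + 1 = q")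
    case True
    then have "f ((map snd us @ x # map snd vs)[length us := scale [:t:] x]) =
        lscale scaleV (lconst [:t:]) (f ((map snd us @ x # map snd vs)[length us := x]))"
      using f by (simp add: basic_cochains_def)
    then show ?thesis
      by (simp add: cochain_on_def cochain_at_def V.lsubst_lscale lsubst_ring_simps map_append_update)
  qed (simp add: cochain_on_def cochain_at_def cochain_length[OF f])
next
  fix us vs :: "('a poly lpoly \<times> 'b) list" and P x
  show "cochain_on f (us @ (P, scale [:0, 1:] x) # vs) = lscale scaleV (- P) (cochain_on f (us @ (P, x) # vs))"
  proof (cases "length us + length vs + 1 = q")
    case True
    then have "f ((map snd us @ x # map snd vs)[length us := scale [:0, 1:] x]) =
        lscale scaleV (- lvar (length us)) (f ((map snd us @ x # map snd vs)[length us := x]))"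
      using f by (simp add: basic_cochains_def del: lV.scale_minus_left)
    then have "cochain_on f (us @ (P, scale [:0, 1:] x) # vs) =
        lscale scaleV (lsubst (*) (map fst (us @ (P, x) # vs)) (- lvar (length us))) (cochain_on f (us @ (P, x) # vs))"
      by (simp add: cochain_on_def cochain_at_def V.lsubst_lscale map_append_update del: lV.scale_minus_left)
    then show ?thesis
      by (simp add: lsubst_ring_simps nth_append)
  qed (simp add: cochain_on_def cochain_at_def cochain_length[OF f])
next
  fix us vs :: "('a poly lpoly \<times> 'b) list" and y z
  let ?m = "length us"
  show "cochain_on f (us @ z # y # vs) = - cochain_on f (us @ y # z # vs)"
  proof (cases "length us + length vs + 2 = q")
    case True
    have "transpose ?m (Suc ?m) permutes {..<q}"
      using True by (intro permutes_swap_id) auto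
    then show ?thesis
      using cochain_at_permute[OF f, of "map fst (us @ y # z # vs)" "map snd (us @ y # z # vs)"
          "transpose ?m (Suc ?m)"] True
      by (simp add: cochain_on_def sign_swap_id permute_list_swap)
  qed (simp add: cochain_on_def cochain_at_def cochain_length[OF f])
qed

end

section \<open>The differential as an operation on functions of lists\<close>

lemma (in module) vars_below_lext:
  assumes "vars_below q w" "\<And>v. vars_below q (g v)"
  shows "vars_below q (lext scale g w)"
  unfolding lext_def
proof (intro vars_below_sum vars_below_lscale assms(2))
  fix n assume "n \<in> Poly_Mapping.keys w"
  then show "vars_below q (Poly_Mapping.single n 1 :: 'a lpoly)"
    using assms(1) by (auto simp: vars_below_def keys_single)
qed

lemma (in module) vars_below_leval: "vars_below q P \<Longrightarrow> vars_below q (leval scale P p)"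
  unfolding leval_def by (intro vars_below_sum vars_below_lscale vars_below_power vars_below_lconst)

context lca_module
begin

interpretation lV: module "lscale scaleV" by (rule V.module_lscale)
interpretation lA: module "lscale scale" by (rule module_lscale)

definition act_at :: "'a poly lpoly \<times> 'b \<Rightarrow> 'v lpoly \<Rightarrow> 'v lpoly"
  where "act_at z w = lext scaleV (\<lambda>v. leval scaleV (fst z) (act (snd z) v)) w"

definition bracket_at ::
  "('a poly lpoly \<times> 'b \<Rightarrow> 'v lpoly) \<Rightarrow> 'a poly lpoly \<times> 'b \<Rightarrow> 'a poly lpoly \<times> 'b \<Rightarrow> 'v lpoly"
  where "bracket_at G y z =
    lext scaleV (\<lambda>x. G (fst y + fst z, x)) (leval scale (fst y) (bracket (snd y) (snd z)))"

definition diff_at :: "(('a poly lpoly \<times> 'b) list \<Rightarrow> 'v lpoly) \<Rightarrow> ('a poly lpoly \<times> 'b) list \<Rightarrow> 'v lpoly"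
  where "diff_at F zs =
    (\<Sum>k<length zs. lscale scaleV ((- 1) ^ k) (act_at (zs ! k) (F (omit k zs)))) +
    (\<Sum>l<length zs. \<Sum>k<l. lscale scaleV ((- 1) ^ (k + l))
      (bracket_at (\<lambda>y. F (y # omit k (omit l zs))) (zs ! k) (zs ! l)))"

text \<open>
  The part of the Lie derivative along \<open>z\<close> that acts on the arguments, each \<open>z\<^sub>l\<close> being replaced in
  its place by its bracket with \<open>z\<close>.
\<close>

definition bracket_sum ::
  "(('a poly lpoly \<times> 'b) list \<Rightarrow> 'v lpoly) \<Rightarrow> 'a poly lpoly \<times> 'b \<Rightarrow> ('a poly lpoly \<times> 'b) list \<Rightarrow> 'v lpoly"
  where "bracket_sum F z zs = (\<Sum>l<length zs. bracket_at (\<lambda>y. F (zs[l := y])) z (zs ! l))"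

lemma act_map: "additive_coefficient_map scaleV scaleV (\<lambda>v. leval scaleV P (act a v))"
  by unfold_locales (simp add: act_add_right V.leval_add)

lemma act_at_add: "act_at z (v + w) = act_at z v + act_at z w"
  unfolding act_at_def by (rule V.lext_add) (simp add: act_add_right V.leval_add)

lemma act_at_uminus: "act_at z (- w) = - act_at z w"
  unfolding act_at_def by (rule V.lext_uminus) (simp add: act_add_right V.leval_add)

lemma act_at_lambda: "P \<in> lambda_polys \<Longrightarrow> act_at z (lscale scaleV P w) = lscale scaleV P (act_at z w)"
  unfolding act_at_def by (rule additive_coefficient_map.lext_lscale_lambda[OF act_map])

lemma act_at_const:
  "act_at z (lscale scaleV (lconst [:t:]) w) = lscale scaleV (lconst [:t:]) (act_at z w)"
  unfolding act_at_def
  by (rule lext_lscale_lconst) (unfold_locales, simp_all add: act_add_right V.leval_add act_scale_right V.leval_map_poly)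

lemma act_at_del: "act_at z (lscale scaleV ldel w) = lscale scaleV (ldel + fst z) (act_at z w)"
  unfolding act_at_def ldel_def
  by (rule lext_lscale_lconst)
     (unfold_locales, simp_all add: act_add_right V.leval_add act_del_right V.leval_map_poly
       V.leval_pCons lV.scale_left_distrib)

lemma act_at_arg:
  "act_at (P, x + y) w = act_at (P, x) w + act_at (P, y) w"
  "act_at (P, scale [:t:] x) w = lscale scaleV (lconst [:t:]) (act_at (P, x) w)"
  "act_at (P, scale [:0, 1:] x) w = lscale scaleV (- P) (act_at (P, x) w)"
  unfolding act_at_def
  by (simp_all add: act_add_left act_scale_left act_del_left V.leval_add V.leval_uminus V.leval_map_poly
      V.leval_pCons V.lext_fun_add V.lext_fun_lscale V.lext_fun_uminus)

lemma bracket_at_fun: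
  "bracket_at (\<lambda>x. G x + H x) y z = bracket_at G y z + bracket_at H y z"
  "bracket_at (\<lambda>x. - G x) y z = - bracket_at G y z"
  "bracket_at (\<lambda>x. lscale scaleV P (G x)) y z = lscale scaleV P (bracket_at G y z)"
  unfolding bracket_at_def by (simp_all add: V.lext_fun_add V.lext_fun_lscale V.lext_fun_uminus)

lemma bracket_at_cong:
  "(\<And>x. G (fst y + fst z, x) = H (fst y + fst z, x)) \<Longrightarrow> bracket_at G y z = bracket_at H y z"
  by (simp add: bracket_at_def)

text \<open>
  The behaviour of one argument when all others are fixed.
\<close>

definition conformal_slot :: "('a poly lpoly \<times> 'b \<Rightarrow> 'v lpoly) \<Rightarrow> bool"
  where "conformal_slot G \<longleftrightarrow> (\<forall>P\<in>lambda_polys. \<forall>x y t.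
    G (P, x + y) = G (P, x) + G (P, y) \<and>
    G (P, scale [:t:] x) = lscale scaleV (lconst [:t:]) (G (P, x)) \<and>
    G (P, scale [:0, 1:] x) = lscale scaleV (- P) (G (P, x)))"

lemma skew_conformal_slot:
  assumes "skew_conformal F" "lambda_list us" "lambda_list vs"
  shows "conformal_slot (\<lambda>y. F (us @ y # vs))"
  unfolding conformal_slot_def using skew_conformalD(1-3)[OF assms] by blast

lemma slot_map:
  assumes "conformal_slot G" "P \<in> lambda_polys"
  shows "additive_coefficient_map scaleV scale (\<lambda>x. G (P, x))"
  using assms by unfold_locales (simp add: conformal_slot_def)

lemma bracket_at_arg:
  assumes G: "conformal_slot G" and P: "P \<in> lambda_polys" "fst z \<in> lambda_polys"
  shows "bracket_at G (P, x + y) z = bracket_at G (P, x) z + bracket_at G (P, y) z"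
    and "bracket_at G (P, scale [:t:] x) z = lscale scaleV (lconst [:t:]) (bracket_at G (P, x) z)"
    and "bracket_at G (P, scale [:0, 1:] x) z = lscale scaleV (- P) (bracket_at G (P, x) z)"
proof -
  have PQ: "P + fst z \<in> lambda_polys" using P by (rule lambda_polys.add)
  interpret g: additive_coefficient_map scaleV scale "\<lambda>x. G (P + fst z, x)"
    by (rule slot_map[OF G PQ])
  have c: "lext scaleV (\<lambda>x. G (P + fst z, x)) (lscale scale (lconst [:t:]) w) =
      lscale scaleV (lconst [:t:]) (lext scaleV (\<lambda>x. G (P + fst z, x)) w)" for w
    using G PQ by (intro lext_lscale_lconst V.module_axioms module_axioms g.g_add) (simp add: conformal_slot_def)
  show "bracket_at G (P, x + y) z = bracket_at G (P, x) z + bracket_at G (P, y) z"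
    by (simp add: bracket_at_def bracket_add_left leval_add V.lext_add[of "\<lambda>x. G (P + fst z, x)", OF g.g_add])
  show "bracket_at G (P, scale [:t:] x) z = lscale scaleV (lconst [:t:]) (bracket_at G (P, x) z)"
    by (simp add: bracket_at_def bracket_scale_left leval_map_poly c)
  show "bracket_at G (P, scale [:0, 1:] x) z = lscale scaleV (- P) (bracket_at G (P, x) z)"
    using P(1) g.lext_lscale_lambda[of "- P"]
    by (simp add: bracket_at_def bracket_del_left leval_uminus leval_pCons lambda_polys.uminus)
qed

text \<open>
  The bracket satisfies \<open>[a\<^bsub>P\<^esub> b] = -[b\<^bsub>-P-\<partial>\<^esub> a]\<close>.  In an argument with parameter \<open>P + Q\<close>, the operator \<open>\<partial>\<close> becomes
  \<open>-(P + Q)\<close>, and therefore \<open>-P - \<partial>\<close> becomes \<open>Q\<close>.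
\<close>

lemma bracket_at_skew:
  assumes G: "conformal_slot G" and yz: "fst y \<in> lambda_polys" "fst z \<in> lambda_polys"
  shows "bracket_at G z y = - bracket_at G y z"
proof -
  obtain P a Q b where eq: "y = (P, a)" "z = (Q, b)" by (cases y, cases z) auto
  have P: "P \<in> lambda_polys" "Q \<in> lambda_polys" "P + Q \<in> lambda_polys"
    using yz by (auto simp: eq intro: lambda_polys.add)
  let ?G = "lext scaleV (\<lambda>x. G (P + Q, x))"
  interpret g: additive_coefficient_map scaleV scale "\<lambda>x. G (P + Q, x)"
    by (rule slot_map[OF G P(3)])
  have del: "?G (lscale scale ldel w) = lscale scaleV (- (P + Q)) (?G w)" for w
    unfolding ldel_def using G P(3)
    by (intro lext_lscale_lconst V.module_axioms module_axioms g.g_add) (simp add: conformal_slot_def del: lV.scale_minus_left)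
  have X: "?G (lscale scale (- P - ldel) w) = lscale scaleV Q (?G w)" for w
  proof -
    have "?G (lscale scale (- P - ldel) w) = ?G (lscale scale (- P) w) + - ?G (lscale scale ldel w)"
      using V.lext_add[of "\<lambda>x. G (P + Q, x)", OF g.g_add] V.lext_uminus[of "\<lambda>x. G (P + Q, x)", OF g.g_add]
      unfolding diff_conv_add_uminus lA.scale_left_distrib by (simp only: lA.scale_minus_left)
    also have "\<dots> = lscale scaleV (- P) (?G w) + lscale scaleV (P + Q) (?G w)"
      unfolding g.lext_lscale_lambda[OF lambda_polys.uminus[OF P(1)]] del
      by (simp only: lV.scale_minus_left minus_minus)
    also have "\<dots> = lscale scaleV Q (?G w)"
      unfolding lV.scale_left_distrib[symmetric] by simp
    finally show ?thesis .
  qed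
  have Xi: "?G (lscale scale ((- P - ldel) ^ i) w) = lscale scaleV (Q ^ i) (?G w)" for i w
    by (induction i) (simp_all only: power_0 power_Suc lV.scale_one lA.scale_one lscale_mult V.lscale_mult X)
  have "leval scale P (bracket a b) = lsubst scale [P] (leval scale (lvar 0) (bracket a b))"
    by (simp add: lsubst_leval)
  also have "\<dots> = - leval scale (- P - ldel) (bracket b a)"
    unfolding bracket_skew by (simp add: lsubst_leval lsubst_uminus ldel_def lsubst_ring_simps)
  finally have "bracket_at G y z = - ?G (leval scale (- P - ldel) (bracket b a))"
    using V.lext_uminus[of "\<lambda>x. G (P + Q, x)", OF g.g_add] by (simp add: bracket_at_def eq)
  also have "?G (leval scale (- P - ldel) (bracket b a)) =
      (\<Sum>i\<le>degree (bracket b a). ?G (lscale scale ((- P - ldel) ^ i) (lconst (coeff (bracket b a) i))))"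
    unfolding leval_def by (rule V.lext_sum) (rule g.g_add)
  also have "\<dots> = ?G (leval scale Q (bracket b a))"
    unfolding g.lext_leval[OF P(2)]
    by (intro sum.cong refl) (simp only: Xi V.lext_lconst[of "\<lambda>x. G (P + Q, x)", OF g.g_0])
  finally show ?thesis
    by (simp add: bracket_at_def eq add.commute)
qed

lemma bracket_sum_Nil [simp]: "bracket_sum F z [] = 0"
  by (simp add: bracket_sum_def)

lemma bracket_sum_Cons [simp]:
  "bracket_sum F z (y # ys) = bracket_at (\<lambda>x. F (x # ys)) z y + bracket_sum (\<lambda>xs. F (y # xs)) z ys"
  unfolding bracket_sum_def list.size add_0_right add_Suc_right sum.lessThan_Suc_shift by simp

lemma bracket_sum_cong:
  assumes "\<And>us vs y. us @ y # vs = zs \<Longrightarrow> bracket_at (\<lambda>x. F (us @ x # vs)) z y = bracket_at (\<lambda>x. G (us @ x # vs)) z y"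
  shows "bracket_sum F z zs = bracket_sum G z zs"
  unfolding bracket_sum_def
proof (intro sum.cong refl)
  fix l assume "l \<in> {..<length zs}"
  then show "bracket_at (\<lambda>y. F (zs[l := y])) z (zs ! l) = bracket_at (\<lambda>y. G (zs[l := y])) z (zs ! l)"
    using assms[of "take l zs" "zs ! l" "drop (Suc l) zs"]
    by (simp add: upd_conv_take_nth_drop id_take_nth_drop[symmetric])
qed

lemma bracket_sum_uminus:
  "bracket_sum (\<lambda>xs. - F xs) z zs = - bracket_sum F z zs"
  by (simp add: bracket_sum_def bracket_at_fun sum_negf)

lemma diff_at_add: "diff_at (\<lambda>ys. F ys + G ys) zs = diff_at F zs + diff_at G zs"
  by (simp add: diff_at_def act_at_add bracket_at_fun lV.scale_right_distrib sum.distrib ac_simps)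

lemma diff_at_uminus: "diff_at (\<lambda>ys. - F ys) zs = - diff_at F zs"
  by (simp add: diff_at_def act_at_uminus bracket_at_fun sum_negf)

lemma diff_at_lscale:
  assumes "\<And>z w. act_at z (lscale scaleV P w) = lscale scaleV P (act_at z w)"
  shows "diff_at (\<lambda>ys. lscale scaleV P (F ys)) zs = lscale scaleV P (diff_at F zs)"
  by (simp add: diff_at_def assms bracket_at_fun lV.scale_sum_right lV.scale_right_distrib mult.commute)

lemma diff_at_cong:
  assumes "\<And>k. k < length zs \<Longrightarrow> F (omit k zs) = G (omit k zs)"
    and "\<And>k l x. k < l \<Longrightarrow> l < length zs \<Longrightarrow>
      F ((fst (zs ! k) + fst (zs ! l), x) # omit k (omit l zs)) = G ((fst (zs ! k) + fst (zs ! l), x) # omit k (omit l zs))"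
  shows "diff_at F zs = diff_at G zs"
  unfolding diff_at_def bracket_at_def using assms
  by (intro arg_cong2[where f = "(+)"] sum.cong refl) simp_all

text \<open>
  In the terms of the differential, \<open>z\<close> acts, or remains an argument, or is bracketed.  The terms where it remains
  an argument form the differential of \<open>F (z # _)\<close> with the opposite sign: an action at index \<open>k\<close> now has index
  \<open>k + 1\<close>, and a bracket of two later arguments stands in front of \<open>z\<close> instead of behind it.  Moving a
  bracket \<open>[z, z\<^sub>l]\<close> from the front to the place of \<open>z\<^sub>l\<close> produces a sign that cancels the alternating
  sign of the term up to a global minus.
\<close>

lemma diff_at_Cons:
  assumes F: "skew_conformal F" and z: "fst z \<in> lambda_polys" and zs: "lambda_list zs"
  shows "diff_at F (z # zs) = act_at z (F zs) - diff_at (\<lambda>ys. F (z # ys)) zs - bracket_sum F z zs"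
proof -
  define A where "A k = act_at (zs ! k) (F (z # omit k zs))" for k
  define B where "B k l = bracket_at (\<lambda>y. F (z # y # omit k (omit l zs))) (zs ! k) (zs ! l)" for k l
  have lam: "fst (zs ! k) \<in> lambda_polys" if "k < length zs" for k
    using zs that by auto
  have lam_omit: "lambda_list (omit k ys)" if "lambda_list ys" for k and ys :: "('a poly lpoly \<times> 'b) list"
    using that set_omit[of k ys] by blast
  have B: "bracket_at (\<lambda>y. F (y # z # omit k (omit l zs))) (zs ! k) (zs ! l) = - B k l" if "k < l" "l < length zs" for k l
    unfolding B_def bracket_at_fun(2)[symmetric]
  proof (rule bracket_at_cong)
    fix x
    have "fst (zs ! k) + fst (zs ! l) \<in> lambda_polys"
      using that lam by (intro lambda_polys.add) auto
    then show "F ((fst (zs ! k) + fst (zs ! l), x) # z # omit k (omit l zs)) =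
        - F (z # (fst (zs ! k) + fst (zs ! l), x) # omit k (omit l zs))"
      using skew_conformalD(4)[OF F, of "[]" "omit k (omit l zs)" z "(fst (zs ! k) + fst (zs ! l), x)"] z zs lam_omit
      by simp
  qed
  have N: "bracket_at (\<lambda>y. F (y # omit l zs)) z (zs ! l) =
      lscale scaleV ((- 1) ^ l) (bracket_at (\<lambda>y. F (zs[l := y])) z (zs ! l))" if l: "l < length zs" for l
    unfolding bracket_at_fun(3)[symmetric]
  proof (rule bracket_at_cong)
    fix x
    have "lambda_list (take l zs)" "lambda_list (drop (Suc l) zs)"
      using zs set_take_subset[of l zs] set_drop_subset[of "Suc l" zs] by blast+
    moreover have "fst z + fst (zs ! l) \<in> lambda_polys"
      using z lam[OF l] by (rule lambda_polys.add)
    ultimately show "F ((fst z + fst (zs ! l), x) # omit l zs) =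
        lscale scaleV ((- 1) ^ l) (F (zs[l := (fst z + fst (zs ! l), x)]))"
      using l skew_conformal_to_front[OF F, of "take l zs" "drop (Suc l) zs" "(fst z + fst (zs ! l), x)"]
      by (simp add: omit_def upd_conv_take_nth_drop min_def)
  qed
  have N': "lscale scaleV ((- 1) ^ Suc l) (bracket_at (\<lambda>y. F (y # omit l zs)) z (zs ! l)) =
      - bracket_at (\<lambda>y. F (zs[l := y])) z (zs ! l)" if "l < length zs" for l
    unfolding N[OF that] by (simp flip: power_add mult_2)
  have "diff_at F (z # zs) = act_at z (F zs)
      + (\<Sum>k<length zs. lscale scaleV ((- 1) ^ Suc k) (A k))
      + ((\<Sum>l<length zs. lscale scaleV ((- 1) ^ Suc l) (bracket_at (\<lambda>y. F (y # omit l zs)) z (zs ! l)))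
      + (\<Sum>l<length zs. \<Sum>k<l. lscale scaleV ((- 1) ^ (Suc k + Suc l))
        (bracket_at (\<lambda>y. F (y # z # omit k (omit l zs))) (zs ! k) (zs ! l))))"
    unfolding diff_at_def list.size add_0_right add_Suc_right sum.lessThan_Suc_shift A_def
    by (simp only: nth_Cons_0 nth_Cons_Suc omit_Cons power_0 lV.scale_one add_0_left lessThan_0 sum.empty
        add_0 add_Suc sum.distrib)
  also have "(\<Sum>l<length zs. lscale scaleV ((- 1) ^ Suc l) (bracket_at (\<lambda>y. F (y # omit l zs)) z (zs ! l))) =
      - bracket_sum F z zs"
    unfolding bracket_sum_def sum_negf[symmetric] by (intro sum.cong refl) (simp only: N' lessThan_iff)
  also have "(\<Sum>l<length zs. \<Sum>k<l. lscale scaleV ((- 1) ^ (Suc k + Suc l))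
        (bracket_at (\<lambda>y. F (y # z # omit k (omit l zs))) (zs ! k) (zs ! l))) =
      - (\<Sum>l<length zs. \<Sum>k<l. lscale scaleV ((- 1) ^ (k + l)) (B k l))"
    unfolding sum_negf[symmetric]
    by (intro sum.cong refl) (simp only: B lessThan_iff power_Suc add_Suc add_Suc_right mult_minus1
        minus_minus lV.scale_minus_right)
  finally show ?thesis
    unfolding diff_at_def[of "\<lambda>ys. F (z # ys)"] A_def B_def
    by (simp add: sum_negf)
qed

lemma bracket_sum_skew:
  assumes F: "skew_conformal F" and "lambda_list us" "lambda_list vs" "fst x \<in> lambda_polys"
    and "fst y \<in> lambda_polys" "fst z \<in> lambda_polys"
  shows "bracket_sum F x (us @ z # y # vs) = - bracket_sum F x (us @ y # z # vs)"
  using F assms(2)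
proof (induction us arbitrary: F)
  case Nil
  note sk = skew_conformalD(4)[OF Nil(1), of "[]" vs, simplified]
  have "bracket_at (\<lambda>w. F (w # y # vs)) x z = - bracket_at (\<lambda>w. F (y # w # vs)) x z"
    "bracket_at (\<lambda>w. F (z # w # vs)) x y = - bracket_at (\<lambda>w. F (w # z # vs)) x y"
    unfolding bracket_at_fun(2)[symmetric] using assms
    by (auto intro!: bracket_at_cong sk lambda_polys.add)
  moreover have "bracket_sum (\<lambda>xs. F (z # y # xs)) x vs = - bracket_sum (\<lambda>xs. F (y # z # xs)) x vs"
    unfolding bracket_sum_uminus[symmetric]
  proof (intro bracket_sum_cong bracket_at_cong)
    fix us ws w v
    assume vs: "us @ w # ws = vs"
    show "F (z # y # us @ (fst x + fst w, v) # ws) = - F (y # z # us @ (fst x + fst w, v) # ws)"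
      using skew_conformalD(4)[OF Nil(1), of "[]" "us @ (fst x + fst w, v) # ws" y z] assms
      by (auto simp: image_Un intro: lambda_polys.add simp flip: vs)
  qed
  ultimately show ?case by simp
next
  case (Cons u us)
  have "bracket_at (\<lambda>w. F (w # us @ z # y # vs)) x u = - bracket_at (\<lambda>w. F (w # us @ y # z # vs)) x u"
    unfolding bracket_at_fun(2)[symmetric]
  proof (rule bracket_at_cong)
    fix v
    show "F ((fst x + fst u, v) # us @ z # y # vs) = - F ((fst x + fst u, v) # us @ y # z # vs)"
      using skew_conformalD(4)[OF Cons.prems(1), of "(fst x + fst u, v) # us" vs y z] assms Cons.prems
      by (simp add: lambda_polys.add)
  qed
  then show ?case
    using Cons.IH[OF skew_conformal_Cons[OF Cons.prems(1), of u]] Cons.prems by simp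
qed

text \<open>
  Induction on the entries before the two that are exchanged.  If there are none, both entries are split off
  by \<open>diff_at_Cons\<close>: the resulting terms are exchanged in pairs, except for the
  bracket of the two entries, which is skew by itself.
\<close>

lemma diff_at_skew:
  assumes "skew_conformal F" "lambda_list us" "lambda_list vs" "fst y \<in> lambda_polys" "fst z \<in> lambda_polys"
  shows "diff_at F (us @ z # y # vs) = - diff_at F (us @ y # z # vs)"
  using assms(1,2)
proof (induction us arbitrary: F)
  case Nil
  note F = Nil(1)
  have "bracket_at (\<lambda>w. F (w # vs)) z y = - bracket_at (\<lambda>w. F (w # vs)) y z"
    using bracket_at_skew[OF skew_conformal_slot[OF F, of "[]" vs], of y z] assms by simp
  moreover have "diff_at (\<lambda>ys. F (z # y # ys)) vs = - diff_at (\<lambda>ys. F (y # z # ys)) vs"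
    unfolding diff_at_uminus[symmetric]
  proof (rule diff_at_cong)
    have lam: "lambda_list (omit k ys)" if "lambda_list ys" for k and ys :: "('a poly lpoly \<times> 'b) list"
      using that set_omit[of k ys] by blast
    fix k
    show "F (z # y # omit k vs) = - F (y # z # omit k vs)"
      using skew_conformalD(4)[OF F, of "[]" "omit k vs" y z] assms lam by simp
    fix l x assume "k < l" "l < length vs"
    then have "fst (vs ! k) + fst (vs ! l) \<in> lambda_polys"
      using assms(3) by (intro lambda_polys.add) auto
    then show "F (z # y # (fst (vs ! k) + fst (vs ! l), x) # omit k (omit l vs)) =
        - F (y # z # (fst (vs ! k) + fst (vs ! l), x) # omit k (omit l vs))"
      using skew_conformalD(4)[OF F, of "[]" "(fst (vs ! k) + fst (vs ! l), x) # omit k (omit l vs)" y z] assms lam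
      by simp
  qed
  ultimately show ?case
    using assms F by (simp add: diff_at_Cons skew_conformal_Cons)
next
  case (Cons u us)
  have "F (us @ z # y # vs) = - F (us @ y # z # vs)"
    using skew_conformalD(4)[OF Cons.prems(1), of us vs y z] Cons.prems assms by simp
  moreover have "bracket_sum F u (us @ z # y # vs) = - bracket_sum F u (us @ y # z # vs)"
    using Cons.prems assms by (intro bracket_sum_skew) auto
  moreover have "diff_at (\<lambda>ys. F (u # ys)) (us @ z # y # vs) = - diff_at (\<lambda>ys. F (u # ys)) (us @ y # z # vs)"
    using Cons.prems by (intro Cons.IH skew_conformal_Cons) auto
  ultimately show ?case
    using Cons.prems assms by (simp add: diff_at_Cons act_at_uminus image_Un)
qed

lemma diff_at_head:
  assumes F: "skew_conformal F" and P: "P \<in> lambda_polys" and zs: "lambda_list zs"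
  shows "diff_at F ((P, x + y) # zs) = diff_at F ((P, x) # zs) + diff_at F ((P, y) # zs)" (is ?add)
    and "diff_at F ((P, scale [:t:] x) # zs) = lscale scaleV (lconst [:t:]) (diff_at F ((P, x) # zs))" (is ?scale)
    and "diff_at F ((P, scale [:0, 1:] x) # zs) = lscale scaleV (- P) (diff_at F ((P, x) # zs))" (is ?del)
proof -
  have br: "bracket_sum F (P, x + y) zs = bracket_sum F (P, x) zs + bracket_sum F (P, y) zs"
    "bracket_sum F (P, scale [:t:] x) zs = lscale scaleV (lconst [:t:]) (bracket_sum F (P, x) zs)"
    "bracket_sum F (P, scale [:0, 1:] x) zs = lscale scaleV (- P) (bracket_sum F (P, x) zs)" for x y t
  proof -
    have slot: "conformal_slot (\<lambda>y. F (zs[l := y]))" "fst (zs ! l) \<in> lambda_polys" if "l < length zs" for l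
    proof -
      have "lambda_list (take l zs)" "lambda_list (drop (Suc l) zs)"
        using zs set_take_subset[of l zs] set_drop_subset[of "Suc l" zs] by blast+
      from skew_conformal_slot[OF F this] show "conformal_slot (\<lambda>y. F (zs[l := y]))"
        using that by (simp add: upd_conv_take_nth_drop)
      show "fst (zs ! l) \<in> lambda_polys" using zs that by auto
    qed
    show "bracket_sum F (P, x + y) zs = bracket_sum F (P, x) zs + bracket_sum F (P, y) zs"
      "bracket_sum F (P, scale [:t:] x) zs = lscale scaleV (lconst [:t:]) (bracket_sum F (P, x) zs)"
      "bracket_sum F (P, scale [:0, 1:] x) zs = lscale scaleV (- P) (bracket_sum F (P, x) zs)"
      unfolding bracket_sum_def lV.scale_sum_right sum.distrib[symmetric]
      by (intro sum.cong refl bracket_at_arg slot P; simp)+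
  qed
  have lam: "lambda_list (omit k ys)" if "lambda_list ys" for k and ys :: "('a poly lpoly \<times> 'b) list"
    using that set_omit[of k ys] by blast
  have lam2: "fst (zs ! k) + fst (zs ! l) \<in> lambda_polys" if "k < l" "l < length zs" for k l
    using that zs by (intro lambda_polys.add) auto
  note F1 = skew_conformalD[OF F, of "[]", simplified]
  have "diff_at (\<lambda>ys. F ((P, x + y) # ys)) zs = diff_at (\<lambda>ys. F ((P, x) # ys) + F ((P, y) # ys)) zs"
    using P zs lam lam2 by (intro diff_at_cong F1) auto
  then show ?add
    using P zs by (simp add: diff_at_Cons[OF F] br act_at_arg diff_at_add)
  have "diff_at (\<lambda>ys. F ((P, scale [:t:] x) # ys)) zs = diff_at (\<lambda>ys. lscale scaleV (lconst [:t:]) (F ((P, x) # ys))) zs"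
    using P zs lam lam2 by (intro diff_at_cong F1) auto
  then show ?scale
    using P zs by (simp add: diff_at_Cons[OF F] br act_at_arg diff_at_lscale act_at_const lV.scale_right_diff_distrib)
  have "diff_at (\<lambda>ys. F ((P, scale [:0, 1:] x) # ys)) zs = diff_at (\<lambda>ys. lscale scaleV (- P) (F ((P, x) # ys))) zs"
    using P zs lam lam2 F1(3) by (intro diff_at_cong) auto
  then have "diff_at (\<lambda>ys. F ((P, scale [:0, 1:] x) # ys)) zs = lscale scaleV (- P) (diff_at (\<lambda>ys. F ((P, x) # ys)) zs)"
    using diff_at_lscale[OF act_at_lambda[OF lambda_polys.uminus[OF P]]] by simp
  then show ?del
    using P zs by (simp add: diff_at_Cons[OF F] br act_at_arg lV.scale_right_diff_distrib)
qed

text \<open>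
  By skew-symmetry any argument may be moved to the front, where \<open>diff_at_head\<close> applies.
\<close>

theorem diff_at_skew_conformal:
  assumes F: "skew_conformal F"
  shows "skew_conformal (diff_at F)"
proof -
  have front: "diff_at F (us @ z # vs) = lscale scaleV ((- 1) ^ length us) (diff_at F (z # us @ vs))"
    if "lambda_list us" "lambda_list vs" "fst z \<in> lambda_polys" for us vs z
    using that
  proof (induction us arbitrary: vs rule: rev_induct)
    case (snoc y us)
    then show ?case
      using snoc.IH[of "y # vs"] diff_at_skew[OF F, of us vs z y] by simp
  qed simp
  show ?thesis
    unfolding skew_conformal_def
  proof (intro conjI allI impI; elim conjE)
    fix us vs and P :: "'a poly lpoly" and x y
    assume *: "lambda_list us" "lambda_list vs" "P \<in> lambda_polys"
    show "diff_at F (us @ (P, x + y) # vs) = diff_at F (us @ (P, x) # vs) + diff_at F (us @ (P, y) # vs)"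
      using * by (simp add: front diff_at_head(1)[OF F] image_Un lV.scale_right_distrib)
  next
    fix us vs and P :: "'a poly lpoly" and t x
    assume *: "lambda_list us" "lambda_list vs" "P \<in> lambda_polys"
    show "diff_at F (us @ (P, scale [:t:] x) # vs) = lscale scaleV (lconst [:t:]) (diff_at F (us @ (P, x) # vs))"
      using * by (simp add: front diff_at_head(2)[OF F] image_Un mult.commute)
  next
    fix us vs and P :: "'a poly lpoly" and x
    assume *: "lambda_list us" "lambda_list vs" "P \<in> lambda_polys"
    show "diff_at F (us @ (P, scale [:0, 1:] x) # vs) = lscale scaleV (- P) (diff_at F (us @ (P, x) # vs))"
      using * by (simp add: front diff_at_head(3)[OF F] image_Un mult.commute)
  next
    fix us vs and y z :: "'a poly lpoly \<times> 'b"
    assume "lambda_list us" "lambda_list vs" "fst y \<in> lambda_polys" "fst z \<in> lambda_polys"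
    then show "diff_at F (us @ z # y # vs) = - diff_at F (us @ y # z # vs)"
      by (rule diff_at_skew[OF F])
  qed
qed

section \<open>The differential of a cochain\<close>

lemma basic_diff_eq:
  "basic_diff f as = diff_at (cochain_on f) (zip (map lvar [0..<length as]) as)"
  unfolding basic_diff_def Let_def diff_at_def act_at_def bracket_at_def
  by (intro arg_cong2[where f = "(+)"] sum.cong)
     (simp_all add: cochain_on_def map_omit)

lemma basic_diff_length:
  assumes f: "f \<in> basic_cochains q" and "length as \<noteq> Suc q"
  shows "basic_diff f as = 0"
proof -
  have "f (omit k as) = 0" if "k < length as" for k
    using that assms by (intro cochain_length[OF f]) (simp add: length_omit)
  moreover have "f (x # omit k (omit l as)) = 0" if "k < l" "l < length as" for k l x
    using that assms by (intro cochain_length[OF f]) (simp add: length_omit)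
  ultimately show ?thesis
    by (simp add: basic_diff_def Let_def cochain_at_def) (simp add: lext_def)
qed

lemma lsubst_act_at:
  assumes f: "f \<in> basic_cochains q" and "length Qs = q"
    and "set Qs \<subseteq> lambda_polys" "set (map (lsubst (*) Ps) Qs) \<subseteq> lambda_polys"
  shows "lsubst scaleV Ps (lext scaleV (\<lambda>v. leval scaleV P (act a v)) (cochain_at f Qs as)) =
    lext scaleV (\<lambda>v. leval scaleV (lsubst (*) Ps P) (act a v)) (cochain_at f (map (lsubst (*) Ps) Qs) as)"
proof -
  have v: "vars_below (length Qs) (f as)" "vars_below (length (map (lsubst (*) Ps) Qs)) (f as)"
    using cochain_vars[OF f] assms(2) by simp_all
  have "lsubst (*) Ps (monomial_at Qs n) = monomial_at (map (lsubst (*) Ps) Qs) n"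
    if "n \<in> Poly_Mapping.keys (f as)" for n
    using that v(1) by (intro lsubst_monomial_at) (simp add: vars_below_def)
  then show ?thesis
    unfolding cochain_at_def additive_coefficient_map.lext_lsubst[OF act_map assms(3) v(1)]
      additive_coefficient_map.lext_lsubst[OF act_map assms(4) v(2)]
    by (simp add: V.lsubst_sum V.lsubst_lscale V.lsubst_leval)
qed

lemma cochain_Cons_map:
  assumes "f \<in> basic_cochains q"
  shows "additive_coefficient_map scaleV scale (\<lambda>x. cochain_at f Qs (x # bs))"
  by unfold_locales (simp add: cochain_at_def cochain_Cons_add[OF assms] V.lsubst_add)

lemma lsubst_bracket_at:
  assumes f: "f \<in> basic_cochains q" and "length Qs = q"
    and "P \<in> lambda_polys" "lsubst (*) Ps P \<in> lambda_polys"
  shows "lsubst scaleV Ps (lext scaleV (\<lambda>x. cochain_at f Qs (x # bs)) (leval scale P p)) =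
    lext scaleV (\<lambda>x. cochain_at f (map (lsubst (*) Ps) Qs) (x # bs)) (leval scale (lsubst (*) Ps P) p)"
proof -
  have "lsubst scaleV Ps (cochain_at f Qs as) = cochain_at f (map (lsubst (*) Ps) Qs) as" for as
    unfolding cochain_at_def using cochain_vars[OF f] assms(2) by (simp add: V.lsubst_lsubst)
  then show ?thesis
    unfolding additive_coefficient_map.lext_leval[OF cochain_Cons_map[OF f] assms(3)]
      additive_coefficient_map.lext_leval[OF cochain_Cons_map[OF f] assms(4)]
    by (simp add: V.lsubst_sum V.lsubst_lscale lsubst_power)
qed

text \<open>
  Evaluating \<open>df\<close> at polynomials is the same as inserting these into the formula for \<open>d\<close>: a
  substitution passes through the action and the bracket as long as no \<open>\<partial>\<close> is substituted.
\<close>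

lemma cochain_on_basic_diff:
  assumes f: "f \<in> basic_cochains q" and len: "length zs = Suc q" and zs: "lambda_list zs"
  shows "cochain_on (basic_diff f) zs = diff_at (cochain_on f) zs"
proof -
  let ?ls = "map lvar [0..<Suc q] :: 'a poly lpoly list"
  let ?Ps = "map fst zs" and ?as = "map snd zs"
  let ?\<sigma> = "lsubst (*) ?Ps"
  have Ps: "set ?Ps \<subseteq> lambda_polys" "length ?Ps = Suc q" using zs len by auto
  have ls: "set ?ls \<subseteq> lambda_polys" "map ?\<sigma> ?ls = ?Ps" "length ?ls = Suc q"
    using map_lsubst_lvars[of ?Ps] len by (auto simp: lambda_polys.var simp del: upt_Suc map_map)
  have A: "lsubst scaleV ?Ps (lext scaleV (\<lambda>v. leval scaleV (lvar k) (act a v)) (cochain_at f (omit k ?ls) bs)) =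
      lext scaleV (\<lambda>v. leval scaleV (?Ps ! k) (act a v)) (cochain_at f (omit k ?Ps) bs)"
    if "k < Suc q" for k a bs
  proof -
    have "length (omit k ?ls) = q" using that by (simp add: length_omit del: upt_Suc)
    moreover have "set (omit k ?ls) \<subseteq> lambda_polys"
      by (rule subset_trans[OF set_omit ls(1)])
    moreover have "set (map ?\<sigma> (omit k ?ls)) \<subseteq> lambda_polys"
      unfolding map_omit ls(2) by (rule subset_trans[OF set_omit Ps(1)])
    ultimately show ?thesis
      using lsubst_act_at[OF f, of "omit k ?ls" ?Ps "lvar k" a bs]
      unfolding map_omit ls(2) by (simp only: lsubst_lvar)
  qed
  have B: "lsubst scaleV ?Ps (lext scaleV
        (\<lambda>x. cochain_at f ((lvar k + lvar l) # omit k (omit l ?ls)) (x # bs)) (leval scale (lvar k) p)) =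
      lext scaleV (\<lambda>x. cochain_at f ((?Ps ! k + ?Ps ! l) # omit k (omit l ?Ps)) (x # bs)) (leval scale (?Ps ! k) p)"
    if "l < Suc q" "k < l" for k l bs p
  proof -
    have "length ((lvar k + lvar l) # omit k (omit l ?ls)) = q"
      using that by (simp add: length_omit del: upt_Suc)
    moreover have "map ?\<sigma> ((lvar k + lvar l) # omit k (omit l ?ls)) = (?Ps ! k + ?Ps ! l) # omit k (omit l ?Ps)"
      unfolding list.map map_omit ls(2) by (simp add: lsubst_ring_simps)
    moreover have "?Ps ! k \<in> lambda_polys"
      using that Ps by (auto simp del: upt_Suc)
    ultimately show ?thesis
      using lsubst_bracket_at[OF f, of "(lvar k + lvar l) # omit k (omit l ?ls)" "lvar k" ?Ps bs p]
      by (simp only: lsubst_lvar lambda_polys.var)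
  qed
  have sgn: "?\<sigma> ((- 1) ^ k) = (- 1) ^ k" for k
    by (simp add: lsubst_power lsubst_ring_simps)
  show ?thesis
    unfolding cochain_on_def[of "basic_diff f"] cochain_at_def[of "basic_diff f"] basic_diff_def Let_def
      length_map len V.lsubst_add V.lsubst_sum V.lsubst_lscale sgn diff_at_def
    by (intro arg_cong2[where f = "(+)"] sum.cong refl)
       (simp_all only: A B lessThan_iff act_at_def bracket_at_def cochain_on_def map_omit list.map
         fst_conv snd_conv nth_map len order.strict_trans)
qed

lemma basic_diff_cochain:
  assumes f: "f \<in> basic_cochains q"
  shows "basic_diff f \<in> basic_cochains (Suc q)"
proof -
  note D = diff_at_skew_conformal[OF cochain_on_skew_conformal[OF f]]
  define zs :: "'b list \<Rightarrow> ('a poly lpoly \<times> 'b) list" where "zs as = zip (map lvar [0..<Suc q]) as" for as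
  have eq: "basic_diff f as = diff_at (cochain_on f) (zs as)" if "length as = Suc q" for as
    using that by (simp add: basic_diff_eq zs_def)
  have slot: "\<exists>us vs. lambda_list us \<and> lambda_list vs \<and> (\<forall>x. zs (as[i := x]) = us @ (lvar i, x) # vs)"
    if "length as = Suc q" "i < Suc q" for as i
  proof -
    have lam: "lambda_list (zs as)" using that
      by (auto simp: zs_def lambda_polys.var dest!: set_zip_leftD simp del: upt_Suc)
    have "zs (as[i := x]) = take i (zs as) @ (lvar i, x) # drop (Suc i) (zs as)" for x
    proof -
      have "zs (as[i := x]) = (zs as)[i := (lvar i, x)]"
        using that by (intro nth_equalityI) (auto simp: zs_def nth_list_update simp del: upt_Suc)
      then show ?thesis
        using that by (simp add: upd_conv_take_nth_drop zs_def del: upt_Suc)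
    qed
    then show ?thesis
      using lam set_take_subset[of i "zs as"] set_drop_subset[of "Suc i" "zs as"] by blast
  qed
  show ?thesis
    unfolding basic_cochains_def
  proof (intro CollectI conjI allI impI ballI)
    fix as :: "'b list" assume "length as \<noteq> Suc q"
    then show "basic_diff f as = 0" by (rule basic_diff_length[OF f])
  next
    fix as :: "'b list" and n assume n: "n \<in> Poly_Mapping.keys (basic_diff f as)"
    have "vars_below (Suc q) (basic_diff f as)"
    proof (cases "length as = Suc q")
      case True
      let ?ls = "map lvar [0..<Suc q] :: 'a poly lpoly list"
      have sgn: "vars_below (Suc q) ((- 1) ^ k :: 'a poly lpoly)" for k
        by (intro vars_below_power vars_below_uminus vars_below_1)
      have ls: "vars_below (Suc q) P" if "P \<in> set ?ls" for P
        using that by (auto simp: vars_below_lvar simp del: upt_Suc)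
      have 1: "vars_below (Suc q) (lext scaleV (\<lambda>v. leval scaleV (lvar k) (act (as ! k) v))
          (lsubst scaleV (omit k ?ls) (f (omit k as))))" if k: "k < Suc q" for k
      proof (intro V.vars_below_lext V.vars_below_leval V.vars_below_lsubst vars_below_lvar k)
        show "vars_below (length (omit k ?ls)) (f (omit k as))"
          using k cochain_vars[OF f] by (simp add: length_omit del: upt_Suc)
        show "vars_below (Suc q) P" if "P \<in> set (omit k ?ls)" for P
          using that set_omit[of k ?ls] by (intro ls) blast
      qed
      have 2: "vars_below (Suc q) (lext scaleV
          (\<lambda>x. lsubst scaleV ((lvar k + lvar l) # omit k (omit l ?ls)) (f (x # omit k (omit l as))))
          (leval scale (lvar k) p))" if kl: "l < Suc q" "k < l" for k l p
      proof (intro V.vars_below_lext vars_below_leval V.vars_below_lsubst)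
        fix x
        show "vars_below (length ((lvar k + lvar l) # omit k (omit l ?ls))) (f (x # omit k (omit l as)))"
          using kl cochain_vars[OF f] by (simp add: length_omit del: upt_Suc)
        show "vars_below (Suc q) P" if P: "P \<in> set ((lvar k + lvar l) # omit k (omit l ?ls))" for P
        proof -
          consider "P = lvar k + lvar l" | "P \<in> set ?ls"
            using P set_omit[of k "omit l ?ls"] set_omit[of l ?ls]
            unfolding list.set by blast
          then show ?thesis
          proof cases
            case 1
            then show ?thesis using kl by (simp add: vars_below_add vars_below_lvar)
          qed (rule ls)
        qed
      qed (use kl in \<open>simp add: vars_below_lvar\<close>)
      show ?thesis
        unfolding basic_diff_def Let_def True cochain_at_def
        by (intro vars_below_add vars_below_sum V.vars_below_lscale sgn 1 2) simp_all
    qed (simp add: basic_diff_length[OF f])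
    then show "Poly_Mapping.keys n \<subseteq> {..<Suc q}"
      using n by (simp add: vars_below_def)
  next
    fix as :: "'b list" and i x y assume *: "length as = Suc q \<and> i < Suc q"
    then obtain us vs where "lambda_list us" "lambda_list vs" "\<And>x. zs (as[i := x]) = us @ (lvar i, x) # vs"
      using slot by blast
    then show "basic_diff f (as[i := x + y]) = basic_diff f (as[i := x]) + basic_diff f (as[i := y])"
      using skew_conformalD(1)[OF D, of us vs "lvar i" x y] * by (simp add: eq lambda_polys.var)
  next
    fix as :: "'b list" and i t x assume *: "length as = Suc q \<and> i < Suc q"
    then obtain us vs where "lambda_list us" "lambda_list vs" "\<And>x. zs (as[i := x]) = us @ (lvar i, x) # vs"
      using slot by blast
    then show "basic_diff f (as[i := scale [:t:] x]) = lscale scaleV (lconst [:t:]) (basic_diff f (as[i := x]))"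
      using skew_conformalD(2)[OF D, of us vs "lvar i" t x] * by (simp add: eq lambda_polys.var)
  next
    fix as :: "'b list" and i x assume *: "length as = Suc q \<and> i < Suc q"
    then obtain us vs where "lambda_list us" "lambda_list vs" "\<And>x. zs (as[i := x]) = us @ (lvar i, x) # vs"
      using slot by blast
    then show "basic_diff f (as[i := scale [:0, 1:] x]) = lscale scaleV (- lvar i) (basic_diff f (as[i := x]))"
      using skew_conformalD(3)[OF D, of us vs "lvar i" x] * by (simp add: eq lambda_polys.var)
  next
    fix as :: "'b list" and \<pi> assume *: "length as = Suc q \<and> \<pi> permutes {..<Suc q}"
    let ?ls = "map lvar [0..<Suc q] :: 'a poly lpoly list"
    have lam: "lambda_list (zs as)" using *
      by (auto simp: zs_def lambda_polys.var dest!: set_zip_leftD simp del: upt_Suc)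
    have len: "length (zs as) = Suc q" using * by (simp add: zs_def del: upt_Suc)
    have m: "map fst (permute_list \<pi> (zs as)) = permute_list \<pi> ?ls" "map snd (permute_list \<pi> (zs as)) = permute_list \<pi> as"
      using * len by (simp_all add: permute_list_map[symmetric] zs_def del: upt_Suc)
    have "lsubst scaleV (permute_list \<pi> ?ls) (basic_diff f (permute_list \<pi> as)) =
        cochain_on (basic_diff f) (permute_list \<pi> (zs as))"
      by (simp only: cochain_on_def cochain_at_def m)
    also have "\<dots> = diff_at (cochain_on f) (permute_list \<pi> (zs as))"
      using lam len * by (intro cochain_on_basic_diff[OF f]) simp_all
    also have "\<dots> = lscale scaleV (of_int (sign \<pi>)) (diff_at (cochain_on f) (zs as))"
      using lam len * by (intro skew_conformal_permute[OF D]) simp_all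
    finally show "lsubst scaleV (permute_list \<pi> ?ls) (basic_diff f (permute_list \<pi> as)) =
        lscale scaleV (of_int (sign \<pi>)) (basic_diff f as)"
      using * by (simp add: eq)
  qed
qed

lemma cochain_on_del:
  "cochain_on (cochain_del f) zs = lscale scaleV (ldel + sum_list (map fst zs)) (cochain_on f zs)"
  by (simp add: cochain_on_def cochain_at_def cochain_del_def V.lsubst_lscale lsubst_ring_simps ldel_def
      sum_list_sum_nth atLeast0LessThan)

text \<open>
  Every summand of \<open>d\<close> contributes the same factor \<open>\<partial> + \<lambda>\<^sub>1 + \<dots> + \<lambda>\<^bsub>q+1\<^esub>\<close>.  Moving \<open>\<partial>\<close> across the action at
  \<open>\<lambda>\<^sub>k\<close> restores the omitted \<open>\<lambda>\<^sub>k\<close>, and the bracket of two arguments carries the sum of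
  their two parameters.
\<close>

lemma basic_diff_del: "basic_diff (cochain_del f) = cochain_del (basic_diff f)"
proof
  fix as :: "'b list"
  define zs where "zs = zip (map lvar [0..<length as] :: 'a poly lpoly list) as"
  define X where "X = sum_list (map fst zs)"
  have omit: "sum_list (map fst (omit k ys)) = sum_list (map fst ys) - fst (ys ! k)"
    if "k < length ys" for k and ys :: "('a poly lpoly \<times> 'b) list"
    using arg_cong[OF id_take_nth_drop[OF that], of "\<lambda>xs. sum_list (map fst xs)"]
    by (simp add: omit_def algebra_simps)
  have lam: "fst (zs ! k) \<in> lambda_polys" if "k < length zs" for k
    using that by (simp add: zs_def lambda_polys.var)
  have X: "X = (\<Sum>k<length as. lvar k)"
    by (simp add: X_def zs_def sum_list_sum_nth atLeast0LessThan)
  have Xl: "P + X \<in> lambda_polys" if "P \<in> lambda_polys" for P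
  proof -
    have "(\<Sum>k<n. lvar k :: 'a poly lpoly) \<in> lambda_polys" for n
      by (induction n) (auto intro: lambda_polys.intros)
    then show ?thesis using that by (simp add: X lambda_polys.add)
  qed
  have "act_at (zs ! k) (cochain_on (cochain_del f) (omit k zs)) =
      lscale scaleV (ldel + X) (act_at (zs ! k) (cochain_on f (omit k zs)))" if "k < length zs" for k
  proof -
    have "ldel + (X - fst (zs ! k)) = ldel + (- fst (zs ! k) + X)" by simp
    moreover have "- fst (zs ! k) + X \<in> lambda_polys"
      using lam[OF that] by (intro Xl lambda_polys.uminus)
    ultimately show ?thesis
      using that
      by (simp only: cochain_on_del omit X_def[symmetric] lV.scale_left_distrib[of ldel] act_at_add act_at_del
          act_at_lambda) (simp flip: lV.scale_left_distrib)
  qed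
  moreover have "bracket_at (\<lambda>y. cochain_on (cochain_del f) (y # omit k (omit l zs))) (zs ! k) (zs ! l) =
      lscale scaleV (ldel + X) (bracket_at (\<lambda>y. cochain_on f (y # omit k (omit l zs))) (zs ! k) (zs ! l))"
    if "k < l" "l < length zs" for k l
    unfolding bracket_at_fun(3)[symmetric]
  proof (rule bracket_at_cong)
    fix x
    have "omit l zs ! k = zs ! k" using that by (simp add: omit_def nth_append)
    then have "sum_list (map fst ((fst (zs ! k) + fst (zs ! l), x) # omit k (omit l zs))) = X"
      using that by (simp add: omit length_omit X_def)
    then show "cochain_on (cochain_del f) ((fst (zs ! k) + fst (zs ! l), x) # omit k (omit l zs)) =
        lscale scaleV (ldel + X) (cochain_on f ((fst (zs ! k) + fst (zs ! l), x) # omit k (omit l zs)))"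
      by (simp only: cochain_on_del)
  qed
  ultimately have "diff_at (cochain_on (cochain_del f)) zs = lscale scaleV (ldel + X) (diff_at (cochain_on f) zs)"
    by (simp add: diff_at_def lV.scale_right_distrib lV.scale_sum_right mult.commute)
  then show "basic_diff (cochain_del f) as = cochain_del (basic_diff f) as"
    by (simp add: basic_diff_eq cochain_del_def zs_def X)
qed

section \<open>Cartan's formula\<close>

text \<open>
  The Lie derivative along \<open>a\<close>, that is, along the operators \<open>a\<^sub>\<lambda>\<close> at \<open>\<lambda> = 0\<close>.
\<close>

definition lie :: "'b \<Rightarrow> ('b list \<Rightarrow> 'v lpoly) \<Rightarrow> 'b list \<Rightarrow> 'v lpoly"
  where "lie a f as = lext scaleV (\<lambda>v. lconst (coeff (act a v) 0)) (f as) -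
    (\<Sum>i<length as. f (as[i := coeff (bracket a (as ! i)) 0]))"

text \<open>
  This is \<open>diff_at_Cons\<close> with first pair \<open>(0, a)\<close>, because fixing the pair \<open>(0, a)\<close> is contraction with \<open>a\<close>.
\<close>

theorem cartan_formula:
  assumes f: "f \<in> basic_cochains q" and as: "length as = q"
  shows "contract a (basic_diff f) as + basic_diff (contract a f) as = lie a f as"
proof -
  define zs where "zs = zip (map lvar [0..<q] :: 'a poly lpoly list) as"
  have zs: "lambda_list zs" "length zs = q" "map fst zs = map lvar [0..<q]" "map snd zs = as"
    using as by (auto simp: zs_def lambda_polys.var dest!: set_zip_leftD)
  note F = cochain_on_skew_conformal[OF f]
  have on: "cochain_on f (zs[l := (lvar l, x)]) = f (as[l := x])" if "l < q" for l x
  proof -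
    have "map fst (zs[l := (lvar l, x)]) = map lvar [0..<q]"
      using that zs by (simp add: map_update list_update_same_conv)
    then show ?thesis
      using cochain_at_lvars[OF f, of "as[l := x]"] as zs by (simp add: cochain_on_def map_update)
  qed
  have "contract a (basic_diff f) as = cochain_on (basic_diff f) ((0, a) # zs)"
    using zs as by (simp add: contract_def cochain_on_def)
  also have "\<dots> = diff_at (cochain_on f) ((0, a) # zs)"
    using zs by (intro cochain_on_basic_diff[OF f]) (simp_all add: lambda_polys.zero)
  also have "\<dots> = act_at (0, a) (cochain_on f zs) - diff_at (\<lambda>ys. cochain_on f ((0, a) # ys)) zs
      - bracket_sum (cochain_on f) (0, a) zs"
    using zs by (intro diff_at_Cons[OF F]) (simp_all add: lambda_polys.zero)
  also have "(\<lambda>ys. cochain_on f ((0, a) # ys)) = cochain_on (contract a f)"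
    using cochain_at_contract[OF f] by (simp add: fun_eq_iff cochain_on_def)
  also have "diff_at (cochain_on (contract a f)) zs = basic_diff (contract a f) as"
    by (simp add: basic_diff_eq zs_def as)
  also have "act_at (0, a) (cochain_on f zs) = lext scaleV (\<lambda>v. lconst (coeff (act a v) 0)) (f as)"
    using cochain_at_lvars[OF f as] zs by (simp add: act_at_def V.leval_at_0 cochain_on_def)
  also have "bracket_sum (cochain_on f) (0, a) zs = (\<Sum>i<length as. f (as[i := coeff (bracket a (as ! i)) 0]))"
    unfolding bracket_sum_def zs(2) as
  proof (intro sum.cong refl)
    fix l assume l: "l \<in> {..<q}"
    have "f (as[l := 0]) = 0"
      using cochain_add[OF f as, of l 0 0] l by simp
    then have "lext scaleV (\<lambda>x. f (as[l := x])) (lconst (coeff (bracket a (as ! l)) 0)) =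
        f (as[l := coeff (bracket a (as ! l)) 0])"
      by (rule V.lext_lconst)
    moreover have "zs ! l = (lvar l, as ! l)" using l as by (simp add: zs_def)
    ultimately show "bracket_at (\<lambda>y. cochain_on f (zs[l := y])) (0, a) (zs ! l) =
        f (as[l := coeff (bracket a (as ! l)) 0])"
      using l by (simp add: bracket_at_def leval_at_0 on)
  qed
  finally show ?thesis
    by (simp add: lie_def)
qed

end

section \<open>A criterion for vanishing cohomology\<close>

text \<open>
  The form in which exactness enters: every cycle is absorbed by \<open>H\<close>.
\<close>

lemma trivial_group_Mod:
  assumes "carrier G \<noteq> {}" "\<And>x. x \<in> carrier G \<Longrightarrow> H #>\<^bsub>G\<^esub> x = H" "H <#>\<^bsub>G\<^esub> H = H"
  shows "trivial_group (G Mod H)"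
proof -
  have "carrier (G Mod H) = {H}"
    using assms(1,2) by (auto simp: FactGroup_def RCOSETS_def)
  moreover have "H \<otimes>\<^bsub>G Mod H\<^esub> H = H" "\<one>\<^bsub>G Mod H\<^esub> = H"
    using assms(3) by (simp_all add: FactGroup_def)
  ultimately show ?thesis
    unfolding trivial_group_def by (auto intro!: groupI)
qed

text \<open>
  Both complexes are built from addition of functions.  In this additive notation a coset is a translate
  \<open>x +o W\<close>, and products of cosets are sums of sets, with the calculus of such sums at hand.
\<close>

definition additive_subgroup :: "'c::ab_group_add set \<Rightarrow> bool"
  where "additive_subgroup W \<longleftrightarrow> 0 \<in> W \<and> (\<forall>x\<in>W. \<forall>y\<in>W. x + y \<in> W \<and> - x \<in> W)"

lemma additive_subgroup_image:
  assumes "additive_subgroup W" "\<And>x y. h (x + y) = h x + h y"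
  shows "additive_subgroup (h ` W)"
proof -
  have h0: "h 0 = 0" using assms(2)[of 0 0] by simp
  have "h (- x) = - h x" for x
    using assms(2)[of x "- x"] h0 by (simp add: eq_neg_iff_add_eq_0 add.commute)
  then show ?thesis
    using assms h0 unfolding additive_subgroup_def by (auto simp: image_iff) (metis assms(2))+
qed

lemma additive_subgroup_absorb:
  assumes W: "additive_subgroup W" and "B \<subseteq> W" "0 \<in> B"
  shows "W + B = W"
proof (intro equalityI subsetI)
  fix x assume "x \<in> W + B"
  then show "x \<in> W" using assms by (auto elim!: set_plus_elim simp: additive_subgroup_def)
next
  fix x assume "x \<in> W"
  then show "x \<in> W + B" using set_plus_intro[of x W 0 B] assms by simp
qed

lemma additive_subgroup_translate:
  assumes W: "additive_subgroup W" and "x \<in> W"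
  shows "x +o W = W"
proof (intro equalityI subsetI)
  fix y assume "y \<in> x +o W"
  then show "y \<in> W" using assms by (auto simp: elt_set_plus_def additive_subgroup_def)
next
  fix y assume "y \<in> W"
  then have "- x + y \<in> W" using assms unfolding additive_subgroup_def by blast
  then show "y \<in> x +o W" using set_plus_intro2[of "- x + y" W x] by simp
qed

lemma set_mult_plus: "monoid.mult G = (+) \<Longrightarrow> H <#>\<^bsub>G\<^esub> K = H + K"
  by (auto simp: set_mult_def set_plus_def)

lemma r_coset_plus: "monoid.mult G = (+) \<Longrightarrow> H #>\<^bsub>G\<^esub> x = (x :: 'c::ab_group_add) +o H"
  by (auto simp: r_coset_def elt_set_plus_def add.commute)

context lca_module
begin

interpretation lV: module "lscale scaleV" by (rule V.module_lscale)

lemma zero_cochain: "0 \<in> basic_cochains q"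
  by (simp add: basic_cochains_def)

lemma add_cochain:
  assumes "f \<in> basic_cochains q" "g \<in> basic_cochains q"
  shows "f + g \<in> basic_cochains q"
proof -
  have "Poly_Mapping.keys n \<subseteq> {..<q}" if "n \<in> Poly_Mapping.keys (f as + g as)" for as n
    using that vars_below_add[OF cochain_vars cochain_vars, OF assms, of as] by (simp add: vars_below_def)
  then show ?thesis
    using assms unfolding basic_cochains_def
    by (auto simp: lV.scale_right_distrib V.lsubst_add ac_simps)
qed

lemma lscale_cochain:
  assumes f: "f \<in> basic_cochains q"
  shows "(\<lambda>as. lscale scaleV (lconst c) (f as)) \<in> basic_cochains q"
proof -
  have "Poly_Mapping.keys n \<subseteq> {..<q}" if "n \<in> Poly_Mapping.keys (lscale scaleV (lconst c) (f as))" for as n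
    using that V.vars_below_lscale[OF vars_below_lconst cochain_vars[OF f], of c as] by (simp add: vars_below_def)
  then show ?thesis
    using f unfolding basic_cochains_def
    by (auto simp: lV.scale_right_distrib V.lsubst_lscale lsubst_ring_simps mult.commute)
qed

lemma sum_cochain:
  "(\<And>i. i \<in> A \<Longrightarrow> f i \<in> basic_cochains q) \<Longrightarrow> (\<lambda>as. \<Sum>i\<in>A. f i as) \<in> basic_cochains q"
proof (induction A rule: infinite_finite_induct)
  case (insert i A)
  then show ?case using add_cochain[of "f i" q "\<lambda>as. \<Sum>i\<in>A. f i as"] by (simp add: plus_fun_def)
qed (simp_all add: zero_cochain[unfolded zero_fun_def])

lemma uminus_cochain: "f \<in> basic_cochains q \<Longrightarrow> - f \<in> basic_cochains q"
  using lscale_cochain[of f q "- 1"] by (simp add: lconst_uminus lconst_1 V.lscale_1 fun_Compl_def)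

lemma additive_subgroup_cochains: "additive_subgroup (basic_cochains q)"
  by (simp add: additive_subgroup_def zero_cochain add_cochain uminus_cochain)

lemma cochain_del_add: "cochain_del (f + g) = cochain_del f + cochain_del g"
  by (auto simp: cochain_del_def fun_eq_iff lV.scale_right_distrib)

lemma cochain_at_add: "cochain_at (f + g) Ps as = cochain_at f Ps as + cochain_at g Ps as"
  by (simp add: cochain_at_def V.lsubst_add)

lemma basic_diff_add: "basic_diff (f + g) = basic_diff f + basic_diff g"
proof -
  have "cochain_on (f + g) = (\<lambda>zs. cochain_on f zs + cochain_on g zs)"
    by (simp add: fun_eq_iff cochain_on_def cochain_at_add)
  then have "diff_at (cochain_on (f + g)) zs = diff_at (cochain_on f) zs + diff_at (cochain_on g) zs" for zs
    by (simp only: diff_at_add)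
  then show ?thesis
    by (simp add: fun_eq_iff basic_diff_eq)
qed

lemma basic_diff_0 [simp]: "basic_diff 0 = 0"
  using basic_diff_add[of 0 0] by simp

lemma cochain_del_0 [simp]: "cochain_del 0 = 0"
  using cochain_del_add[of 0 0] by simp

lemma contract_0 [simp]: "contract a 0 = 0"
  by (simp add: fun_eq_iff contract_def cochain_at_def)

lemma basic_group_simps [simp]:
  "carrier (basic_group q) = basic_cochains q" "monoid.mult (basic_group q) = (+)" "one (basic_group q) = 0"
  by (simp_all add: basic_group_def fun_eq_iff)

lemma carrier_reduced_group:
  "carrier (reduced_group q) = (\<lambda>f. f +o cochain_del ` basic_cochains q) ` basic_cochains q"
  by (auto simp: reduced_group_def FactGroup_def RCOSETS_def r_coset_plus)

lemma reduced_group_simps [simp]: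
  "monoid.mult (reduced_group q) = (+)" "one (reduced_group q) = cochain_del ` basic_cochains q"
  by (simp_all add: reduced_group_def FactGroup_def fun_eq_iff set_mult_plus)

lemma additive_subgroup_coboundaries: "additive_subgroup (cochain_del ` basic_cochains q)"
  by (intro additive_subgroup_image additive_subgroup_cochains cochain_del_add)

lemma reduced_diff_coset:
  assumes "u \<in> basic_cochains p"
  shows "reduced_diff p (u +o cochain_del ` basic_cochains p) =
    basic_diff u +o cochain_del ` basic_cochains (Suc p)"
proof -
  let ?B = "cochain_del ` basic_cochains (Suc p)"
  have *: "basic_diff (u + cochain_del g) +o ?B = basic_diff u +o ?B" if "g \<in> basic_cochains p" for g
  proof -
    have "cochain_del (basic_diff g) \<in> ?B"
      using basic_diff_cochain[OF that] by blast
    then have "cochain_del (basic_diff g) +o ?B = ?B"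
      by (rule additive_subgroup_translate[OF additive_subgroup_coboundaries])
    then show ?thesis
      by (simp add: basic_diff_add basic_diff_del flip: set_plus_rearrange2)
  qed
  have "u +o cochain_del ` basic_cochains p = (\<lambda>g. u + cochain_del g) ` basic_cochains p"
    by (auto simp: elt_set_plus_def)
  then have "reduced_diff p (u +o cochain_del ` basic_cochains p) =
      (\<Union>g\<in>basic_cochains p. basic_diff (u + cochain_del g) +o ?B)"
    by (simp only: reduced_diff_def r_coset_plus[OF basic_group_simps(2)] image_image)
  also have "\<dots> = (\<Union>g\<in>basic_cochains p. basic_diff u +o ?B)"
    by (intro SUP_cong refl *)
  also have "\<dots> = basic_diff u +o ?B"
    using zero_cochain[of p] by blast
  finally show ?thesis .
qed

text \<open>
  Cartan's formula is applied to \<open>T f\<close>: its Lie derivative is \<open>f\<close>, and \<open>d(T f) = T(\<partial>g) = \<partial>(T g)\<close>.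
  For \<open>g = 0\<close> this exhibits a cocycle as a coboundary; for general \<open>g\<close> it does so in the reduced complex.
\<close>

lemma homotopy_decomposition:
  assumes T: "\<And>r f. f \<in> basic_cochains r \<Longrightarrow> T f \<in> basic_cochains r"
    and Td: "\<And>f. f \<in> basic_cochains q \<Longrightarrow> basic_diff (T f) = T (basic_diff f)"
    and Tdel: "\<And>f. T (cochain_del f) = cochain_del (T f)"
    and lieT: "\<And>f as. f \<in> basic_cochains q \<Longrightarrow> length as = q \<Longrightarrow> lie a (T f) as = f as"
    and f: "f \<in> basic_cochains q" and g: "g \<in> basic_cochains (Suc q)"
    and df: "basic_diff f = cochain_del g"
  shows "f = basic_diff (contract a (T f)) + cochain_del (contract a (T g))"
proof
  fix as
  show "f as = (basic_diff (contract a (T f)) + cochain_del (contract a (T g))) as"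
  proof (cases "length as = q")
    case True
    have "contract a (basic_diff (T f)) = cochain_del (contract a (T g))"
      by (rule ext) (simp add: Td[OF f] df Tdel cochain_del_contract)
    then show ?thesis
      using cartan_formula[OF T[OF f] True, of a] lieT[OF f True] by (simp add: add.commute)
  next
    case False
    have "contract a (T g) as = 0"
      using contract_cochain[OF T[OF g]] False by (rule cochain_length)
    moreover have "basic_diff (contract a (T f)) as = 0"
    proof (cases q)
      case 0
      then have "contract a (T f) = 0"
        using cochain_length[OF T[OF f]] by (simp add: fun_eq_iff contract_def cochain_at_def)
      then show ?thesis by simp
    next
      case (Suc p)
      then show ?thesis
        using contract_cochain[of "T f" p a] T[OF f] False by (intro basic_diff_length[of _ p]) auto
    qed
    ultimately show ?thesis
      using cochain_length[OF f False] by (simp add: cochain_del_def)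
  qed
qed

text \<open>
  In a fixed degree, both cohomologies vanish if the Lie derivative along some element has a right inverse that is
  compatible with the two operators \<open>d\<close> and \<open>\<partial>\<close>.
\<close>

theorem cohomology_vanishes:
  assumes T: "\<And>r f. f \<in> basic_cochains r \<Longrightarrow> T f \<in> basic_cochains r"
    and Td: "\<And>f. f \<in> basic_cochains q \<Longrightarrow> basic_diff (T f) = T (basic_diff f)"
    and Tdel: "\<And>f. T (cochain_del f) = cochain_del (T f)"
    and T0: "T 0 = 0"
    and lieT: "\<And>f as. f \<in> basic_cochains q \<Longrightarrow> length as = q \<Longrightarrow> lie a (T f) as = f as"
  shows "trivial_group (basic_cohomology q)" and "trivial_group (reduced_cohomology q)"
proof -
  have decomp: "f = basic_diff (contract a (T f)) + cochain_del (contract a (T g))"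
    if "f \<in> basic_cochains q" "g \<in> basic_cochains (Suc q)" "basic_diff f = cochain_del g" for f g
    using T Td Tdel lieT that by (rule homotopy_decomposition)
  have contract0: "contract a (T f) = 0" if "f \<in> basic_cochains 0" for f
    using cochain_length[OF T[OF that]] by (simp add: fun_eq_iff contract_def cochain_at_def)
  let ?B = "\<lambda>q. cochain_del ` basic_cochains q"
  note B = additive_subgroup_coboundaries
  define Hb where "Hb = (case q of 0 \<Rightarrow> {\<one>\<^bsub>basic_group 0\<^esub>} | Suc p \<Rightarrow> basic_diff ` carrier (basic_group p))"
  have Hb: "additive_subgroup Hb"
    by (cases q) (simp_all add: Hb_def additive_subgroup_def[of "{0}"] additive_subgroup_image
        additive_subgroup_cochains basic_diff_add)
  have exact: "f \<in> Hb" if "f \<in> basic_cochains q" "basic_diff f = 0" for f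
  proof -
    have f: "f = basic_diff (contract a (T f))"
      using decomp[OF that(1) zero_cochain] that(2) T0 by (metis add.right_neutral cochain_del_0 contract_0)
    show ?thesis
    proof (cases q)
      case 0
      then show ?thesis using f contract0[of f] that(1) by (simp add: Hb_def)
    next
      case (Suc p)
      then have "contract a (T f) \<in> basic_cochains p"
        using contract_cochain T that(1) by blast
      then show ?thesis using f Suc by (auto simp: Hb_def)
    qed
  qed
  show "trivial_group (basic_cohomology q)"
    unfolding basic_cohomology_def cohomology_def Hb_def[symmetric]
  proof (rule trivial_group_Mod)
    show "carrier (basic_group q\<lparr>carrier := kernel (basic_group q) (basic_group (Suc q)) basic_diff\<rparr>) \<noteq> {}"
      using zero_cochain by (auto simp: kernel_def intro: exI[of _ 0])
  next
    fix f assume "f \<in> carrier (basic_group q\<lparr>carrier := kernel (basic_group q) (basic_group (Suc q)) basic_diff\<rparr>)"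
    then have "f \<in> Hb" by (intro exact) (simp_all add: kernel_def)
    then show "Hb #>\<^bsub>basic_group q\<lparr>carrier := kernel (basic_group q) (basic_group (Suc q)) basic_diff\<rparr>\<^esub> f = Hb"
      by (simp add: r_coset_plus additive_subgroup_translate[OF Hb])
  next
    show "Hb <#>\<^bsub>basic_group q\<lparr>carrier := kernel (basic_group q) (basic_group (Suc q)) basic_diff\<rparr>\<^esub> Hb = Hb"
      using Hb by (simp add: set_mult_plus additive_subgroup_absorb additive_subgroup_def[of Hb])
  qed

  define Z where "Z = (case q of 0 \<Rightarrow> {0} | Suc p \<Rightarrow> basic_diff ` basic_cochains p)"
  define Hr where "Hr = (case q of 0 \<Rightarrow> {\<one>\<^bsub>reduced_group 0\<^esub>} | Suc p \<Rightarrow> reduced_diff p ` carrier (reduced_group p))"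
  have Z: "additive_subgroup Z"
    by (cases q) (auto simp: Z_def additive_subgroup_def[of "{0}"] intro!: additive_subgroup_image
        additive_subgroup_cochains basic_diff_add)
  have B0: "0 \<in> ?B q" using B[of q] by (simp add: additive_subgroup_def)
  have Hr: "Hr = (\<lambda>z. z +o ?B q) ` Z"
  proof (cases q)
    case (Suc p)
    have "reduced_diff p ` carrier (reduced_group p) =
        (\<lambda>u. basic_diff u +o ?B q) ` basic_cochains p"
      unfolding carrier_reduced_group image_image Suc by (intro image_cong refl reduced_diff_coset)
    then show ?thesis
      by (simp add: Hr_def Z_def Suc image_image)
  qed (simp add: Hr_def Z_def)
  have exact: "\<exists>z\<in>Z. X = z +o ?B q"
    if XK: "X \<in> carrier (reduced_group q)" "reduced_diff q X = ?B (Suc q)" for X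
  proof -
    obtain f where f: "f \<in> basic_cochains q" "X = f +o ?B q"
      using XK(1) unfolding carrier_reduced_group by blast
    have "f \<in> X" using set_plus_intro2[OF B0, of f] f by simp
    moreover have "basic_diff f \<in> ?B (Suc q) #>\<^bsub>basic_group (Suc q)\<^esub> basic_diff f"
      using set_plus_intro2[of 0 "?B (Suc q)" "basic_diff f"] B[of "Suc q"]
      by (simp add: r_coset_plus additive_subgroup_def)
    ultimately have "basic_diff f \<in> ?B (Suc q)"
      using XK(2) unfolding reduced_diff_def by blast
    then obtain g where g: "g \<in> basic_cochains (Suc q)" "basic_diff f = cochain_del g"
      by blast
    have "contract a (T g) \<in> basic_cochains q"
      by (intro contract_cochain T g)
    then have del: "cochain_del (contract a (T g)) \<in> ?B q" by blast
    have "X = basic_diff (contract a (T f)) +o (cochain_del (contract a (T g)) +o ?B q)"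
      using f(2) decomp[OF f(1) g] by (metis set_plus_rearrange2)
    also have "cochain_del (contract a (T g)) +o ?B q = ?B q"
      by (rule additive_subgroup_translate[OF B del])
    finally have X: "X = basic_diff (contract a (T f)) +o ?B q" .
    have "basic_diff (contract a (T f)) \<in> Z"
    proof (cases q)
      case 0
      then show ?thesis using contract0[of f] f(1) by (simp add: Z_def)
    next
      case (Suc p)
      then have "contract a (T f) \<in> basic_cochains p"
        using contract_cochain T f(1) by blast
      then show ?thesis using Suc by (auto simp: Z_def)
    qed
    with X show ?thesis by blast
  qed
  have absorb: "(z +o ?B q) + (y +o ?B q) = (z + y) +o ?B q" for z y
    using additive_subgroup_absorb[OF B order_refl B0] by (simp add: set_plus_rearrange)
  have translate: "(\<lambda>z. (z + y) +o ?B q) ` Z = Hr" if "y \<in> Z" for y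
  proof -
    have "(\<lambda>z. (z + y) +o ?B q) ` Z = (\<lambda>z. z +o ?B q) ` (\<lambda>z. z + y) ` Z"
      by (simp only: image_image)
    also have "(\<lambda>z. z + y) ` Z = y +o Z"
      by (auto simp: elt_set_plus_def add.commute)
    also have "y +o Z = Z"
      by (rule additive_subgroup_translate[OF Z that])
    finally show ?thesis by (simp only: Hr)
  qed
  let ?G = "reduced_group q\<lparr>carrier := kernel (reduced_group q) (reduced_group (Suc q)) (reduced_diff q)\<rparr>"
  show "trivial_group (reduced_cohomology q)"
    unfolding reduced_cohomology_def cohomology_def Hr_def[symmetric]
  proof (rule trivial_group_Mod)
    \<comment> \<open>The class of the zero cochain is a cycle.\<close>
    have "0 +o ?B q \<in> carrier (reduced_group q)"
      unfolding carrier_reduced_group using zero_cochain by (rule imageI)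
    then have "?B q \<in> carrier ?G"
      using reduced_diff_coset[OF zero_cochain[of q]] by (simp add: kernel_def)
    then show "carrier ?G \<noteq> {}" by blast
  next
    fix X assume "X \<in> carrier ?G"
    then obtain z where "z \<in> Z" "X = z +o ?B q"
      using exact[of X] by (auto simp: kernel_def)
    then have "Hr #>\<^bsub>?G\<^esub> X = (\<lambda>y. (y + z) +o ?B q) ` Z"
      by (auto simp: r_coset_def Hr absorb image_iff set_mult_plus)
    then show "Hr #>\<^bsub>?G\<^esub> X = Hr"
      using translate \<open>z \<in> Z\<close> by simp
  next
    have "0 \<in> Z" using Z by (auto simp: additive_subgroup_def)
    have "Hr <#>\<^bsub>?G\<^esub> Hr = (\<Union>y\<in>Z. (\<lambda>z. (z + y) +o ?B q) ` Z)"
      by (auto simp: set_mult_def Hr absorb)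
    then show "Hr <#>\<^bsub>?G\<^esub> Hr = Hr"
      using translate \<open>0 \<in> Z\<close> by auto
  qed
qed

end

section \<open>Pullback of cochains\<close>

context lca_module
begin

interpretation lV: module "lscale scaleV" by (rule V.module_lscale)

text \<open>
  Endomorphisms of the Lie conformal algebra that are compatible with the identity of the module.
\<close>

definition compatible_endo :: "('b \<Rightarrow> 'b) \<Rightarrow> bool"
  where "compatible_endo \<phi> \<longleftrightarrow>
    (\<forall>x y. \<phi> (x + y) = \<phi> x + \<phi> y) \<and> (\<forall>p x. \<phi> (scale p x) = scale p (\<phi> x)) \<and>
    (\<forall>x y. bracket (\<phi> x) (\<phi> y) = map_poly \<phi> (bracket x y)) \<and> (\<forall>x v. act (\<phi> x) v = act x v)"

lemma pullback_cochain:
  assumes f: "f \<in> basic_cochains q" and \<phi>: "compatible_endo \<phi>"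
  shows "(\<lambda>as. f (map \<phi> as)) \<in> basic_cochains q"
proof -
  have "permute_list \<pi> (map \<phi> as) = map \<phi> (permute_list \<pi> as)" if "\<pi> permutes {..<length as}" for \<pi> as
    using that by (simp add: permute_list_map)
  then show ?thesis
    using f \<phi> unfolding basic_cochains_def compatible_endo_def
    by (auto simp: map_update) (metis length_map)+
qed

text \<open>
  In the bracket terms, \<open>\<phi>\<close> moves from the arguments of the bracket to its coefficients.
\<close>

lemma basic_diff_pullback:
  assumes f: "f \<in> basic_cochains q" and \<phi>: "compatible_endo \<phi>"
  shows "basic_diff (\<lambda>as. f (map \<phi> as)) as = basic_diff f (map \<phi> as)"
proof -
  have \<phi>0: "\<phi> 0 = 0" using \<phi> unfolding compatible_endo_def by (metis add_cancel_right_left)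
  have "lext scaleV (\<lambda>x. cochain_at f Qs (\<phi> x # bs)) (leval scale (lvar k) p) =
      lext scaleV (\<lambda>x. cochain_at f Qs (x # bs)) (leval scale (lvar k) (map_poly \<phi> p))" for Qs bs k p
  proof -
    interpret g: additive_coefficient_map scaleV scale "\<lambda>x. cochain_at f Qs (x # bs)"
      by (rule cochain_Cons_map[OF f])
    interpret h: additive_coefficient_map scaleV scale "\<lambda>x. cochain_at f Qs (\<phi> x # bs)"
      using \<phi> by unfold_locales (simp add: compatible_endo_def g.g_add)
    have deg: "degree (map_poly \<phi> p) \<le> degree p"
      by (rule degree_le) (simp add: coeff_map_poly \<phi>0 coeff_eq_0)
    have "(\<Sum>i\<le>degree (map_poly \<phi> p). lscale scaleV (lvar k ^ i) (cochain_at f Qs (coeff (map_poly \<phi> p) i # bs))) =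
        (\<Sum>i\<le>degree p. lscale scaleV (lvar k ^ i) (cochain_at f Qs (coeff (map_poly \<phi> p) i # bs)))"
      using deg by (intro sum.mono_neutral_left) (auto simp: coeff_eq_0 g.g_0)
    then show ?thesis
      by (simp add: g.lext_leval h.lext_leval lambda_polys.var coeff_map_poly \<phi>0)
  qed
  moreover have "cochain_at (\<lambda>as. f (map \<phi> as)) Ps bs = cochain_at f Ps (map \<phi> bs)" for Ps bs
    by (simp add: cochain_at_def)
  ultimately show ?thesis
    using \<phi> by (simp add: basic_diff_def Let_def map_omit[symmetric] compatible_endo_def)
qed

text \<open>
  If \<open>\<phi> i\<close> is the \<open>i\<close>-th power of one endomorphism, this is \<open>Q\<close> evaluated at the pullback operator.
\<close>

definition weighted_pullback :: "'a poly \<Rightarrow> (nat \<Rightarrow> 'b \<Rightarrow> 'b) \<Rightarrow> ('b list \<Rightarrow> 'v lpoly) \<Rightarrow> 'b list \<Rightarrow> 'v lpoly"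
  where "weighted_pullback Q \<phi> f as =
    (\<Sum>i\<le>degree Q. lscale scaleV (lconst [:coeff Q i:]) (f (map (\<phi> i) as)))"

lemma weighted_pullback_cochain:
  assumes "f \<in> basic_cochains q" "\<And>i. compatible_endo (\<phi> i)"
  shows "weighted_pullback Q \<phi> f \<in> basic_cochains q"
proof -
  have "(\<lambda>as. \<Sum>i\<le>degree Q. lscale scaleV (lconst [:coeff Q i:]) (f (map (\<phi> i) as))) \<in> basic_cochains q"
    by (intro sum_cochain lscale_cochain pullback_cochain assms)
  then show ?thesis by (simp add: weighted_pullback_def[abs_def])
qed

lemma basic_diff_lscale:
  "basic_diff (\<lambda>as. lscale scaleV (lconst [:t:]) (f as)) = (\<lambda>as. lscale scaleV (lconst [:t:]) (basic_diff f as))"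
proof -
  have "cochain_on (\<lambda>as. lscale scaleV (lconst [:t:]) (f as)) = (\<lambda>zs. lscale scaleV (lconst [:t:]) (cochain_on f zs))"
    by (simp add: fun_eq_iff cochain_on_def cochain_at_def V.lsubst_lscale lsubst_ring_simps)
  then have "diff_at (cochain_on (\<lambda>as. lscale scaleV (lconst [:t:]) (f as))) zs =
      lscale scaleV (lconst [:t:]) (diff_at (cochain_on f) zs)" for zs
    by (simp only: diff_at_lscale[OF act_at_const])
  then show ?thesis
    by (simp add: fun_eq_iff basic_diff_eq)
qed

lemma basic_diff_sum: "basic_diff (\<lambda>as. \<Sum>i\<in>A. f i as) = (\<lambda>as. \<Sum>i\<in>A. basic_diff (f i) as)"
proof (induction A rule: infinite_finite_induct)
  case (insert i A)
  then show ?case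
    using basic_diff_add[of "f i" "\<lambda>as. \<Sum>i\<in>A. f i as"] by (simp add: plus_fun_def)
qed (use basic_diff_0 in \<open>simp_all add: zero_fun_def\<close>)

lemma basic_diff_weighted_pullback:
  assumes "f \<in> basic_cochains q" "\<And>i. compatible_endo (\<phi> i)"
  shows "basic_diff (weighted_pullback Q \<phi> f) = weighted_pullback Q \<phi> (basic_diff f)"
  unfolding weighted_pullback_def[abs_def]
  by (simp add: basic_diff_sum basic_diff_lscale basic_diff_pullback[OF assms])

lemma cochain_del_weighted_pullback:
  "weighted_pullback Q \<phi> (cochain_del f) = cochain_del (weighted_pullback Q \<phi> f)"
  by (simp add: fun_eq_iff weighted_pullback_def cochain_del_def lV.scale_sum_right mult.commute)

section \<open>The Lie derivative on eigenvectors\<close>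

text \<open>
  The part of the axioms of a cochain by which it is determined by its values on generators.
\<close>

definition slotwise_linear :: "nat \<Rightarrow> ('b list \<Rightarrow> 'v lpoly) \<Rightarrow> bool"
  where "slotwise_linear q h \<longleftrightarrow> (\<forall>as i. length as = q \<longrightarrow> i < q \<longrightarrow>
    (\<forall>x y. h (as[i := x + y]) = h (as[i := x]) + h (as[i := y])) \<and>
    (\<forall>t x. h (as[i := scale [:t:] x]) = lscale scaleV (lconst [:t:]) (h (as[i := x]))) \<and>
    (\<forall>x. h (as[i := scale [:0, 1:] x]) = lscale scaleV (- lvar i) (h (as[i := x]))))"

lemma slotwise_linearD:
  assumes "slotwise_linear q h" "length as = q" "i < q"
  shows "h (as[i := x + y]) = h (as[i := x]) + h (as[i := y])"
    and "h (as[i := scale [:t:] x]) = lscale scaleV (lconst [:t:]) (h (as[i := x]))"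
    and "h (as[i := scale [:0, 1:] x]) = lscale scaleV (- lvar i) (h (as[i := x]))"
  using assms unfolding slotwise_linear_def by blast+

lemma cochain_slotwise_linear: "f \<in> basic_cochains q \<Longrightarrow> slotwise_linear q f"
  by (simp add: basic_cochains_def slotwise_linear_def)

lemma slotwise_linear_add:
  "slotwise_linear q g \<Longrightarrow> slotwise_linear q h \<Longrightarrow> slotwise_linear q (\<lambda>as. g as + h as)"
  by (simp add: slotwise_linear_def lV.scale_right_distrib)

lemma slotwise_linear_uminus: "slotwise_linear q h \<Longrightarrow> slotwise_linear q (\<lambda>as. - h as)"
  by (simp add: slotwise_linear_def)

lemma slotwise_linear_sum:
  "(\<And>i. i \<in> A \<Longrightarrow> slotwise_linear q (h i)) \<Longrightarrow> slotwise_linear q (\<lambda>as. \<Sum>i\<in>A. h i as)"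
proof (induction A rule: infinite_finite_induct)
  case (insert i A)
  then show ?case using slotwise_linear_add[of q "h i"] by simp
qed (simp_all add: slotwise_linear_def)

lemma bracket_0_coeff:
  "coeff (bracket a (x + y)) 0 = coeff (bracket a x) 0 + coeff (bracket a y) 0"
  "coeff (bracket a (scale [:t:] x)) 0 = scale [:t:] (coeff (bracket a x) 0)"
  "coeff (bracket a (scale [:0, 1:] x)) 0 = scale [:0, 1:] (coeff (bracket a x) 0)"
  by (simp_all add: bracket_add_right bracket_scale_right bracket_del_right coeff_map_poly)

lemma lie_slotwise_linear:
  assumes f: "f \<in> basic_cochains q"
  shows "slotwise_linear q (lie a f)"
proof -
  have L: "slotwise_linear q f" by (rule cochain_slotwise_linear[OF f])
  let ?g = "\<lambda>v. lconst (coeff (act a v) 0) :: 'v lpoly"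
  have g: "?g (v + w) = ?g v + ?g w" "?g (scaleV [:t:] v) = lscale scaleV (lconst [:t:]) (?g v)" for v w t
    by (simp_all add: act_add_right act_scale_right coeff_map_poly lconst_add V.lscale_lconst)
  have 1: "slotwise_linear q (\<lambda>as. lext scaleV ?g (f as))"
    using L unfolding slotwise_linear_def
    by (simp add: V.lext_add[of ?g, OF g(1)] V.lext_uminus[of ?g, OF g(1)]
        lext_lscale_lvar[OF V.module_axioms V.module_axioms g(1)]
        lext_lscale_lconst[OF V.module_axioms V.module_axioms g(1) g(2)])
  have 2: "slotwise_linear q (\<lambda>as. f (as[l := coeff (bracket a (as ! l)) 0]))" if "l < q" for l
    unfolding slotwise_linear_def
  proof (intro allI impI)
    fix as :: "'b list" and i assume *: "length as = q" "i < q"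
    \<comment> \<open>The argument that is varied is transformed if it is the one bracketed, and untouched otherwise.\<close>
    define c where "c = (if i = l then (\<lambda>x. coeff (bracket a x) 0) else id)"
    define bs where "bs = (if i = l then as else as[l := coeff (bracket a (as ! l)) 0])"
    have eq: "(as[i := x])[l := coeff (bracket a (as[i := x] ! l)) 0] = bs[i := c x]" for x
      using * that by (auto simp: bs_def c_def list_update_swap)
    have "length bs = q" using * by (simp add: bs_def)
    moreover have "c (x + y) = c x + c y" "c (scale [:t:] x) = scale [:t:] (c x)"
        "c (scale [:0, 1:] x) = scale [:0, 1:] (c x)" for x y t
      by (simp_all add: c_def bracket_0_coeff)
    ultimately show "(\<forall>x y. f (as[i := x + y, l := coeff (bracket a (as[i := x + y] ! l)) 0]) =
          f (as[i := x, l := coeff (bracket a (as[i := x] ! l)) 0]) +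
          f (as[i := y, l := coeff (bracket a (as[i := y] ! l)) 0])) \<and>
        (\<forall>t x. f (as[i := scale [:t:] x, l := coeff (bracket a (as[i := scale [:t:] x] ! l)) 0]) =
          lscale scaleV (lconst [:t:]) (f (as[i := x, l := coeff (bracket a (as[i := x] ! l)) 0]))) \<and>
        (\<forall>x. f (as[i := scale [:0, 1:] x, l := coeff (bracket a (as[i := scale [:0, 1:] x] ! l)) 0]) =
          lscale scaleV (- lvar i) (f (as[i := x, l := coeff (bracket a (as[i := x] ! l)) 0])))"
      using slotwise_linearD[OF L, of bs i] * unfolding eq by simp
  qed
  have "slotwise_linear q (\<lambda>as. lext scaleV ?g (f as) + - (\<Sum>l<q. f (as[l := coeff (bracket a (as ! l)) 0])))"
    using 1 2 by (intro slotwise_linear_add slotwise_linear_uminus slotwise_linear_sum) auto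
  then show ?thesis
    by (simp add: slotwise_linear_def lie_def)
qed

lemma slotwise_linear_eigenvector:
  assumes "slotwise_linear q h" "length as + length gs = q"
  shows "h (as @ map (\<lambda>g. scale [:c g:] (e g)) gs) =
    lscale scaleV (lconst [:prod_list (map c gs):]) (h (as @ map e gs))"
  using assms(2)
proof (induction gs arbitrary: as)
  case Nil
  then show ?case by (simp add: lconst_1 V.lscale_1 flip: one_pCons)
next
  case (Cons g gs)
  let ?bs = "map (\<lambda>g. scale [:c g:] (e g)) gs"
  have "h ((as @ e g # ?bs)[length as := scale [:c g:] (e g)]) =
      lscale scaleV (lconst [:c g:]) (h ((as @ e g # ?bs)[length as := e g]))"
    using Cons.prems by (intro slotwise_linearD[OF assms(1)]) auto
  then have "h (as @ scale [:c g:] (e g) # ?bs) = lscale scaleV (lconst [:c g:]) (h ((as @ [e g]) @ ?bs))"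
    by simp
  also have "\<dots> = lscale scaleV (lconst [:c g:] * lconst [:prod_list (map c gs):]) (h ((as @ [e g]) @ map e gs))"
    using Cons.prems by (subst Cons.IH) simp_all
  finally show ?case
    by (simp add: mult.commute flip: lconst_mult)
qed

text \<open>
  Each summand of the Lie derivative changes a single argument and contributes the eigenvalue of that argument.
\<close>

lemma lie_eigenvector:
  assumes f: "f \<in> basic_cochains q" and "length gs = q"
    and \<beta>: "\<And>v. coeff (act a v) 0 = scaleV [:\<beta>:] v"
    and w: "\<And>g. coeff (bracket a (e g)) 0 = scale [:w g:] (e g)"
  shows "lie a f (map e gs) = lscale scaleV (lconst [:\<beta> - sum_list (map w gs):]) (f (map e gs))"
proof -
  have "lext scaleV (\<lambda>v. lconst (coeff (act a v) 0)) p = lscale scaleV (lconst [:\<beta>:]) p" for p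
    unfolding \<beta>
  proof (induction p rule: poly_mapping_additive_induct)
    case (1 n v)
    then show ?case by (simp add: V.lext_single V.lscale_single lconst_def)
  next
    case (2 p q)
    then show ?case
      by (subst V.lext_add) (simp_all add: V.scale_right_distrib lconst_add lV.scale_right_distrib)
  qed
  moreover have "f ((map e gs)[i := coeff (bracket a (map e gs ! i)) 0]) =
      lscale scaleV (lconst [:w (gs ! i):]) (f (map e gs))" if "i < q" for i
    using slotwise_linearD(2)[OF cochain_slotwise_linear[OF f], of "map e gs" i "w (gs ! i)" "e (gs ! i)"]
      that assms(2) list_update_id[of "map e gs" i] by (simp add: w)
  moreover have "(\<Sum>i<q. lscale scaleV (lconst [:w (gs ! i):]) (f (map e gs))) =
      lscale scaleV (lconst [:sum_list (map w gs):]) (f (map e gs))"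
  proof -
    have "(\<Sum>i<n. lconst [:u i:]) = (lconst [:\<Sum>i<n. u i:] :: 'a poly lpoly)" for u :: "nat \<Rightarrow> 'a" and n
      by (induction n) (simp_all flip: lconst_add)
    then show ?thesis
      using assms(2) by (simp add: sum_list_sum_nth atLeast0LessThan flip: lV.scale_sum_left)
  qed
  ultimately show ?thesis
    using assms(2) by (simp add: lie_def flip: lV.scale_left_diff_distrib)
      (simp add: diff_conv_add_uminus flip: lconst_uminus lconst_add del: add_uminus_conv_diff)
qed

end

text \<open>
  Newton interpolation: the correction added for a new point vanishes at the previous ones.
\<close>

lemma interpolation_polynomial:
  fixes x y :: "nat \<Rightarrow> 'a::field"
  assumes "inj x"
  shows "\<exists>Q. \<forall>i<n. poly Q (x i) = y i"
proof (induction n)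
  case (Suc n)
  then obtain Q where Q: "\<And>i. i < n \<Longrightarrow> poly Q (x i) = y i" by blast
  define R where "R = (\<Prod>j<n. [:- x j, 1:])"
  have "poly R (x n) \<noteq> 0"
    using assms by (auto simp: R_def poly_prod inj_def)
  moreover have "poly R (x i) = 0" if "i < n" for i
    using that by (auto simp: R_def poly_prod)
  ultimately have "poly (Q + smult ((y n - poly Q (x n)) / poly R (x n)) R) (x i) = y i" if "i < Suc n" for i
    using that Q by (cases "i = n") auto
  then show ?case by blast
qed simp

section \<open>The extended Schroedinger-Virasoro algebra\<close>

text \<open>
  The eigenvalues of the coefficient at \<open>\<lambda>\<^sup>0\<close> of \<open>[N\<^sub>\<lambda> _]\<close>; see \<open>bracket_N_0\<close>.
\<close>

fun weight :: "sv_gen \<Rightarrow> nat" where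
  "weight gL = 0" | "weight gN = 0" | "weight gY = 1" | "weight gM = 2"

abbreviation generator :: "sv_gen \<Rightarrow> (sv_gen \<Rightarrow>\<^sub>0 'a::field_char_0 poly)"
  where "generator g \<equiv> Poly_Mapping.single g 1"

definition rescale :: "'a::field_char_0 \<Rightarrow> (sv_gen \<Rightarrow>\<^sub>0 'a poly) \<Rightarrow> (sv_gen \<Rightarrow>\<^sub>0 'a poly)"
  where "rescale c = Poly_Mapping.mapp (\<lambda>g p. [:c ^ weight g:] * p)"

lemma lookup_rescale: "Poly_Mapping.lookup (rescale c x) g = [:c ^ weight g:] * Poly_Mapping.lookup x g"
  by (simp add: rescale_def lookup_mapp when_def not_in_keys_iff_lookup_eq_zero)

lemma rescale_add: "rescale c (x + y) = rescale c x + rescale c y"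
  by (intro poly_mapping_eqI) (simp only: lookup_rescale lookup_add distrib_left)

lemma rescale_scale: "rescale c (free_scale p x) = free_scale p (rescale c x)"
  by (intro poly_mapping_eqI) (simp only: lookup_rescale lookup_free_scale mult.left_commute)

lemma rescale_0 [simp]: "rescale c 0 = 0"
  using rescale_add[of c 0 0] by simp

lemma rescale_single: "rescale c (Poly_Mapping.single g p) = Poly_Mapping.single g ([:c ^ weight g:] * p)"
  by (intro poly_mapping_eqI) (simp add: lookup_rescale lookup_single when_def)

lemma free_scale_single: "free_scale p (Poly_Mapping.single g q) = Poly_Mapping.single g (p * q)"
  by (intro poly_mapping_eqI) (simp add: lookup_single when_def)

lemma rescale_generator: "rescale c (generator g) = free_scale [:c ^ weight g:] (generator g)"
  by (simp add: rescale_single free_scale_single)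

lemma map_poly_rescale_simps:
  fixes p q :: "(sv_gen \<Rightarrow>\<^sub>0 'a::field_char_0 poly) poly"
  shows "map_poly (rescale c) (p + q) = map_poly (rescale c) p + map_poly (rescale c) q"
  "map_poly (rescale c) (- p) = - map_poly (rescale c) p"
  "map_poly (rescale c) (map_poly (free_scale r) p) = map_poly (free_scale r) (map_poly (rescale c) p)"
  "map_poly (rescale c) (pCons x p) = pCons (rescale c x) (map_poly (rescale c) p)"
proof -
  have neg: "rescale c (- x) = - rescale c x" for x
    using rescale_add[of c x "- x"] by (simp add: eq_neg_iff_add_eq_0 add.commute)
  have zero: "free_scale r (0 :: sv_gen \<Rightarrow>\<^sub>0 'a poly) = 0"
    by (rule module.scale_zero_right[OF module_free_scale])
  show "map_poly (rescale c) (p + q) = map_poly (rescale c) p + map_poly (rescale c) q"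
    by (intro poly_eqI) (simp add: coeff_map_poly rescale_add)
  show "map_poly (rescale c) (- p) = - map_poly (rescale c) p"
    by (intro poly_eqI) (simp add: coeff_map_poly neg)
  show "map_poly (rescale c) (map_poly (free_scale r) p) = map_poly (free_scale r) (map_poly (rescale c) p)"
    by (intro poly_eqI) (simp add: coeff_map_poly zero rescale_scale)
  show "map_poly (rescale c) (pCons x p) = pCons (rescale c x) (map_poly (rescale c) p)"
    by (rule map_poly_pCons) simp
qed

context
  fixes \<Delta> \<beta> :: "'a::field_char_0"
begin

interpretation sv: lca_module free_scale sv_bracket "(*)" "sv_act \<Delta> \<beta>"
  by (rule sv_lca_module)

text \<open>
  The brackets of generators preserve the total weight.
\<close>

lemma rescale_bracket:
  fixes c :: 'a
  shows "sv_bracket (rescale c x) (rescale c y) = map_poly (rescale c) (sv_bracket x y)"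
proof -
  have gen: "sv_bracket (rescale c (generator g)) (rescale c (generator h)) =
      map_poly (rescale c) (sv_bracket (generator g) (generator h))" for g h
    unfolding rescale_generator sv.bracket_scale_left sv.bracket_scale_right sv_bracket_gen
    by (cases g; cases h)
       (simp_all add: map_poly_rescale_simps map_poly_pCons rescale_single free_scale_single power2_eq_square mult_ac)
  have "sv_bracket (rescale c (generator g)) (rescale c y) = map_poly (rescale c) (sv_bracket (generator g) y)" for g
    by (induction y rule: free_induct)
       (simp_all add: gen rescale_add rescale_scale sv.bracket_add_right sv.bracket_scale_right
         sv.bracket_del_right map_poly_rescale_simps)
  then show ?thesis
    by (induction x rule: free_induct)
       (simp_all add: rescale_add rescale_scale sv.bracket_add_left sv.bracket_scale_left
         sv.bracket_del_left map_poly_rescale_simps)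
qed

text \<open>
  The generators \<open>Y\<close> and \<open>M\<close> of positive weight act by \<open>0\<close>.
\<close>

lemma rescale_act: "sv_act \<Delta> \<beta> (rescale c x) v = sv_act \<Delta> \<beta> x v"
proof -
  have 0: "sv_act \<Delta> \<beta> (generator g) v = 0" if "g = gM \<or> g = gY" for g v
  proof (induction v rule: poly_module_induct)
    case (2 x t)
    then show ?case using sv.act_scale_right[of "generator g" t x] by simp
  next
    case (3 x)
    then show ?case using sv.act_del_right[of "generator g" x] by simp
  qed (use that in \<open>auto simp: sv.act_add_right sv_act_gen\<close>)
  have gen: "sv_act \<Delta> \<beta> (rescale c (generator g)) v = sv_act \<Delta> \<beta> (generator g) v" for g
    unfolding rescale_generator sv.act_scale_left
    by (cases g) (simp_all add: 0 map_poly_idI flip: one_pCons)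
  show ?thesis
    by (induction x rule: free_induct)
       (simp_all add: gen rescale_add rescale_scale sv.act_add_left sv.act_scale_left sv.act_del_left)
qed

lemma rescale_compatible: "sv.compatible_endo (rescale c)"
  unfolding sv.compatible_endo_def
  by (simp add: rescale_add rescale_scale rescale_bracket rescale_act)

lemma act_N_0: "coeff (sv_act \<Delta> \<beta> (generator gN) v) 0 = [:\<beta>:] * v"
proof (induction v rule: poly_module_induct)
  case (1 x y)
  then show ?case by (simp only: sv.act_add_right coeff_add distrib_left)
next
  case (2 x t)
  then show ?case by (simp only: sv.act_scale_right) (simp add: coeff_map_poly mult.commute)
next
  case (3 x)
  then show ?case by (simp only: sv.act_del_right) (simp add: coeff_map_poly)
qed (simp add: sv_act_gen)

lemma bracket_N_0:
  "coeff (sv_bracket (generator gN) (generator g)) 0 = free_scale [:of_nat (weight g):] (generator g)"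
  by (cases g) (simp_all add: sv_bracket_gen free_scale_single)

lemma slotwise_linear_generators:
  assumes h: "sv.slotwise_linear q h" and gens: "\<And>gs. length gs = q \<Longrightarrow> h (map generator gs) = 0"
    and "length as = q"
  shows "h as = 0"
proof -
  have "h (bs @ map generator gs) = 0" if "length bs + length gs = q" for bs gs
    using that
  proof (induction bs arbitrary: gs rule: rev_induct)
    case Nil
    then show ?case by (simp add: gens)
  next
    case (snoc b bs)
    let ?as = "bs @ b # map generator gs"
    have len: "length ?as = q" "length bs < q" using snoc.prems by auto
    note lin = sv.slotwise_linearD[OF h len]
    interpret l: module "lscale ((*) :: 'a poly \<Rightarrow> _)" by (rule sv.V.module_lscale)
    have "h (?as[length bs := x]) = 0" for x
    proof (induction x rule: free_induct)
      case (4 g)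
      then show ?case using snoc.IH[of "g # gs"] snoc.prems by simp
    qed (simp_all only: lin l.scale_zero_right add_0_right)
    from this[of b] show ?case by simp
  qed
  from this[of as "[]"] show ?thesis using assms(3) by simp
qed

text \<open>
  On generators of total weight \<open>w \<le> 2q\<close>, the pullback for \<open>2\<^sup>i\<close> is multiplication by \<open>(2\<^sup>i)\<^sup>w = (2\<^sup>w)\<^sup>i\<close>, so the
  weighted pullback is multiplication by \<open>Q(2\<^sup>w)\<close>.  The points \<open>2\<^sup>w\<close> are distinct in characteristic
  \<open>0\<close>, and \<open>Q\<close> is chosen to take the value \<open>1/(\<beta> - w)\<close> at each of them.
\<close>

lemma lie_N_inverse:
  assumes \<beta>: "\<And>n. \<beta> \<noteq> of_nat n"
  shows "\<exists>Q. \<forall>f\<in>sv.basic_cochains q. \<forall>as. length as = q \<longrightarrow>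
    sv.lie (generator gN) (sv.weighted_pullback Q (\<lambda>i. rescale (2 ^ i)) f) as = f as"
proof -
  have "inj (\<lambda>w. 2 ^ w :: 'a)"
  proof (rule injI)
    fix v w :: nat assume "(2 :: 'a) ^ v = 2 ^ w"
    then have "of_nat (2 ^ v) = (of_nat (2 ^ w) :: 'a)" by simp
    then show "v = w" by (simp only: of_nat_eq_iff) simp
  qed
  then obtain Q where Q: "poly Q (2 ^ w) = inverse (\<beta> - of_nat w)" if "w < Suc (2 * q)" for w
    using interpolation_polynomial[of "\<lambda>w. 2 ^ w :: 'a" "Suc (2 * q)" "\<lambda>w. inverse (\<beta> - of_nat w)"] by blast
  let ?T = "sv.weighted_pullback Q (\<lambda>i. rescale (2 ^ i))"
  interpret l: module "lscale ((*) :: 'a poly \<Rightarrow> _)" by (rule sv.V.module_lscale)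
  have "sv.lie (generator gN) (?T f) as = f as" if f: "f \<in> sv.basic_cochains q" and "length as = q" for f as
  proof -
    have T: "?T f \<in> sv.basic_cochains q"
      by (intro sv.weighted_pullback_cochain f rescale_compatible)
    have "sv.slotwise_linear q (\<lambda>as. sv.lie (generator gN) (?T f) as + - f as)"
      by (intro sv.slotwise_linear_add sv.slotwise_linear_uminus sv.lie_slotwise_linear
          sv.cochain_slotwise_linear T f)
    moreover have "sv.lie (generator gN) (?T f) (map generator gs) + - f (map generator gs) = 0"
      if gs: "length gs = q" for gs
    proof -
      let ?W = "sum_list (map weight gs)"
      have "weight g \<le> 2" for g by (cases g) auto
      then have W: "?W < Suc (2 * q)"
        using sum_list_mono[of gs weight "\<lambda>_. 2"] gs by (simp add: sum_list_triv)
      have prod: "prod_list (map (\<lambda>g. c ^ weight g) gs') = c ^ sum_list (map weight gs')" for c :: 'a and gs'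
        by (induction gs') (simp_all add: power_add)
      have "f (map (rescale (2 ^ i)) (map generator gs)) = lscale (*) (lconst [:(2 ^ i) ^ ?W:]) (f (map generator gs))" for i
        using sv.slotwise_linear_eigenvector[OF sv.cochain_slotwise_linear[OF f], of "[]" gs "\<lambda>g. (2 ^ i) ^ weight g" generator] gs
        by (simp add: rescale_generator comp_def prod)
      then have "?T f (map generator gs) = (\<Sum>i\<le>degree Q. lscale (*) (lconst [:coeff Q i * (2 ^ ?W) ^ i:]) (f (map generator gs)))"
        unfolding sv.weighted_pullback_def
        by (intro sum.cong refl) (simp add: flip: lconst_mult power_mult, simp add: mult.commute)
      also have "\<dots> = lscale (*) (lconst [:poly Q (2 ^ ?W):]) (f (map generator gs))"
      proof -
        have "(\<Sum>i\<le>n. lconst [:u i:]) = (lconst [:\<Sum>i\<le>n. u i:] :: 'a poly lpoly)" for u :: "nat \<Rightarrow> 'a" and n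
          by (induction n) (simp_all flip: lconst_add)
        then show ?thesis by (simp add: poly_altdef flip: l.scale_sum_left)
      qed
      finally have T_gs: "?T f (map generator gs) = lscale (*) (lconst [:inverse (\<beta> - of_nat ?W):]) (f (map generator gs))"
        by (simp add: Q[OF W])
      have "sum_list (map (\<lambda>g. of_nat (weight g)) gs) = (of_nat ?W :: 'a)"
        by (induction gs) simp_all
      then have "sv.lie (generator gN) (?T f) (map generator gs) =
          lscale (*) (lconst [:\<beta> - of_nat ?W:]) (?T f (map generator gs))"
        using sv.lie_eigenvector[OF T gs act_N_0 bracket_N_0] by simp
      also have "\<dots> = f (map generator gs)"
        using \<beta>[of ?W] by (simp add: T_gs lconst_1 sv.V.lscale_1 flip: lconst_mult one_pCons)
      finally show ?thesis by simp
    qed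
    ultimately have "sv.lie (generator gN) (?T f) as + - f as = 0"
      using \<open>length as = q\<close> by (rule slotwise_linear_generators)
    then show ?thesis by simp
  qed
  then show ?thesis by blast
qed

lemma sv_cohomology_vanishes:
  assumes \<beta>: "\<And>n. \<beta> \<noteq> of_nat n"
  shows "trivial_group (sv.basic_cohomology q)" "trivial_group (sv.reduced_cohomology q)"
proof -
  obtain Q where Q: "sv.lie (generator gN) (sv.weighted_pullback Q (\<lambda>i. rescale (2 ^ i)) f) as = f as"
    if "f \<in> sv.basic_cochains q" "length as = q" for f as
    using lie_N_inverse[OF \<beta>, of q] by blast
  let ?T = "sv.weighted_pullback Q (\<lambda>i. rescale (2 ^ i))"
  have T0: "?T 0 = 0"
  proof -
    interpret l: module "lscale ((*) :: 'a poly \<Rightarrow> _)" by (rule sv.V.module_lscale)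
    show ?thesis by (simp add: fun_eq_iff sv.weighted_pullback_def)
  qed
  note * = sv.cohomology_vanishes[of ?T q "generator gN", OF
      sv.weighted_pullback_cochain[OF _ rescale_compatible]
      sv.basic_diff_weighted_pullback[OF _ rescale_compatible]
      sv.cochain_del_weighted_pullback T0 Q]
  show "trivial_group (sv.basic_cohomology q)" "trivial_group (sv.reduced_cohomology q)"
    by (rule *; assumption)+
qed

end

theorem theorem4p15:
  fixes \<Delta> \<beta> :: "'a::field_char_0"
  assumes "\<beta> \<notin> \<int> \<or> (\<exists>n::int. n < 0 \<and> \<beta> = of_int n)"
  shows "\<forall>q. trivial_group
           (lca_module.basic_cohomology free_scale sv_bracket (*) (sv_act \<Delta> \<beta>) q) \<and>
         trivial_group
           (lca_module.reduced_cohomology free_scale sv_bracket (*) (sv_act \<Delta> \<beta>) q)"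
proof -
  have "\<beta> \<noteq> of_nat n" for n
  proof
    assume n: "\<beta> = of_nat n"
    with assms obtain k :: int where "k < 0" "\<beta> = of_int k" by (auto simp: Ints_of_nat)
    with n have "of_int k = (of_int (int n) :: 'a)" by simp
    with \<open>k < 0\<close> show False by (simp only: of_int_eq_iff)
  qed
  then show ?thesis by (blast intro: sv_cohomology_vanishes)
qed

end
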